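(* Let $\alpha,\beta\in\mathbb{C}$ be nonzero with $|\alpha|^2+|\beta|^2=1$, and let $\mathcal{M}\subseteq H^2_{\alpha,\beta}$ be a nonzero closed subspace. Then $S_{\alpha,\beta}\mathcal{M}\subseteq\mathcal{M}$ if and only if there exists an inner function $\theta$ such that either $\mathcal{M}=z^2\theta H^2(\mathbb{D})$, or $\theta(\alpha\bar\beta)\ne0$ and $\mathcal{M}$ can be written as $$\mathcal{M}=\mathbb{C}f\oplus z^2\theta H^2(\mathbb{D}),$$ where $f=f_0+z^2g$ for some $g\in H^2(\mathbb{D})\ominus\theta H^2(\mathbb{D})$ satisfying $$(z-\alpha\bar\beta)\,g(z)=\frac{\beta}{\theta(\alpha\bar\beta)}\big(\theta(z)-\theta(\alpha\bar\beta)\big).$$ Moreover, every such $\mathcal{M}$ is cyclic; in the second case $\mathcal{M}=[f]_{S_{\alpha,\beta}}$.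
   Context: $H^2(\mathbb{D})$ is the Hardy space of the open unit disc. Put $f_0=\alpha+\beta z$ and $H^2_{\alpha,\beta}=\overline{\mathrm{span}}\{f_0,\ z^n: n\ge 2\}$, a closed subspace of $H^2(\mathbb{D})$. Let $P_{H^2_{\alpha,\beta}}$ be the orthogonal projection of $H^2(\mathbb{D})$ onto $H^2_{\alpha,\beta}$, $M_z$ multiplication by $z$ on $H^2(\mathbb{D})$, and $S_{\alpha,\beta}=P_{H^2_{\alpha,\beta}}M_z|_{H^2_{\alpha,\beta}}$. $\oplus$ denotes orthogonal direct sum. For an operator $T$ on a Hilbert space, $[h]_T$ is the closed linear span of $\{T^nh:n\ge0\}$; a closed $T$-invariant subspace $\mathcal{M}$ is cyclic if $\mathcal{M}=[h]_T$ for some $h\in\mathcal{M}$. *)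

theory Defs
  imports "HOL-Complex_Analysis.Complex_Analysis"
begin

section \<open>The Hardy space of the unit disc\<close>

definition taylor :: "(complex \<Rightarrow> complex) \<Rightarrow> nat \<Rightarrow> complex" where
  "taylor f n = fps_nth (fps_expansion f 0) n"

lemma taylor_altdef: "taylor f n = (deriv ^^ n) f 0 / fact n"
  by (simp add: taylor_def fps_expansion_def)

lemma holomorphic_has_fps_expansion:
  assumes "f holomorphic_on ball 0 1"
  shows "f has_fps_expansion fps_expansion f 0"
proof -
  have "f analytic_on {0}"
    using assms by (simp add: analytic_at) (metis centre_in_ball open_ball zero_less_one)
  thus ?thesis
    by (rule analytic_at_imp_has_fps_expansion_0)
qed

lemma taylor_eqI: "f has_fps_expansion F \<Longrightarrow> taylor f n = fps_nth F n"
  by (simp add: taylor_def fps_expansion_eqI)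

lemma taylor_add:
  assumes "f holomorphic_on ball 0 1" "g holomorphic_on ball 0 1"
  shows "taylor (\<lambda>z. f z + g z) n = taylor f n + taylor g n"
  using taylor_eqI[OF has_fps_expansion_add[OF assms[THEN holomorphic_has_fps_expansion]]]
  by (simp add: taylor_def)

lemma taylor_cmult:
  assumes "f holomorphic_on ball 0 1"
  shows "taylor (\<lambda>z. c * f z) n = c * taylor f n"
  using taylor_eqI[OF has_fps_expansion_cmult_left[OF holomorphic_has_fps_expansion[OF assms]]]
  by (simp add: taylor_def)

lemma taylor_shift:
  assumes "f holomorphic_on ball 0 1"
  shows "taylor (\<lambda>z. z * f z) n = (if n = 0 then 0 else taylor f (n - 1))"
  using taylor_eqI[OF has_fps_expansion_mult[OF has_fps_expansion_fps_X
      holomorphic_has_fps_expansion[OF assms]]]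
  by (simp add: taylor_def)

lemma taylor_zero: "taylor (\<lambda>_. 0) n = 0"
  using taylor_eqI[OF has_fps_expansion_0] by simp

lemma taylor_monom:
  "taylor (\<lambda>z. if z \<in> ball 0 1 then z ^ k else 0) n = (if n = k then 1 else 0)"
proof -
  have "eventually (\<lambda>z::complex. z \<in> ball 0 1) (nhds 0)"
    by (intro eventually_nhds_in_open) auto
  hence "eventually (\<lambda>z::complex. (if z \<in> ball 0 1 then z ^ k else 0) = z ^ k) (nhds 0)"
    by eventually_elim auto
  hence "(\<lambda>z::complex. if z \<in> ball 0 1 then z ^ k else 0) has_fps_expansion fps_X ^ k"
    using has_fps_expansion_fps_X_power[of k] by (subst has_fps_expansion_cong) auto
  from taylor_eqI[OF this] show ?thesis by simp
qed

lemma taylor_sums: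
  assumes "f holomorphic_on ball 0 1" "z \<in> ball 0 1"
  shows "(\<lambda>n. taylor f n * z ^ n) sums f z"
  using holomorphic_power_series[OF assms] by (simp add: taylor_altdef)

lemma summable_norm_mult:
  fixes a b :: "nat \<Rightarrow> complex"
  assumes "summable (\<lambda>n. (cmod (a n))\<^sup>2)" "summable (\<lambda>n. (cmod (b n))\<^sup>2)"
  shows "summable (\<lambda>n. cmod (a n) * cmod (b n))"
proof (rule summable_comparison_test)
  show "summable (\<lambda>n. (cmod (a n))\<^sup>2 + (cmod (b n))\<^sup>2)"
    using assms by (rule summable_add)
  have "x * y \<le> x\<^sup>2 + y\<^sup>2" if "x \<ge> 0" "y \<ge> 0" for x y :: real
    using that sum_squares_bound[of x y] mult_nonneg_nonneg[OF that] by linarith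
  thus "\<exists>N. \<forall>n\<ge>N. norm (cmod (a n) * cmod (b n)) \<le> (cmod (a n))\<^sup>2 + (cmod (b n))\<^sup>2"
    by auto
qed

lemma summable_square_add:
  fixes a b :: "nat \<Rightarrow> complex"
  assumes "summable (\<lambda>n. (cmod (a n))\<^sup>2)" "summable (\<lambda>n. (cmod (b n))\<^sup>2)"
  shows "summable (\<lambda>n. (cmod (a n + b n))\<^sup>2)"
proof (rule summable_comparison_test)
  show "summable (\<lambda>n. (cmod (a n))\<^sup>2 + 2 * (cmod (a n) * cmod (b n)) + (cmod (b n))\<^sup>2)"
    using assms by (intro summable_add summable_mult summable_norm_mult)
  have "(cmod (a n + b n))\<^sup>2 \<le> (cmod (a n))\<^sup>2 + 2 * (cmod (a n) * cmod (b n)) + (cmod (b n))\<^sup>2" for n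
    using power_mono[OF norm_triangle_ineq[of "a n" "b n"] norm_ge_zero, of 2]
    by (simp add: power2_sum algebra_simps)
  thus "\<exists>N. \<forall>n\<ge>N. norm ((cmod (a n + b n))\<^sup>2) \<le>
      (cmod (a n))\<^sup>2 + 2 * (cmod (a n) * cmod (b n)) + (cmod (b n))\<^sup>2"
    by auto
qed

lemma summable_square_cmult:
  fixes a :: "nat \<Rightarrow> complex"
  assumes "summable (\<lambda>n. (cmod (a n))\<^sup>2)"
  shows "summable (\<lambda>n. (cmod (c * a n))\<^sup>2)"
  using summable_mult[OF assms, of "(cmod c)\<^sup>2"] by (simp add: norm_mult power_mult_distrib)

text \<open>
  Elements of \<open>H\<^sup>2\<close> are the holomorphic functions on the open unit disc with square-summable
  Taylor coefficients at 0. They are extended by 0 to the complement of the disc, so that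
  equality of elements is equality of functions on the disc.
\<close>

typedef hardy =
  "{f :: complex \<Rightarrow> complex. f holomorphic_on ball 0 1 \<and> (\<forall>z. z \<notin> ball 0 1 \<longrightarrow> f z = 0) \<and>
     summable (\<lambda>n. (cmod (taylor f n))\<^sup>2)}"
  morphisms hfun Abs_hardy
  by (rule exI[of _ "\<lambda>_. 0"]) (auto simp: taylor_zero)

setup_lifting type_definition_hardy

definition hcoeff :: "hardy \<Rightarrow> nat \<Rightarrow> complex" where
  "hcoeff f = taylor (hfun f)"

lemma hfun_holomorphic: "hfun f holomorphic_on ball 0 1"
  using hfun[of f] by simp

lemma hfun_outside: "z \<notin> ball 0 1 \<Longrightarrow> hfun f z = 0"
  using hfun[of f] by simp

lemma hcoeff_summable: "summable (\<lambda>n. (cmod (hcoeff f n))\<^sup>2)"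
  using hfun[of f] by (simp add: hcoeff_def)

lemma hfun_sums: "z \<in> ball 0 1 \<Longrightarrow> (\<lambda>n. hcoeff f n * z ^ n) sums hfun f z"
  unfolding hcoeff_def by (rule taylor_sums[OF hfun_holomorphic])

lemma hardy_eqI: "(\<And>z. z \<in> ball 0 1 \<Longrightarrow> hfun f z = hfun g z) \<Longrightarrow> f = g"
  by (metis hfun_inject hfun_outside ext)

lemma hardy_eq_hcoeffI: "(\<And>n. hcoeff f n = hcoeff g n) \<Longrightarrow> f = g"
  by (rule hardy_eqI) (metis (no_types, lifting) ext hfun_sums sums_unique2)

lift_definition hscale :: "complex \<Rightarrow> hardy \<Rightarrow> hardy" is "\<lambda>c f z. c * f z"
  by (auto intro!: holomorphic_intros simp: taylor_cmult summable_square_cmult)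

lift_definition hmonom :: "nat \<Rightarrow> hardy" is "\<lambda>n z. if z \<in> ball 0 1 then z ^ n else 0"
proof (safe, goal_cases)
  case (1 n)
  show ?case
    by (rule holomorphic_transform[of "\<lambda>z. z ^ n"]) (auto intro!: holomorphic_intros)
next
  case (3 n)
  show ?case unfolding taylor_monom
    by (rule summable_finite[of "{n}"]) auto
qed auto

lift_definition mult_z :: "hardy \<Rightarrow> hardy" is "\<lambda>f z. z * f z"
proof (safe, goal_cases)
  case (3 f)
  have "summable (\<lambda>n. (cmod (taylor (\<lambda>z. z * f z) (Suc n)))\<^sup>2)"
    using 3 by (simp add: taylor_shift)
  thus ?case by (subst (asm) summable_Suc_iff)
qed (auto intro!: holomorphic_intros)

definition hinner :: "hardy \<Rightarrow> hardy \<Rightarrow> complex" where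
  "hinner f g = (\<Sum>n. hcoeff f n * cnj (hcoeff g n))"

lemma hinner_summable: "summable (\<lambda>n. hcoeff f n * cnj (hcoeff g n))"
  by (rule summable_norm_cancel)
     (simp add: norm_mult summable_norm_mult hcoeff_summable)

instantiation hardy :: real_vector
begin

lift_definition zero_hardy :: hardy is "\<lambda>_. 0"
  by (auto simp: taylor_zero)

lift_definition plus_hardy :: "hardy \<Rightarrow> hardy \<Rightarrow> hardy" is "\<lambda>f g z. f z + g z"
  by (auto intro!: holomorphic_intros simp: taylor_add summable_square_add)

definition scaleR_hardy :: "real \<Rightarrow> hardy \<Rightarrow> hardy" where
  "scaleR_hardy r f = hscale (of_real r) f"

definition uminus_hardy :: "hardy \<Rightarrow> hardy" where
  "uminus_hardy f = hscale (- 1) f"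

definition minus_hardy :: "hardy \<Rightarrow> hardy \<Rightarrow> hardy" where
  "minus_hardy f g = f + - g"

instance
proof
  fix f g h :: hardy and r s :: real
  show "f + g + h = f + (g + h)"
    by transfer (simp add: algebra_simps)
  show "f + g = g + f"
    by transfer (simp add: algebra_simps)
  show "0 + f = f"
    by transfer simp
  show "- f + f = 0"
    unfolding uminus_hardy_def by transfer simp
  show "f - g = f + - g"
    by (fact minus_hardy_def)
  show "r *\<^sub>R (f + g) = r *\<^sub>R f + r *\<^sub>R g"
    unfolding scaleR_hardy_def by transfer (simp add: algebra_simps)
  show "(r + s) *\<^sub>R f = r *\<^sub>R f + s *\<^sub>R f"
    unfolding scaleR_hardy_def by transfer (simp add: algebra_simps)
  show "r *\<^sub>R s *\<^sub>R f = (r * s) *\<^sub>R f"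
    unfolding scaleR_hardy_def by transfer (simp add: algebra_simps)
  show "1 *\<^sub>R f = f"
    unfolding scaleR_hardy_def by transfer simp
qed

end

lemma hcoeff_add: "hcoeff (f + g) n = hcoeff f n + hcoeff g n"
  unfolding hcoeff_def by transfer (simp add: taylor_add)

lemma hcoeff_hscale: "hcoeff (hscale c f) n = c * hcoeff f n"
  unfolding hcoeff_def by transfer (simp add: taylor_cmult)

lemma hcoeff_zero: "hcoeff 0 n = 0"
  unfolding hcoeff_def by transfer (simp add: taylor_zero)

text \<open>
  The norm and topology of \<open>H\<^sup>2\<close> are those of the complex inner product
  \<^const>\<open>hinner\<close>; the class \<^class>\<open>real_inner\<close> records its real part.
\<close>

instantiation hardy :: real_inner
begin

definition inner_hardy :: "hardy \<Rightarrow> hardy \<Rightarrow> real" where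
  "inner_hardy f g = Re (hinner f g)"

definition norm_hardy :: "hardy \<Rightarrow> real" where
  "norm_hardy f = sqrt (inner f f)"

definition sgn_hardy :: "hardy \<Rightarrow> hardy" where
  "sgn_hardy f = inverse (norm f) *\<^sub>R f"

definition dist_hardy :: "hardy \<Rightarrow> hardy \<Rightarrow> real" where
  "dist_hardy f g = norm (f - g)"

definition uniformity_hardy :: "(hardy \<times> hardy) filter" where
  "uniformity_hardy = (INF e\<in>{0<..}. principal {(f, g). dist f g < e})"

definition open_hardy :: "hardy set \<Rightarrow> bool" where
  "open_hardy U = (\<forall>f\<in>U. eventually (\<lambda>(f', g). f' = f \<longrightarrow> g \<in> U) uniformity)"

lemma Re_hinner: "(\<lambda>n. Re (hcoeff f n * cnj (hcoeff g n))) sums inner f g"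
  unfolding inner_hardy_def hinner_def by (rule sums_Re summable_sums hinner_summable)+

instance
proof
  fix f g h :: hardy and r s :: real
  show "dist f g = norm (f - g)"
    by (fact dist_hardy_def)
  show "sgn f = f /\<^sub>R norm f"
    by (fact sgn_hardy_def)
  show "uniformity = (INF e\<in>{0<..}. principal {(f, g :: hardy). dist f g < e})"
    by (fact uniformity_hardy_def)
  show "open U = (\<forall>f\<in>U. eventually (\<lambda>(f', g). f' = f \<longrightarrow> g \<in> U) uniformity)" for U :: "hardy set"
    by (fact open_hardy_def)
  show "inner f g = inner g f"
    by (rule sums_unique2[OF Re_hinner]) (use Re_hinner[of g f] in \<open>simp add: algebra_simps\<close>)
  show "inner (f + g) h = inner f h + inner g h"
    by (rule sums_unique2[OF Re_hinner])
       (use sums_add[OF Re_hinner[of f h] Re_hinner[of g h]] in \<open>simp add: hcoeff_add algebra_simps\<close>)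
  show "inner (r *\<^sub>R f) g = r * inner f g"
    by (rule sums_unique2[OF Re_hinner])
       (use sums_mult[OF Re_hinner[of f g], of r] in
         \<open>simp add: scaleR_hardy_def hcoeff_hscale algebra_simps\<close>)
  have sq: "(\<lambda>n. (cmod (hcoeff f n))\<^sup>2) sums inner f f"
    using Re_hinner[of f f] by (simp add: cmod_power2 flip: power2_eq_square)
  show "0 \<le> inner f f"
    by (rule sums_le[OF _ sums_zero sq]) simp
  show "(inner f f = 0) = (f = 0)"
  proof
    assume "inner f f = 0"
    hence "(\<Sum>n. (cmod (hcoeff f n))\<^sup>2) = 0"
      using sums_unique[OF sq] by simp
    hence "\<forall>n. (cmod (hcoeff f n))\<^sup>2 = 0"
      by (subst (asm) suminf_eq_zero_iff) (auto intro: hcoeff_summable)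
    thus "f = 0"
      by (intro hardy_eq_hcoeffI) (simp add: hcoeff_zero)
  next
    assume "f = 0"
    thus "inner f f = 0"
      using sums_unique2[OF sq, of 0] by (simp add: hcoeff_zero)
  qed
  show "norm f = sqrt (inner f f)"
    by (fact norm_hardy_def)
qed

end

text \<open>The library constants \<^const>\<open>subspace\<close> and \<^const>\<open>span\<close> would only be real-linear.\<close>

global_interpretation H2: vector_space hscale
  defines H2_subspace = H2.subspace and H2_span = H2.span
  by unfold_locales (transfer; simp add: algebra_simps)+

definition closed_span :: "hardy set \<Rightarrow> hardy set" where
  "closed_span A = closure (H2_span A)"

text \<open>
  For a function \<open>\<phi>\<close> on the disc, \<open>mult_range \<phi>\<close> is \<open>\<phi> H\<^sup>2\<close>; only
  those products that lie in \<open>H\<^sup>2\<close> are collected, which is no restriction for bounded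
  holomorphic \<open>\<phi>\<close>.
\<close>

definition mult_range :: "(complex \<Rightarrow> complex) \<Rightarrow> hardy set" where
  "mult_range \<phi> = {h. \<exists>k. \<forall>z\<in>ball 0 1. hfun h z = \<phi> z * hfun k z}"

text \<open>Values of an inner function outside the open disc are irrelevant.\<close>

definition inner_function :: "(complex \<Rightarrow> complex) \<Rightarrow> bool" where
  "inner_function \<theta> \<longleftrightarrow> \<theta> holomorphic_on ball 0 1 \<and> bounded (\<theta> ` ball 0 1) \<and>
     (AE t in lebesgue_on {0..2 * pi}.
        \<exists>l. ((\<lambda>r. \<theta> (of_real r * cis t)) \<longlongrightarrow> l) (at_left 1) \<and> cmod l = 1)"

definition orth_compl :: "hardy set \<Rightarrow> hardy set" where
  "orth_compl K = {g. \<forall>k\<in>K. hinner g k = 0}"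

definition orth_proj :: "hardy set \<Rightarrow> hardy \<Rightarrow> hardy" where
  "orth_proj K f = (THE p. p \<in> K \<and> f - p \<in> orth_compl K)"

definition is_orth_sum :: "hardy set \<Rightarrow> hardy set \<Rightarrow> hardy set \<Rightarrow> bool" where
  "is_orth_sum M A B \<longleftrightarrow>
     (\<forall>a\<in>A. \<forall>b\<in>B. hinner a b = 0) \<and> M = {a + b | a b. a \<in> A \<and> b \<in> B}"

definition cyc_span :: "(hardy \<Rightarrow> hardy) \<Rightarrow> hardy \<Rightarrow> hardy set" where
  "cyc_span T h = closed_span (range (\<lambda>n. (T ^^ n) h))"

definition is_cyclic :: "(hardy \<Rightarrow> hardy) \<Rightarrow> hardy set \<Rightarrow> bool" where
  "is_cyclic T M \<longleftrightarrow> H2_subspace M \<and> closed M \<and> T ` M \<subseteq> M \<and> (\<exists>h\<in>M. M = cyc_span T h)"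

section \<open>The space \<open>H\<^sup>2\<^sub>\<alpha>\<^sub>,\<^sub>\<beta>\<close> and the compressed shift\<close>

definition f0 :: "complex \<Rightarrow> complex \<Rightarrow> hardy" where
  "f0 \<alpha> \<beta> = hscale \<alpha> (hmonom 0) + hscale \<beta> (hmonom 1)"

definition Hab :: "complex \<Rightarrow> complex \<Rightarrow> hardy set" where
  "Hab \<alpha> \<beta> = closed_span (insert (f0 \<alpha> \<beta>) (hmonom ` {2..}))"

text \<open>The operator is a total function here; only its values on \<^term>\<open>Hab \<alpha> \<beta>\<close> are meant.\<close>

definition Sab :: "complex \<Rightarrow> complex \<Rightarrow> hardy \<Rightarrow> hardy" where
  "Sab \<alpha> \<beta> f = orth_proj (Hab \<alpha> \<beta>) (mult_z f)"

text \<open>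
  The second family of invariant subspaces, with
  \<open>f = f\<^sub>0 + z\<^sup>2 g\<close> and \<open>w = \<alpha> cnj \<beta>\<close>.
\<close>

definition second_form ::
  "complex \<Rightarrow> complex \<Rightarrow> (complex \<Rightarrow> complex) \<Rightarrow> hardy \<Rightarrow> hardy \<Rightarrow> hardy set \<Rightarrow> bool" where
  "second_form \<alpha> \<beta> \<theta> g f M \<longleftrightarrow>
     (let w = \<alpha> * cnj \<beta> in
       \<theta> w \<noteq> 0 \<and>
       g \<in> orth_compl (mult_range \<theta>) \<and>
       (\<forall>z\<in>ball 0 1. (z - w) * hfun g z = \<beta> / \<theta> w * (\<theta> z - \<theta> w)) \<and>
       f = f0 \<alpha> \<beta> + mult_z (mult_z g) \<and>
       is_orth_sum M (range (\<lambda>c. hscale c f)) (mult_range (\<lambda>z. z\<^sup>2 * \<theta> z)))"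

end

theory Submission
  imports Defs
begin

text \<open>
  The operator \<open>S\<close> is explicit. Every element of \<open>H\<^sup>2\<^sub>\<alpha>\<^sub>,\<^sub>\<beta>\<close> has the form
  \<open>c f\<^sub>0 + z\<^sup>2 g\<close>, the vector \<open>f\<^sub>0\<close> is a unit vector orthogonal to \<open>z\<^sup>2 H\<^sup>2\<close>, and with
  \<open>w = \<alpha> cnj \<beta>\<close> one computes \<open>S (c f\<^sub>0 + z\<^sup>2 g) = c w f\<^sub>0 + z\<^sup>2 (c \<beta> + z g)\<close> (\<open>Sab_formula\<close>).
  So \<open>S\<close> is the plain shift on \<open>z\<^sup>2 H\<^sup>2\<close>, which has codimension one in \<open>H\<^sup>2\<^sub>\<alpha>\<^sub>,\<^sub>\<beta>\<close>.

  Let \<open>M\<close> be invariant. The space \<open>N = {g. z\<^sup>2 g \<in> M}\<close> is closed and shift-invariant, so Beurling's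
  theorem gives \<open>N = \<theta> H\<^sup>2\<close> if \<open>N \<noteq> 0\<close>. If \<open>M \<subseteq> z\<^sup>2 H\<^sup>2\<close>, this is the first form. Otherwise
  \<open>M\<close> contains some \<open>f = f\<^sub>0 + z\<^sup>2 g\<close>, and then
  \<open>S f - w f = z\<^sup>2 (\<beta> + (z - w) g)\<close> shows that \<open>d = \<beta> + (z - w) g\<close> lies in \<open>N\<close>. Its value at
  \<open>w\<close> is \<open>\<beta> \<noteq> 0\<close>, so \<open>N \<noteq> 0\<close>. Subtracting from \<open>g\<close> its projection to \<open>\<theta> H\<^sup>2\<close> we may take
  \<open>g\<close> orthogonal to \<open>\<theta> H\<^sup>2\<close>. Writing \<open>d = \<theta> \<kappa>\<close>, the coefficient \<open>\<langle>d, z\<^sup>n \<theta>\<rangle>\<close> of \<open>\<kappa>\<close> vanishes for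
  \<open>n \<ge> 1\<close>, so \<open>\<kappa>\<close> is constant, and evaluation at \<open>w\<close> yields \<open>\<theta>(w) \<noteq> 0\<close> and the equation for
  \<open>g\<close>. Conversely that equation says \<open>S f - w f = (\<beta> / \<theta>(w)) z\<^sup>2 \<theta>\<close>, which gives invariance as well
  as cyclicity: \<open>[f]\<close> contains \<open>z\<^sup>2 \<theta>\<close> and hence, applying \<open>S\<close> repeatedly, all \<open>z\<^sup>n\<^sup>+\<^sup>2 \<theta>\<close>.

  The remaining work is Beurling's theorem together with the fact that its generator is inner in
  the sense of radial limits. Both are organised around one algebraic notion: a unit vector
  \<open>\<theta>\<close> of \<open>H\<^sup>2\<close> is \<open>shift_orthonormal\<close> if the vectors \<open>z\<^sup>n \<theta>\<close> are orthonormal; then multiplication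
  by \<open>\<theta>\<close> is an isometry of \<open>H\<^sup>2\<close>. Beurling's theorem for such \<open>\<theta>\<close> is pure Hilbert space geometry
  (\<open>Beurling_shift_orthonormal\<close>). That shift-orthonormal and inner functions are the same is analysis.
  Parseval's identity on circles and dominated convergence show that inner functions are
  shift-orthonormal (\<open>inner_function_imp_shift_orthonormal\<close>). For the converse
  (\<open>shift_orthonormal_imp_inner_function\<close>), the powers \<open>\<theta>\<^sup>n\<close> all have norm 1, which forces
  \<open>|\<theta>| \<le> 1\<close>; Fatou's theorem (\<open>Fatou_radial_limits\<close>) gives radial limits \<open>u\<close> almost everywhere,
  and \<open>|u| \<le> 1\<close> with mean square \<open>1\<close> forces \<open>|u| = 1\<close>.

  Fatou's theorem is derived from the almost everywhere differentiability of indefinite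
  integrals. For \<open>h = \<Sum> a\<^sub>n z\<^sup>n\<close> in \<open>H\<^sup>2\<close> the primitive \<open>F = \<Sum> a\<^sub>n z\<^sup>n\<^sup>+\<^sup>1 / (n + 1)\<close> is continuous on the closed
  disc, and on the circle it is the indefinite integral of an integrable boundary function. Where the
  boundary values of \<open>F\<close> are differentiable, a Cauchy integral with a kernel of Poisson size
  shows that \<open>F' = h\<close> has the corresponding radial limit.
\<close>

section \<open>Coefficients, values and the inner product\<close>

lemma hfun_add: "hfun (f + g) z = hfun f z + hfun g z"
  by transfer simp

lemma hfun_hscale: "hfun (hscale c f) z = c * hfun f z"
  by transfer simp

lemma hfun_mult_z: "hfun (mult_z f) z = z * hfun f z"
  by transfer simp

lemma hfun_hmonom: "z \<in> ball 0 1 \<Longrightarrow> hfun (hmonom n) z = z ^ n"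
  by transfer simp

lemma hfun_zero: "hfun 0 z = 0"
  by transfer simp

lemma hfun_diff: "hfun (f - g) z = hfun f z - hfun g z"
  unfolding minus_hardy_def uminus_hardy_def hfun_add hfun_hscale by simp

lemma hfun_sum: "hfun (sum F A) z = (\<Sum>i\<in>A. hfun (F i) z)"
  by (induction A rule: infinite_finite_induct) (auto simp: hfun_zero hfun_add)

lemma hcoeff_diff: "hcoeff (f - g) n = hcoeff f n - hcoeff g n"
  unfolding minus_hardy_def uminus_hardy_def hcoeff_add hcoeff_hscale by simp

lemma hcoeff_sum: "hcoeff (sum F A) n = (\<Sum>i\<in>A. hcoeff (F i) n)"
  by (induction A rule: infinite_finite_induct) (auto simp: hcoeff_zero hcoeff_add)

lemma hcoeff_hmonom: "hcoeff (hmonom k) n = (if n = k then 1 else 0)"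
  unfolding hcoeff_def by transfer (rule taylor_monom)

lemma hcoeff_mult_z: "hcoeff (mult_z f) n = (if n = 0 then 0 else hcoeff f (n - 1))"
  unfolding hcoeff_def by transfer (simp add: taylor_shift)

lemma hcoeff_mult_z_power:
  "hcoeff ((mult_z ^^ k) f) n = (if n < k then 0 else hcoeff f (n - k))"
  by (induction k arbitrary: n) (auto simp: hcoeff_mult_z)

lemma hfun_mult_z_power: "hfun ((mult_z ^^ k) f) z = z ^ k * hfun f z"
  by (induction k) (auto simp: hfun_mult_z)

lemma mult_z_add: "mult_z (f + g) = mult_z f + mult_z g"
  by (rule hardy_eqI) (simp add: hfun_add hfun_mult_z algebra_simps)

lemma mult_z_hscale: "mult_z (hscale c f) = hscale c (mult_z f)"
  by (rule hardy_eqI) (simp add: hfun_hscale hfun_mult_z algebra_simps)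

lemma mult_z_power_add: "(mult_z ^^ n) (f + g) = (mult_z ^^ n) f + (mult_z ^^ n) g"
  by (induction n) (auto simp: mult_z_add)

lemma mult_z_power_hscale: "(mult_z ^^ n) (hscale c f) = hscale c ((mult_z ^^ n) f)"
  by (induction n) (auto simp: mult_z_hscale)

lemma mult_z_diff: "mult_z (f - g) = mult_z f - mult_z g"
  by (rule hardy_eqI) (simp add: hfun_diff hfun_mult_z algebra_simps)

lemma hinner_add_left: "hinner (f + g) h = hinner f h + hinner g h"
  unfolding hinner_def hcoeff_add distrib_right by (intro suminf_add[symmetric] hinner_summable)

lemma hinner_hscale_left: "hinner (hscale c f) h = c * hinner f h"
  unfolding hinner_def hcoeff_hscale mult.assoc by (intro suminf_mult hinner_summable)

lemma hinner_commute: "hinner g f = cnj (hinner f g)"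
proof -
  have "(\<lambda>n. cnj (hcoeff f n * cnj (hcoeff g n))) sums cnj (hinner f g)"
    unfolding hinner_def by (intro iffD2[OF sums_cnj] summable_sums hinner_summable)
  thus ?thesis
    unfolding hinner_def[of g f] by (auto simp: sums_iff mult.commute)
qed

lemma hinner_add_right: "hinner f (g + h) = hinner f g + hinner f h"
  by (metis complex_cnj_add hinner_add_left hinner_commute)

lemma hinner_hscale_right: "hinner f (hscale c h) = cnj c * hinner f h"
  by (metis complex_cnj_mult hinner_hscale_left hinner_commute)

lemma hinner_diff_left: "hinner (f - g) h = hinner f h - hinner g h"
  unfolding minus_hardy_def uminus_hardy_def hinner_add_left hinner_hscale_left by simp

lemma hinner_diff_right: "hinner f (g - h) = hinner f g - hinner f h"
  unfolding minus_hardy_def uminus_hardy_def hinner_add_right hinner_hscale_right by simp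

lemma hinner_zero_left: "hinner 0 f = 0"
  by (simp add: hinner_def hcoeff_zero)

lemma hinner_zero_right: "hinner f 0 = 0"
  by (simp add: hinner_def hcoeff_zero)

lemma hinner_sum_left: "hinner (sum F A) g = (\<Sum>i\<in>A. hinner (F i) g)"
  by (induction A rule: infinite_finite_induct) (auto simp: hinner_zero_left hinner_add_left)

lemma hinner_sum_right: "hinner g (sum F A) = (\<Sum>i\<in>A. hinner g (F i))"
  by (induction A rule: infinite_finite_induct) (auto simp: hinner_zero_right hinner_add_right)

lemmas hinner_simps = hinner_add_left hinner_add_right hinner_diff_left hinner_diff_right
  hinner_hscale_left hinner_hscale_right hinner_zero_left hinner_zero_right

lemma norm_square_sums: "(\<lambda>n. (cmod (hcoeff f n))\<^sup>2) sums (norm f)\<^sup>2"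
  using Re_hinner[of f f] by (simp add: cmod_power2 dot_square_norm flip: power2_eq_square)

lemma partial_sum_norm_square_le: "(\<Sum>n<N. (cmod (hcoeff f n))\<^sup>2) \<le> (norm f)\<^sup>2"
  using norm_square_sums[of f] by (metis sum_le_suminf finite_lessThan sums_iff zero_le_power2)

lemma hinner_self: "hinner f f = of_real ((norm f)\<^sup>2)"
proof -
  have "(\<lambda>n. complex_of_real ((cmod (hcoeff f n))\<^sup>2)) sums of_real ((norm f)\<^sup>2)"
    by (intro sums_of_real norm_square_sums)
  thus ?thesis
    unfolding hinner_def complex_norm_square by (simp add: sums_iff)
qed

lemma hinner_self_eq_0: "hinner f f = 0 \<longleftrightarrow> f = 0"
  by (simp add: hinner_self)

lemma norm_hscale: "norm (hscale c f) = cmod c * norm f"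
proof -
  have "complex_of_real ((norm (hscale c f))\<^sup>2) = of_real ((cmod c * norm f)\<^sup>2)"
    unfolding hinner_self[symmetric] power_mult_distrib of_real_mult complex_norm_square
    by (simp add: hinner_simps mult_ac)
  thus ?thesis
    by (metis norm_ge_zero mult_nonneg_nonneg of_real_eq_iff power2_eq_iff_nonneg)
qed

lemma hinner_Cauchy_Schwarz: "cmod (hinner f g) \<le> norm f * norm g"
proof (cases "hinner f g = 0")
  case False
  define c where "c = cnj (sgn (hinner f g))"
  have c: "cmod c = 1"
    using False by (simp add: c_def norm_sgn)
  have "c * hinner f g = of_real (cmod (hinner f g))"
    using False by (simp add: c_def sgn_eq complex_norm_square[symmetric] power2_eq_square
        flip: of_real_mult)
      (simp add: mult.commute complex_norm_square[symmetric] power2_eq_square)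
  hence "cmod (hinner f g) = inner (hscale c f) g"
    by (simp add: inner_hardy_def hinner_simps)
  also have "\<dots> \<le> norm (hscale c f) * norm g"
    by (rule norm_cauchy_schwarz)
  finally show ?thesis by (simp add: norm_hscale c)
qed auto

lemma hinner_hmonom: "hinner f (hmonom n) = hcoeff f n"
proof -
  have "(\<lambda>m. hcoeff f m * cnj (hcoeff (hmonom n) m)) sums
      (\<Sum>m\<in>{n}. hcoeff f m * cnj (hcoeff (hmonom n) m))"
    by (rule sums_finite) (auto simp: hcoeff_hmonom)
  thus ?thesis
    by (simp add: hinner_def sums_iff hcoeff_hmonom)
qed

lemma norm_hmonom: "norm (hmonom n) = 1"
proof -
  have "complex_of_real ((norm (hmonom n))\<^sup>2) = 1"
    unfolding hinner_self[symmetric] hinner_hmonom by (simp add: hcoeff_hmonom)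
  hence "(norm (hmonom n))\<^sup>2 = 1"
    by (metis of_real_eq_1_iff)
  thus ?thesis
    by (simp add: power2_eq_1_iff) (metis norm_ge_zero not_one_le_zero neg_0_le_iff_le)
qed

lemma cmod_hcoeff_le: "cmod (hcoeff f n) \<le> norm f"
  using hinner_Cauchy_Schwarz[of f "hmonom n"] by (simp add: hinner_hmonom norm_hmonom)

lemma hinner_mult_z: "hinner (mult_z f) (mult_z g) = hinner f g"
proof -
  have "(\<lambda>n. hcoeff (mult_z f) (Suc n) * cnj (hcoeff (mult_z g) (Suc n))) sums hinner f g"
    using hinner_summable by (simp add: hcoeff_mult_z hinner_def summable_sums)
  from sums_Suc[OF this] show ?thesis
    by (simp add: hinner_def hcoeff_mult_z sums_iff)
qed

lemma hinner_mult_z_power: "hinner ((mult_z ^^ n) f) ((mult_z ^^ n) g) = hinner f g"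
  by (induction n) (auto simp: hinner_mult_z)

lemma norm_mult_z: "norm (mult_z f) = norm f"
  by (simp add: norm_hardy_def inner_hardy_def hinner_mult_z)

lemma tendsto_hinner_left:
  assumes "X \<longlonglongrightarrow> x"
  shows "(\<lambda>n. hinner (X n) g) \<longlonglongrightarrow> hinner x g"
proof (rule Lim_null[THEN iffD2], rule Lim_null_comparison)
  show "\<forall>\<^sub>F n in sequentially. cmod (hinner (X n) g - hinner x g) \<le> norm (X n - x) * norm g"
    by (simp add: hinner_Cauchy_Schwarz flip: hinner_diff_left)
  have "(\<lambda>n. norm (X n - x)) \<longlonglongrightarrow> 0"
    using assms by (simp add: LIM_zero_iff tendsto_norm_zero)
  from tendsto_mult_right[OF this, of "norm g"] show "(\<lambda>n. norm (X n - x) * norm g) \<longlonglongrightarrow> 0"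
    by simp
qed

lemma tendsto_hcoeff: "X \<longlonglongrightarrow> x \<Longrightarrow> (\<lambda>n. hcoeff (X n) k) \<longlonglongrightarrow> hcoeff x k"
  using tendsto_hinner_left[of X x "hmonom k"] by (simp add: hinner_hmonom)

lemma tendsto_mult_z:
  assumes "X \<longlonglongrightarrow> x"
  shows "(\<lambda>n. mult_z (X n)) \<longlonglongrightarrow> mult_z x"
proof (rule Lim_null[THEN iffD2], rule tendsto_norm_zero_cancel)
  show "(\<lambda>n. norm (mult_z (X n) - mult_z x)) \<longlonglongrightarrow> 0"
    using assms by (simp add: LIM_zero_iff tendsto_norm_zero norm_mult_z flip: mult_z_diff)
qed

section \<open>Completeness and orthonormal systems\<close>
lemma hardy_of_coeffs:
  assumes "summable (\<lambda>n. (cmod (a n))\<^sup>2)"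
  obtains f where "\<And>n. hcoeff f n = a n"
proof -
  define g where "g = (\<lambda>z. \<Sum>n. a n * z ^ n)"
  have bdd: "\<exists>K. \<forall>n. cmod (a n) \<le> K"
  proof -
    have "(\<lambda>n. (cmod (a n))\<^sup>2) \<longlonglongrightarrow> 0"
      by (rule summable_LIMSEQ_zero[OF assms])
    hence "Bseq (\<lambda>n. (cmod (a n))\<^sup>2)"
      by (intro convergent_imp_Bseq convergentI)
    then obtain K where K: "K > 0" "\<And>n. (cmod (a n))\<^sup>2 \<le> K"
      unfolding Bseq_def by auto
    have "cmod (a n) \<le> sqrt K" for n
      using K(2)[of n] by (simp add: real_le_rsqrt)
    thus ?thesis by blast
  qed
  then obtain K where K: "\<And>n. cmod (a n) \<le> K" by blast
  have sm: "(\<lambda>n. a n * (z - 0) ^ n) sums g z" if "z \<in> ball 0 1" for z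
  proof -
    have "summable (\<lambda>n. K * cmod z ^ n)"
      using that by (intro summable_mult summable_geometric) auto
    hence "summable (\<lambda>n. a n * z ^ n)"
      by (rule summable_comparison_test'[where N = 0])
         (auto simp: norm_mult norm_power intro!: mult_right_mono K)
    thus ?thesis by (simp add: g_def summable_sums)
  qed
  have hol: "g holomorphic_on ball 0 1"
    by (rule power_series_holomorphic[OF sm])
  have "g has_fps_expansion Abs_fps a"
  proof (rule has_fps_expansionI)
    have "\<forall>\<^sub>F u::complex in nhds 0. u \<in> ball 0 1"
      by (intro eventually_nhds_in_open) auto
    thus "\<forall>\<^sub>F u in nhds 0. (\<lambda>n. fps_nth (Abs_fps a) n * u ^ n) sums g u"
      by eventually_elim (use sm in auto)
  qed
  moreover have "\<forall>\<^sub>F z in nhds 0. (if z \<in> ball 0 1 then g z else 0) = g z"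
    using eventually_nhds_in_open[of "ball 0 1" "0::complex"] by (auto elim: eventually_mono)
  ultimately have "(\<lambda>z. if z \<in> ball 0 1 then g z else 0) has_fps_expansion Abs_fps a"
    by (subst has_fps_expansion_cong) auto
  hence t: "taylor (\<lambda>z. if z \<in> ball 0 1 then g z else 0) = a"
    by (auto simp: taylor_eqI)
  have "(\<lambda>z. if z \<in> ball 0 1 then g z else 0) holomorphic_on ball 0 1"
    by (rule holomorphic_transform[OF hol]) auto
  hence "hfun (Abs_hardy (\<lambda>z. if z \<in> ball 0 1 then g z else 0)) =
      (\<lambda>z. if z \<in> ball 0 1 then g z else 0)"
    using assms t by (intro Abs_hardy_inverse) auto
  hence "hcoeff (Abs_hardy (\<lambda>z. if z \<in> ball 0 1 then g z else 0)) n = a n" for n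
    unfolding hcoeff_def by (simp only: t)
  thus ?thesis by (rule that)
qed

text \<open>
  The coefficients of a Cauchy sequence converge one by one. The tail estimate holds for every finite
  block of coefficients, uniformly in its length, and so survives the passage to the limit.
\<close>
lemma hardy_Cauchy_convergent:
  fixes X :: "nat \<Rightarrow> hardy"
  assumes "Cauchy X"
  shows "convergent X"
proof -
  have "Cauchy (\<lambda>k. hcoeff (X k) n)" for n
  proof (rule metric_CauchyI)
    fix e :: real assume "e > 0"
    then obtain M where M: "\<And>k l. k \<ge> M \<Longrightarrow> l \<ge> M \<Longrightarrow> dist (X k) (X l) < e"
      using assms unfolding Cauchy_def by blast
    have "dist (hcoeff (X k) n) (hcoeff (X l) n) \<le> dist (X k) (X l)" for k l
      using cmod_hcoeff_le[of "X k - X l" n] by (simp add: dist_norm hcoeff_diff)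
    with M show "\<exists>M. \<forall>k\<ge>M. \<forall>l\<ge>M. dist (hcoeff (X k) n) (hcoeff (X l) n) < e"
      by (meson le_less_trans)
  qed
  hence "\<forall>n. \<exists>l. (\<lambda>k. hcoeff (X k) n) \<longlonglongrightarrow> l"
    using Cauchy_convergent unfolding convergent_def by blast
  then obtain c where c: "\<And>n. (\<lambda>k. hcoeff (X k) n) \<longlonglongrightarrow> c n"
    unfolding choice_iff by blast
  have est: "(\<Sum>n<N. (cmod (c n - hcoeff (X k) n))\<^sup>2) \<le> e\<^sup>2"
    if "\<And>l. l \<ge> M \<Longrightarrow> dist (X l) (X k) \<le> e" "e \<ge> 0" for N M k e
  proof (rule LIMSEQ_le_const2)
    show "(\<lambda>l. \<Sum>n<N. (cmod (hcoeff (X l) n - hcoeff (X k) n))\<^sup>2)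
        \<longlonglongrightarrow> (\<Sum>n<N. (cmod (c n - hcoeff (X k) n))\<^sup>2)"
      by (intro tendsto_intros c)
    have "(\<Sum>n<N. (cmod (hcoeff (X l) n - hcoeff (X k) n))\<^sup>2) \<le> e\<^sup>2" if "l \<ge> M" for l
    proof -
      have "(\<Sum>n<N. (cmod (hcoeff (X l - X k) n))\<^sup>2) \<le> (norm (X l - X k))\<^sup>2"
        by (rule partial_sum_norm_square_le)
      also have "\<dots> \<le> e\<^sup>2"
        using \<open>\<And>l. l \<ge> M \<Longrightarrow> dist (X l) (X k) \<le> e\<close>[OF that] by (intro power_mono) (auto simp: dist_norm)
      finally show ?thesis by (simp add: hcoeff_diff)
    qed
    thus "\<exists>L. \<forall>l\<ge>L. (\<Sum>n<N. (cmod (hcoeff (X l) n - hcoeff (X k) n))\<^sup>2) \<le> e\<^sup>2" by blast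
  qed
  have smb: "summable (\<lambda>n. (cmod (c n - hcoeff (X k) n))\<^sup>2) \<and>
      (\<Sum>n. (cmod (c n - hcoeff (X k) n))\<^sup>2) \<le> e\<^sup>2"
    if "\<And>l. l \<ge> M \<Longrightarrow> dist (X l) (X k) \<le> e" "e \<ge> 0" for M k e
  proof -
    have "summable (\<lambda>n. (cmod (c n - hcoeff (X k) n))\<^sup>2)"
    proof (rule bounded_imp_summable)
      show "(\<Sum>n\<le>N. (cmod (c n - hcoeff (X k) n))\<^sup>2) \<le> e\<^sup>2" for N
        unfolding lessThan_Suc_atMost[symmetric] by (rule est[OF that])
    qed auto
    thus ?thesis
      using suminf_le_const[OF _ est[OF that]] by auto
  qed
  obtain M where M: "\<And>k l. k \<ge> M \<Longrightarrow> l \<ge> M \<Longrightarrow> dist (X k) (X l) < 1"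
    using metric_CauchyD[OF assms, of 1] by auto
  have "summable (\<lambda>n. (cmod (c n - hcoeff (X M) n))\<^sup>2)"
    using smb[of M M 1] M[of _ M] by (simp add: less_imp_le)
  hence "summable (\<lambda>n. (cmod ((c n - hcoeff (X M) n) + hcoeff (X M) n))\<^sup>2)"
    by (intro summable_square_add hcoeff_summable)
  hence "summable (\<lambda>n. (cmod (c n))\<^sup>2)" by simp
  then obtain f where f: "\<And>n. hcoeff f n = c n"
    by (rule hardy_of_coeffs) blast
  have "X \<longlonglongrightarrow> f"
  proof (rule metric_LIMSEQ_I)
    fix r :: real assume "r > 0"
    then obtain M where M: "\<And>k l. k \<ge> M \<Longrightarrow> l \<ge> M \<Longrightarrow> dist (X k) (X l) < r / 2"
      using metric_CauchyD[OF assms, of "r/2"] by auto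
    have "dist (X k) f < r" if "k \<ge> M" for k
    proof -
      have "(norm (f - X k))\<^sup>2 = (\<Sum>n. (cmod (c n - hcoeff (X k) n))\<^sup>2)"
        using norm_square_sums[of "f - X k"] by (simp add: hcoeff_diff f sums_iff)
      also have "\<dots> \<le> (r/2)\<^sup>2"
        using smb[of M k "r/2"] M that \<open>r > 0\<close> by (simp add: less_imp_le)
      finally have "norm (f - X k) \<le> r / 2"
        using \<open>r > 0\<close> by (simp add: abs_le_square_iff[symmetric])
      thus ?thesis using \<open>r > 0\<close> by (simp add: dist_norm norm_minus_commute)
    qed
    thus "\<exists>M. \<forall>k\<ge>M. dist (X k) f < r" by blast
  qed
  thus ?thesis by (auto simp: convergent_def)
qed

lemma trunc_tendsto: "(\<lambda>N. \<Sum>n<N. hscale (hcoeff f n) (hmonom n)) \<longlonglongrightarrow> f"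
proof -
  define T where "T = (\<lambda>N. \<Sum>n<N. hscale (hcoeff f n) (hmonom n))"
  have co: "hcoeff (f - T N) n = (if n < N then 0 else hcoeff f n)" for n N
    by (auto simp: T_def hcoeff_diff hcoeff_sum hcoeff_hscale hcoeff_hmonom sum.delta if_distrib cong: if_cong)
  have "(norm (f - T N))\<^sup>2 = (norm f)\<^sup>2 - (\<Sum>n<N. (cmod (hcoeff f n))\<^sup>2)" for N
  proof -
    have "(\<lambda>n. (cmod (hcoeff (f - T N) n))\<^sup>2 + (if n \<in> {..<N} then (cmod (hcoeff f n))\<^sup>2 else 0)) sums
        ((norm (f - T N))\<^sup>2 + (\<Sum>n<N. (cmod (hcoeff f n))\<^sup>2))"
      by (intro sums_add norm_square_sums sums_If_finite_set) auto
    moreover have "(\<lambda>n. (cmod (hcoeff (f - T N) n))\<^sup>2 + (if n \<in> {..<N} then (cmod (hcoeff f n))\<^sup>2 else 0))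
        = (\<lambda>n. (cmod (hcoeff f n))\<^sup>2)"
      by (auto simp: co)
    ultimately show ?thesis
      using sums_unique2[OF norm_square_sums[of f]] by fastforce
  qed
  moreover have "(\<lambda>N. (norm f)\<^sup>2 - (\<Sum>n<N. (cmod (hcoeff f n))\<^sup>2)) \<longlonglongrightarrow> (norm f)\<^sup>2 - (norm f)\<^sup>2"
    using norm_square_sums[of f] unfolding sums_def by (intro tendsto_intros)
  ultimately have "(\<lambda>N. (norm (f - T N))\<^sup>2) \<longlonglongrightarrow> 0"
    by simp
  from tendsto_real_sqrt[OF this] have "(\<lambda>N. norm (f - T N)) \<longlonglongrightarrow> 0"
    by simp
  hence "(\<lambda>N. norm (T N - f)) \<longlonglongrightarrow> 0"
    by (simp add: norm_minus_commute)
  thus ?thesis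
    unfolding T_def by (rule LIM_zero_cancel[OF tendsto_norm_zero_cancel])
qed

lemma norm_orthonormal_sum:
  assumes "\<And>m n. hinner (e m) (e n) = (if m = n then 1 else 0)"
  shows "(norm (\<Sum>n<N. hscale (c n) (e n)))\<^sup>2 = (\<Sum>n<(N::nat). (cmod (c n))\<^sup>2)"
proof -
  have "complex_of_real ((norm (\<Sum>n<N. hscale (c n) (e n)))\<^sup>2) = of_real (\<Sum>n<N. (cmod (c n))\<^sup>2)"
    unfolding hinner_self[symmetric] hinner_sum_left hinner_sum_right hinner_simps assms
    by (simp add: if_distrib complex_norm_square mult.commute del: of_real_power cong: if_cong)
  thus ?thesis
    by (simp only: of_real_eq_iff)
qed

text \<open>
  With \<open>p\<close> the projection of \<open>f\<close> to the span of finitely many of the vectors, the difference \<open>f - p\<close> is orthogonal to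
  \<open>p\<close>, so \<open>norm p \<le> norm f\<close>.
\<close>
lemma Bessel:
  assumes "\<And>m n. hinner (e m) (e n) = (if m = (n::nat) then 1 else 0)"
  shows "summable (\<lambda>n. (cmod (hinner f (e n)))\<^sup>2)"
proof (rule bounded_imp_summable)
  fix N :: nat
  define p where "p = (\<Sum>n<Suc N. hscale (hinner f (e n)) (e n))"
  have fp: "hinner f p = of_real ((norm p)\<^sup>2)"
    unfolding p_def norm_orthonormal_sum[OF assms] hinner_sum_right hinner_simps
    by (simp add: complex_norm_square mult.commute del: of_real_power)
  have "complex_of_real ((norm (f - p))\<^sup>2) = of_real ((norm f)\<^sup>2) - of_real ((norm p)\<^sup>2)"
    unfolding hinner_self[symmetric] hinner_simps hinner_commute[of p f] fp
    by (simp add: hinner_self)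
  hence "(norm (f - p))\<^sup>2 = (norm f)\<^sup>2 - (norm p)\<^sup>2"
    by (metis of_real_diff of_real_eq_iff)
  hence "(norm p)\<^sup>2 \<le> (norm f)\<^sup>2"
    by (metis diff_ge_0_iff_ge zero_le_power2)
  thus "(\<Sum>n\<le>N. (cmod (hinner f (e n)))\<^sup>2) \<le> (norm f)\<^sup>2"
    unfolding p_def norm_orthonormal_sum[OF assms] by (simp only: lessThan_Suc_atMost)
qed auto

section \<open>Isometric multipliers\<close>
text \<open>
  Orthonormality of all shifts \<open>z\<^sup>n \<theta>\<close> is encoded by the pairs with one exponent equal to 0,
  because the shift preserves inner products. These vectors are the Hilbert space counterpart of
  inner functions.
\<close>
definition shift_orthonormal :: "hardy \<Rightarrow> bool" where
  "shift_orthonormal \<theta> \<longleftrightarrow> (\<forall>n. hinner ((mult_z ^^ n) \<theta>) \<theta> = (if n = 0 then 1 else 0))"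

lemma shift_orthonormalD:
  assumes "shift_orthonormal \<theta>"
  shows "hinner ((mult_z ^^ m) \<theta>) ((mult_z ^^ n) \<theta>) = (if m = n then 1 else 0)"
proof -
  have *: "hinner ((mult_z ^^ (n + d)) \<theta>) ((mult_z ^^ n) \<theta>) = (if d = 0 then 1 else 0)" for n d
    using assms by (simp add: funpow_add hinner_mult_z_power shift_orthonormal_def)
  show ?thesis
  proof (cases "n \<le> m")
    case True
    thus ?thesis using *[of n "m - n"] by auto
  next
    case False
    thus ?thesis using *[of m "n - m"] hinner_commute[of "(mult_z ^^ m) \<theta>" "(mult_z ^^ n) \<theta>"] by auto
  qed
qed

text \<open>
  The product of two elements of \<open>H\<^sup>2\<close> is in general not in \<open>H\<^sup>2\<close>; the value is meaningful for
  shift-orthonormal \<open>\<theta>\<close>.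
\<close>
definition hmul :: "hardy \<Rightarrow> hardy \<Rightarrow> hardy" where
  "hmul \<theta> k = Abs_hardy (\<lambda>z. hfun \<theta> z * hfun k z)"

lemma taylor_mult:
  assumes "f holomorphic_on ball 0 1" "g holomorphic_on ball 0 1"
  shows "taylor (\<lambda>z. f z * g z) n = (\<Sum>i\<le>n. taylor f i * taylor g (n - i))"
  using taylor_eqI[OF has_fps_expansion_mult[OF assms[THEN holomorphic_has_fps_expansion]]]
  by (simp add: taylor_def fps_mult_nth atLeast0AtMost)

text \<open>
  The first \<open>N\<close> coefficients of the product \<open>\<theta> k\<close> only depend on the first \<open>N\<close> coefficients of \<open>k\<close>,
  that is, they are those of the finite sum \<open>\<Sum> k\<^sub>n z\<^sup>n \<theta>\<close> over \<open>n < N\<close>. By orthonormality the norm of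
  this sum is at most that of \<open>k\<close>. This bounds all partial sums of squares of the product.
\<close>
lemma hfun_hmul_and_norm_le:
  assumes "shift_orthonormal \<theta>"
  shows "hfun (hmul \<theta> k) = (\<lambda>z. hfun \<theta> z * hfun k z)" and "norm (hmul \<theta> k) \<le> norm k"
proof -
  define a where "a = taylor (\<lambda>z. hfun \<theta> z * hfun k z)"
  define T where "T = (\<lambda>N. \<Sum>n<N. hscale (hcoeff k n) ((mult_z ^^ n) \<theta>))"
  have T: "hcoeff (T N) m = a m" if "m < N" for m N
  proof -
    have "hcoeff (T N) m = (\<Sum>n<N. hcoeff k n * (if m < n then 0 else hcoeff \<theta> (m - n)))"
      by (simp add: T_def hcoeff_sum hcoeff_hscale hcoeff_mult_z_power)
    also have "\<dots> = (\<Sum>n\<le>m. hcoeff k n * hcoeff \<theta> (m - n))"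
      using that by (intro sum.mono_neutral_cong_right) auto
    also have "\<dots> = (\<Sum>n\<le>m. hcoeff \<theta> n * hcoeff k (m - n))"
      by (rule sum.reindex_bij_witness[of _ "\<lambda>n. m - n" "\<lambda>n. m - n"]) auto
    also have "\<dots> = a m"
      unfolding a_def by (subst taylor_mult[OF hfun_holomorphic hfun_holomorphic]) (simp add: hcoeff_def)
    finally show ?thesis .
  qed
  have bd: "(\<Sum>m<N. (cmod (a m))\<^sup>2) \<le> (norm k)\<^sup>2" for N
  proof -
    have "(\<Sum>m<N. (cmod (a m))\<^sup>2) = (\<Sum>m<N. (cmod (hcoeff (T N) m))\<^sup>2)"
      by (intro sum.cong) (auto simp: T)
    also have "\<dots> \<le> (norm (T N))\<^sup>2" by (rule partial_sum_norm_square_le)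
    also have "\<dots> = (\<Sum>n<N. (cmod (hcoeff k n))\<^sup>2)"
      unfolding T_def by (rule norm_orthonormal_sum[OF shift_orthonormalD[OF assms]])
    also have "\<dots> \<le> (norm k)\<^sup>2" by (rule partial_sum_norm_square_le)
    finally show ?thesis .
  qed
  have sm: "summable (\<lambda>m. (cmod (a m))\<^sup>2)"
  proof (rule bounded_imp_summable)
    show "(\<Sum>n\<le>N. (cmod (a n))\<^sup>2) \<le> (norm k)\<^sup>2" for N
      using bd[of "Suc N"] unfolding lessThan_Suc_atMost .
  qed auto
  show *: "hfun (hmul \<theta> k) = (\<lambda>z. hfun \<theta> z * hfun k z)"
    unfolding hmul_def using sm
    by (intro Abs_hardy_inverse)
       (auto simp: a_def hfun_outside intro!: holomorphic_intros hfun_holomorphic)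
  have "hcoeff (hmul \<theta> k) m = a m" for m
    by (simp add: hcoeff_def * a_def)
  hence "(\<lambda>m. (cmod (a m))\<^sup>2) sums (norm (hmul \<theta> k))\<^sup>2"
    using norm_square_sums[of "hmul \<theta> k"] by simp
  hence "(norm (hmul \<theta> k))\<^sup>2 \<le> (norm k)\<^sup>2"
    using suminf_le_const[OF sm bd] by (simp add: sums_iff)
  thus "norm (hmul \<theta> k) \<le> norm k"
    by (simp add: abs_le_square_iff[symmetric])
qed

lemmas hfun_hmul = hfun_hmul_and_norm_le(1)
lemmas norm_hmul_le = hfun_hmul_and_norm_le(2)

context
  fixes \<theta> :: hardy
  assumes so: "shift_orthonormal \<theta>"
begin

text \<open>
  The error of the partial sum is \<open>\<theta>\<close> times the error of the truncated power series of \<open>k\<close>, and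
  multiplication by \<open>\<theta>\<close> is a contraction.
\<close>
lemma hmul_tendsto: "(\<lambda>N. \<Sum>n<N. hscale (hcoeff k n) ((mult_z ^^ n) \<theta>)) \<longlonglongrightarrow> hmul \<theta> k"
proof -
  define T where "T = (\<lambda>N. \<Sum>n<N. hscale (hcoeff k n) ((mult_z ^^ n) \<theta>))"
  define K where "K = (\<lambda>N. \<Sum>n<N. hscale (hcoeff k n) (hmonom n))"
  have eq: "T N - hmul \<theta> k = hmul \<theta> (K N - k)" for N
    by (rule hardy_eqI)
       (simp add: hfun_diff hfun_hmul[OF so] hfun_sum T_def K_def hfun_hscale hfun_mult_z_power
          hfun_hmonom algebra_simps sum_distrib_left)
  have "(\<lambda>N. norm (K N - k)) \<longlonglongrightarrow> 0"
    using trunc_tendsto[of k] unfolding K_def by (simp add: LIM_zero_iff tendsto_norm_zero)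
  hence "(\<lambda>N. norm (T N - hmul \<theta> k)) \<longlonglongrightarrow> 0"
    by (rule tendsto_0_le[where K = 1]) (simp add: eq norm_hmul_le[OF so])
  thus ?thesis
    unfolding T_def by (rule LIM_zero_cancel[OF tendsto_norm_zero_cancel])
qed

lemma hinner_hmul_shift: "hinner (hmul \<theta> k) ((mult_z ^^ m) \<theta>) = hcoeff k m"
proof (rule LIMSEQ_unique)
  show "(\<lambda>N. hinner (\<Sum>n<N. hscale (hcoeff k n) ((mult_z ^^ n) \<theta>)) ((mult_z ^^ m) \<theta>))
      \<longlonglongrightarrow> hinner (hmul \<theta> k) ((mult_z ^^ m) \<theta>)"
    by (intro tendsto_hinner_left hmul_tendsto)
  have "hinner (\<Sum>n<N. hscale (hcoeff k n) ((mult_z ^^ n) \<theta>)) ((mult_z ^^ m) \<theta>) = hcoeff k m"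
    if "N \<ge> Suc m" for N
    using that
    by (simp add: hinner_sum_left hinner_simps shift_orthonormalD[OF so] if_distrib cong: if_cong)
  thus "(\<lambda>N. hinner (\<Sum>n<N. hscale (hcoeff k n) ((mult_z ^^ n) \<theta>)) ((mult_z ^^ m) \<theta>)) \<longlonglongrightarrow> hcoeff k m"
    by (intro tendsto_eventually eventually_sequentiallyI)
qed

lemma norm_hmul: "norm (hmul \<theta> k) = norm k"
proof -
  have "(\<lambda>N. hinner (\<Sum>n<N. hscale (hcoeff k n) ((mult_z ^^ n) \<theta>)) (hmul \<theta> k))
      \<longlonglongrightarrow> hinner (hmul \<theta> k) (hmul \<theta> k)"
    by (intro tendsto_hinner_left hmul_tendsto)
  moreover have "hinner (\<Sum>n<N. hscale (hcoeff k n) ((mult_z ^^ n) \<theta>)) (hmul \<theta> k)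
      = (\<Sum>n<N. complex_of_real ((cmod (hcoeff k n))\<^sup>2))" for N
  proof -
    have "hinner ((mult_z ^^ n) \<theta>) (hmul \<theta> k) = cnj (hcoeff k n)" for n
      using hinner_hmul_shift[of k n] hinner_commute by metis
    thus ?thesis
      unfolding hinner_sum_left hinner_simps complex_norm_square by simp
  qed
  ultimately have "(\<lambda>n. complex_of_real ((cmod (hcoeff k n))\<^sup>2)) sums of_real ((norm (hmul \<theta> k))\<^sup>2)"
    by (simp add: sums_def hinner_self)
  moreover have "(\<lambda>n. complex_of_real ((cmod (hcoeff k n))\<^sup>2)) sums of_real ((norm k)\<^sup>2)"
    by (intro sums_of_real norm_square_sums)
  ultimately have "(norm (hmul \<theta> k))\<^sup>2 = (norm k)\<^sup>2"
    using sums_unique2 of_real_eq_iff by blast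
  thus ?thesis by simp
qed

lemma mult_range_hfun: "mult_range (hfun \<theta>) = range (hmul \<theta>)"
proof (intro equalityI subsetI)
  fix h assume "h \<in> mult_range (hfun \<theta>)"
  then obtain k where "\<And>z. z \<in> ball 0 1 \<Longrightarrow> hfun h z = hfun \<theta> z * hfun k z"
    unfolding mult_range_def by blast
  hence "h = hmul \<theta> k"
    by (intro hardy_eqI) (simp add: hfun_hmul[OF so])
  thus "h \<in> range (hmul \<theta>)" by blast
qed (auto simp: mult_range_def hfun_hmul[OF so])

lemma hmul_hmonom: "hmul \<theta> (hmonom n) = (mult_z ^^ n) \<theta>"
  by (rule hardy_eqI) (simp add: hfun_hmul[OF so] hfun_hmonom hfun_mult_z_power)

lemma mult_z_hmul: "mult_z (hmul \<theta> k) = hmul \<theta> (mult_z k)"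
  by (rule hardy_eqI) (simp add: hfun_hmul[OF so] hfun_mult_z)

lemma hmul_in_closed_subspace:
  assumes "H2_subspace N" "closed N" "\<And>n. (mult_z ^^ n) \<theta> \<in> N"
  shows "hmul \<theta> k \<in> N"
  by (rule closed_sequentially[OF assms(2) _ hmul_tendsto])
     (intro H2.subspace_sum H2.subspace_scale assms)

end

section \<open>Beurling's theorem\<close>
text \<open>
  By the parallelogram law a norm-minimising sequence in a convex set is a Cauchy sequence: the
  midpoints stay in the set and cannot have smaller norm than the infimum.
\<close>
lemma min_norm_exists:
  fixes C :: "hardy set"
  assumes "closed C" "convex C" "C \<noteq> {}"
  obtains u where "u \<in> C" "\<And>v. v \<in> C \<Longrightarrow> norm u \<le> norm v"
proof -
  define d where "d = Inf (norm ` C)"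
  have bdd: "bdd_below (norm ` C)"
    by (rule bdd_belowI[of _ 0]) auto
  have d_le: "d \<le> norm v" if "v \<in> C" for v
    unfolding d_def using that bdd by (intro cInf_lower) auto
  have "d \<ge> 0"
    unfolding d_def using assms(3) by (intro cInf_greatest) auto
  have "\<exists>v\<in>C. norm v < d + inverse (real (Suc k))" for k
    using cInf_lessD[of "norm ` C" "d + inverse (real (Suc k))"] assms(3)
    unfolding d_def[symmetric] by auto
  then obtain X where X: "\<And>k. X k \<in> C" "\<And>k. norm (X k) < d + inverse (real (Suc k))"
    by metis
  have par: "(norm (x - y))\<^sup>2 \<le> 2 * (norm x)\<^sup>2 + 2 * (norm y)\<^sup>2 - 4 * d\<^sup>2"
    if "x \<in> C" "y \<in> C" for x y
  proof -
    have "(1/2) *\<^sub>R x + (1/2) *\<^sub>R y \<in> C"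
      using convexD[OF assms(2) that, of "1/2" "1/2"] by simp
    hence "d \<le> norm ((1/2) *\<^sub>R x + (1/2) *\<^sub>R y)" by (rule d_le)
    also have "(1/2) *\<^sub>R x + (1/2) *\<^sub>R y = (1/2) *\<^sub>R (x + y)"
      by (simp add: scaleR_add_right)
    finally have "2 * d \<le> norm (x + y)" by simp
    hence "(2 * d)\<^sup>2 \<le> (norm (x + y))\<^sup>2"
      using \<open>d \<ge> 0\<close> by (intro power_mono) auto
    moreover have "(norm (x + y))\<^sup>2 + (norm (x - y))\<^sup>2 = 2 * (norm x)\<^sup>2 + 2 * (norm y)\<^sup>2"
      by (simp add: power2_norm_eq_inner inner_simps inner_commute)
    ultimately show ?thesis by (simp add: power_mult_distrib)
  qed
  have lim: "(\<lambda>k. d + inverse (real (Suc k))) \<longlonglongrightarrow> d"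
    using tendsto_add[OF tendsto_const LIMSEQ_inverse_real_of_nat, of d] by simp
  have "Cauchy X"
  proof (rule metric_CauchyI)
    fix e :: real assume "e > 0"
    have "(\<lambda>k. 4 * (d + inverse (real (Suc k)))\<^sup>2 - 4 * d\<^sup>2) \<longlonglongrightarrow> 4 * d\<^sup>2 - 4 * d\<^sup>2"
      by (intro tendsto_intros lim)
    hence "\<forall>\<^sub>F k in sequentially. 4 * (d + inverse (real (Suc k)))\<^sup>2 - 4 * d\<^sup>2 < e\<^sup>2"
      using \<open>e > 0\<close> by (intro order_tendstoD(2)[where y = 0]) auto
    then obtain M where M: "4 * (d + inverse (real (Suc M)))\<^sup>2 - 4 * d\<^sup>2 < e\<^sup>2"
      by (meson eventually_happens' sequentially_bot)
    have "dist (X k) (X l) < e" if "k \<ge> M" "l \<ge> M" for k l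
    proof -
      have *: "(norm (X k))\<^sup>2 \<le> (d + inverse (real (Suc M)))\<^sup>2" if "k \<ge> M" for k
      proof (intro power_mono norm_ge_zero)
        have "inverse (real (Suc k)) \<le> inverse (real (Suc M))"
          using that by (intro le_imp_inverse_le) auto
        thus "norm (X k) \<le> d + inverse (real (Suc M))"
          using X(2)[of k] by linarith
      qed
      have "(norm (X k - X l))\<^sup>2 < e\<^sup>2"
        using par[OF X(1) X(1), of k l] *[OF that(1)] *[OF that(2)] M by linarith
      thus ?thesis
        using \<open>e > 0\<close> by (simp add: dist_norm power2_less_imp_less)
    qed
    thus "\<exists>M. \<forall>k\<ge>M. \<forall>l\<ge>M. dist (X k) (X l) < e" by blast
  qed
  then obtain u where u: "X \<longlonglongrightarrow> u"
    using hardy_Cauchy_convergent unfolding convergent_def by blast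
  have "norm u \<le> d"
    by (rule LIMSEQ_le[OF tendsto_norm[OF u] lim]) (use X(2) in \<open>auto intro: less_imp_le\<close>)
  moreover have "u \<in> C"
    by (rule closed_sequentially[OF assms(1) X(1) u])
  ultimately show ?thesis
    using that d_le order_trans by blast
qed

text \<open>
  Let \<open>m\<close> be the smallest index for which some element of \<open>N\<close> has a nonzero \<open>m\<close>-th coefficient.
  Among the elements whose \<open>m\<close>-th coefficient is 1 take one of minimal norm. It is orthogonal to all
  elements of \<open>N\<close> whose \<open>m\<close>-th coefficient vanishes, in particular to \<open>z N\<close>.
\<close>
lemma wandering_vector:
  assumes N: "H2_subspace N" "closed N" "mult_z ` N \<subseteq> N" "N \<noteq> {0}"
  obtains \<phi> where "\<phi> \<in> N" "shift_orthonormal \<phi>" "\<And>h. h \<in> N \<Longrightarrow> hinner (mult_z h) \<phi> = 0"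
proof -
  have "0 \<in> N" by (rule H2.subspace_0[OF N(1)])
  with N(4) obtain h where h: "h \<in> N" "h \<noteq> 0" by blast
  then obtain n where "hcoeff h n \<noteq> 0"
    using hardy_eq_hcoeffI[of h 0] by (auto simp: hcoeff_zero)
  hence ex: "\<exists>n. \<exists>h\<in>N. hcoeff h n \<noteq> 0" using h by blast
  define m where "m = (LEAST n. \<exists>h\<in>N. hcoeff h n \<noteq> 0)"
  obtain h where h: "h \<in> N" "hcoeff h m \<noteq> 0"
    using LeastI_ex[OF ex] unfolding m_def by blast
  have low: "hcoeff v n = 0" if "v \<in> N" "n < m" for v n
    using not_less_Least[of n "\<lambda>n. \<exists>h\<in>N. hcoeff h n \<noteq> 0"] that unfolding m_def by blast
  define C where "C = {v\<in>N. hcoeff v m = 1}"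
  have "closed C"
  proof (rule closed_sequential_limits[THEN iffD2], intro allI impI, elim conjE)
    fix X l assume X: "\<forall>n. X n \<in> C" "X \<longlonglongrightarrow> l"
    have "l \<in> N"
      using X by (intro closed_sequentially[OF N(2) _ X(2)]) (auto simp: C_def)
    moreover have "hcoeff l m = 1"
      using LIMSEQ_unique[OF tendsto_hcoeff[OF X(2)], of m 1] X(1) by (simp add: C_def)
    ultimately show "l \<in> C" by (simp add: C_def)
  qed
  moreover have "convex C"
    by (rule convexI)
       (auto simp: C_def scaleR_hardy_def hcoeff_add hcoeff_hscale simp flip: of_real_add
          intro!: H2.subspace_add H2.subspace_scale N(1))
  moreover have "hscale (inverse (hcoeff h m)) h \<in> C"
    using h by (auto simp: C_def hcoeff_hscale intro!: H2.subspace_scale N(1))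
  hence "C \<noteq> {}" by blast
  ultimately obtain u where u: "u \<in> C" and min: "\<And>v. v \<in> C \<Longrightarrow> norm u \<le> norm v"
    using min_norm_exists by blast
  have uN: "u \<in> N" and um: "hcoeff u m = 1" using u by (auto simp: C_def)
  have "u \<noteq> 0" using um by (auto simp: hcoeff_zero)
  have orth: "hinner v u = 0" if v: "v \<in> N" "hcoeff v m = 0" for v
  proof (cases "v = 0")
    case False
    \<comment> \<open>Subtracting from \<open>u\<close> its component along \<open>v\<close> stays in \<open>C\<close>; by minimality the component is 0.\<close>
    define c where "c = hinner u v / of_real ((norm v)\<^sup>2)"
    have nv: "complex_of_real ((norm v)\<^sup>2) \<noteq> 0" using False by simp
    have "u - hscale c v \<in> C"
      using v uN um by (auto simp: C_def hcoeff_diff hcoeff_hscale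
          intro!: H2.subspace_diff H2.subspace_scale N(1))
    hence "(norm u)\<^sup>2 \<le> (norm (u - hscale c v))\<^sup>2"
      by (intro power_mono min) auto
    have ortho: "hinner (u - hscale c v) v = 0"
      using nv by (simp add: hinner_simps c_def hinner_self)
    have "hinner u u = hinner (u - hscale c v) (u - hscale c v) + hinner (hscale c v) (hscale c v)"
      using ortho hinner_commute[of v "u - hscale c v"]
      by (simp add: hinner_simps algebra_simps)
    hence "(norm u)\<^sup>2 = (norm (u - hscale c v))\<^sup>2 + (norm (hscale c v))\<^sup>2"
      unfolding hinner_self by (metis of_real_add of_real_eq_iff)
    with \<open>(norm u)\<^sup>2 \<le> _\<close> have "norm (hscale c v) = 0"
      by (smt (verit) zero_le_power2 power2_eq_iff_nonneg zero_eq_power2)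
    hence "c = 0" using False by (simp add: norm_hscale)
    hence "hinner u v = 0" using nv by (simp add: c_def)
    thus ?thesis using hinner_commute[of v u] by simp
  qed (simp add: hinner_zero_left)
  have zorth: "hinner (mult_z v) u = 0" if "v \<in> N" for v
    using that N(3) by (intro orth) (auto simp: hcoeff_mult_z low)
  define \<phi> where "\<phi> = hscale (inverse (of_real (norm u))) u"
  have "norm \<phi> = 1"
    using \<open>u \<noteq> 0\<close> by (simp add: \<phi>_def norm_hscale norm_inverse)
  have phiN: "\<phi> \<in> N"
    unfolding \<phi>_def by (intro H2.subspace_scale N(1) uN)
  have phiz: "hinner (mult_z v) \<phi> = 0" if "v \<in> N" for v
    using zorth[OF that] by (simp add: \<phi>_def hinner_simps)
  have pow: "(mult_z ^^ n) \<phi> \<in> N" for n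
    by (induction n) (use phiN N(3) in auto)
  have "shift_orthonormal \<phi>"
    unfolding shift_orthonormal_def
  proof
    show "hinner ((mult_z ^^ n) \<phi>) \<phi> = (if n = 0 then 1 else 0)" for n
      using phiz[OF pow] \<open>norm \<phi> = 1\<close> by (cases n) (auto simp: hinner_self)
  qed
  with phiN phiz show ?thesis using that by blast
qed

text \<open>
  Take a wandering unit vector \<open>\<phi>\<close> of \<open>N\<close>. The orthogonal complement \<open>N\<^sub>1\<close> of \<open>\<phi> H\<^sup>2\<close> in \<open>N\<close> is again
  closed and shift-invariant, since \<open>\<phi>\<close> is orthogonal to \<open>z N\<close>. If it were nonzero, it would have a
  wandering vector \<open>\<psi>\<close> of its own. Then \<open>\<phi> \<psi> = \<psi> \<phi>\<close> lies both in \<open>\<phi> H\<^sup>2\<close> and in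
  \<open>\<psi> H\<^sup>2 \<subseteq> N\<^sub>1\<close>, which are orthogonal, so \<open>\<phi> \<psi> = 0\<close>; but multiplication by \<open>\<phi>\<close> is isometric.
\<close>
theorem Beurling_shift_orthonormal:
  assumes N: "H2_subspace N" "closed N" "mult_z ` N \<subseteq> N" "N \<noteq> {0}"
  obtains \<phi> where "shift_orthonormal \<phi>" "N = range (hmul \<phi>)"
proof -
  obtain \<phi> where phi: "\<phi> \<in> N" "shift_orthonormal \<phi>"
      and orth: "\<And>h. h \<in> N \<Longrightarrow> hinner (mult_z h) \<phi> = 0"
    using wandering_vector[OF N] by blast
  have pow: "(mult_z ^^ n) \<phi> \<in> N" for n
    by (induction n) (use phi N(3) in auto)
  have sub: "hmul \<phi> k \<in> N" for k
    by (rule hmul_in_closed_subspace[OF phi(2) N(1,2) pow])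
  define N1 where "N1 = {d\<in>N. \<forall>n. hinner d ((mult_z ^^ n) \<phi>) = 0}"
  have "N1 = {0}"
  proof (rule ccontr)
    assume "N1 \<noteq> {0}"
    have "H2_subspace N1"
      unfolding N1_def using N(1)
      by (auto simp: H2.subspace_def hinner_simps)
    moreover have "closed N1"
    proof (rule closed_sequential_limits[THEN iffD2], intro allI impI, elim conjE)
      fix X l assume X: "\<forall>n. X n \<in> N1" "X \<longlonglongrightarrow> l"
      have "l \<in> N"
        using X by (intro closed_sequentially[OF N(2) _ X(2)]) (auto simp: N1_def)
      moreover have "hinner l ((mult_z ^^ n) \<phi>) = 0" for n
        using LIMSEQ_unique[OF tendsto_hinner_left[OF X(2)], of _ 0] X(1) by (simp add: N1_def)
      ultimately show "l \<in> N1" by (simp add: N1_def)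
    qed
    moreover have zN1: "mult_z d \<in> N1" if d: "d \<in> N1" for d
    proof -
      have "hinner (mult_z d) ((mult_z ^^ n) \<phi>) = 0" for n
        using d orth by (cases n) (auto simp: N1_def hinner_mult_z)
      thus ?thesis using d N(3) by (auto simp: N1_def)
    qed
    ultimately obtain \<psi> where psi: "\<psi> \<in> N1" "shift_orthonormal \<psi>"
      using wandering_vector[of N1] \<open>N1 \<noteq> {0}\<close> by blast
    have psiN: "hmul \<psi> k \<in> N1" for k
    proof (rule hmul_in_closed_subspace[OF psi(2) \<open>H2_subspace N1\<close> \<open>closed N1\<close>])
      show "(mult_z ^^ n) \<psi> \<in> N1" for n
        by (induction n) (use psi zN1 in auto)
    qed
    have "hmul \<psi> \<phi> = hmul \<phi> \<psi>"
      by (rule hardy_eqI) (simp add: hfun_hmul[OF phi(2)] hfun_hmul[OF psi(2)])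
    hence "hmul \<phi> \<psi> \<in> N1" using psiN[of \<phi>] by simp
    hence "hcoeff \<psi> n = 0" for n
      using hinner_hmul_shift[OF phi(2), of \<psi> n] by (simp add: N1_def)
    hence "\<psi> = 0" by (intro hardy_eq_hcoeffI) (simp add: hcoeff_zero)
    thus False
      using psi(2) by (auto simp: shift_orthonormal_def hinner_simps dest: spec[of _ 0])
  qed
  have "h \<in> range (hmul \<phi>)" if "h \<in> N" for h
  proof -
    obtain k where k: "\<And>n. hcoeff k n = hinner h ((mult_z ^^ n) \<phi>)"
      by (rule hardy_of_coeffs[OF Bessel[OF shift_orthonormalD[OF phi(2)], of h]]) blast
    have "h - hmul \<phi> k \<in> N"
      by (intro H2.subspace_diff N(1) that sub)
    hence "h - hmul \<phi> k \<in> N1"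
      by (simp add: N1_def hinner_simps hinner_hmul_shift[OF phi(2)] k)
    hence "h = hmul \<phi> k" using \<open>N1 = {0}\<close> by simp
    thus ?thesis by blast
  qed
  with sub have "N = range (hmul \<phi>)" by blast
  with phi(2) show ?thesis by (rule that)
qed

section \<open>Integrals over circles and inner functions\<close>
abbreviation circle_measure :: "real measure" where
  "circle_measure \<equiv> lebesgue_on {0..2 * pi}"

lemma measure_circle_measure: "measure circle_measure (space circle_measure) = 2 * pi"
  by (simp add: space_restrict_space measure_restrict_space)

lemma integral_const_circle: "(\<integral>t. c \<partial>circle_measure) = of_real (2 * pi) * (c::complex)"
  by (simp add: measure_circle_measure[simplified] scaleR_conv_of_real)

lemma cis_power_integrable: "integrable circle_measure (\<lambda>t. cis t ^ n)"
  by (intro continuous_imp_integrable_real continuous_intros)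

lemma cis_power_measurable: "(\<lambda>t. cis t ^ n) \<in> borel_measurable circle_measure"
  by (rule borel_measurable_integrable[OF cis_power_integrable])

lemma integral_cis_power: "(\<integral>t. cis t ^ n \<partial>circle_measure) = (if n = 0 then of_real (2 * pi) else 0)"
proof (cases "n = 0")
  case True
  thus ?thesis using integral_const_circle[of 1] by simp
next
  case False
  have "((\<lambda>t. cis (real n * t)) has_integral
      (cis (real n * (2 * pi)) / (\<i> * of_nat n) - cis (real n * 0) / (\<i> * of_nat n))) {0..2*pi}"
  proof (rule fundamental_theorem_of_calculus)
    fix t :: real
    have "((\<lambda>z. exp (\<i> * of_nat n * z) / (\<i> * of_nat n)) has_field_derivative exp (\<i> * of_nat n * of_real t))
        (at (of_real t))"
      using False by (auto intro!: derivative_eq_intros)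
    from has_vector_derivative_real_field[OF this]
    have "((\<lambda>x. exp (\<i> * of_nat n * of_real x) / (\<i> * of_nat n)) has_vector_derivative
        exp (\<i> * of_nat n * of_real t)) (at t within {0..2*pi})" .
    moreover have "exp (\<i> * of_nat n * of_real x) = cis (real n * x)" for x
      by (simp add: cis_conv_exp mult_ac)
    ultimately show "((\<lambda>t. cis (real n * t) / (\<i> * of_nat n)) has_vector_derivative cis (real n * t))
        (at t within {0..2*pi})"
      by simp
  qed auto
  moreover have "cis (real n * (2 * pi)) = 1"
    using cis_multiple_2pi[of "real n"] by (simp add: mult_ac)
  ultimately have "((\<lambda>t. cis (real n * t)) has_integral 0) {0..2*pi}"
    by simp
  hence "integral {0..2*pi} (\<lambda>t. cis t ^ n) = 0"
    unfolding Complex.DeMoivre by (rule integral_unique)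
  thus ?thesis
    using False by (subst lebesgue_integral_eq_integral[OF cis_power_integrable]) auto
qed

lemma integral_cis_power_cnj:
  "(\<integral>t. cis t ^ m * cnj (cis t ^ n) \<partial>circle_measure) = (if m = n then of_real (2 * pi) else 0)"
proof -
  have *: "(\<integral>t. cis t ^ (n + d) * cnj (cis t ^ n) \<partial>circle_measure) = (if d = 0 then of_real (2 * pi) else 0)" for n d
  proof -
    have "cis t ^ (n + d) * cnj (cis t ^ n) = cis t ^ d" for t
    proof -
      have "cis t ^ n * cnj (cis t ^ n) = 1"
        by (subst complex_norm_square[symmetric]) (simp add: norm_power)
      thus ?thesis by (simp add: power_add mult_ac)
    qed
    thus ?thesis by (simp add: integral_cis_power)
  qed
  show ?thesis
  proof (cases "n \<le> m")
    case True
    thus ?thesis using *[of n "m - n"] by auto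
  next
    case False
    have "(\<integral>t. cis t ^ m * cnj (cis t ^ n) \<partial>circle_measure)
        = (\<integral>t. cnj (cis t ^ n * cnj (cis t ^ m)) \<partial>circle_measure)"
      by (simp add: mult.commute)
    also have "\<dots> = cnj (\<integral>t. cis t ^ n * cnj (cis t ^ m) \<partial>circle_measure)"
      by (rule Bochner_Integration.integral_cnj)
    finally show ?thesis
      using *[of m "n - m"] False by auto
  qed
qed

lemma fourier_series_integral:
  fixes a :: "nat \<Rightarrow> complex"
  assumes a: "summable (\<lambda>n. cmod (a n))" and h: "integrable circle_measure h"
  shows "(\<lambda>n. a n * (\<integral>t. cis t ^ n * h t \<partial>circle_measure)) sums
      (\<integral>t. (\<Sum>n. a n * cis t ^ n) * h t \<partial>circle_measure)"
    and "integrable circle_measure (\<lambda>t. (\<Sum>n. a n * cis t ^ n) * h t)"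
proof -
  have i: "integrable circle_measure (\<lambda>t. a n * (cis t ^ n * h t))" for n
    by (intro integrable_mult_right Bochner_Integration.integrable_bound[OF h]
        borel_measurable_times cis_power_measurable borel_measurable_integrable[OF h])
       (auto simp: norm_mult norm_power)
  have sm: "summable (\<lambda>n. norm (a n * (cis t ^ n * h t)))" for t
    using summable_mult2[OF a, of "cmod (h t)"] by (simp add: norm_mult norm_power mult_ac)
  have sm2: "summable (\<lambda>n. \<integral>t. norm (a n * (cis t ^ n * h t)) \<partial>circle_measure)"
    using summable_mult2[OF a, of "\<integral>t. norm (h t) \<partial>circle_measure"]
    by (simp add: norm_mult norm_power)
  have eq: "(\<Sum>n. a n * (cis t ^ n * h t)) = (\<Sum>n. a n * cis t ^ n) * h t" for t
  proof -
    have "summable (\<lambda>n. a n * cis t ^ n)"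
      using a by (intro summable_norm_cancel[of "\<lambda>n. a n * cis t ^ n"]) (simp add: norm_mult norm_power)
    from suminf_mult2[OF this, of "h t"] show ?thesis by (simp add: mult.assoc)
  qed
  show "(\<lambda>n. a n * (\<integral>t. cis t ^ n * h t \<partial>circle_measure)) sums
      (\<integral>t. (\<Sum>n. a n * cis t ^ n) * h t \<partial>circle_measure)"
    using sums_integral[OF i _ sm2] sm by (simp add: eq)
  show "integrable circle_measure (\<lambda>t. (\<Sum>n. a n * cis t ^ n) * h t)"
    using integrable_suminf[OF i _ sm2] sm by (simp add: eq)
qed

text \<open>
  The series for the first factor is integrated termwise against the conjugate of the second
  factor, and each resulting Fourier coefficient by termwise integration of the second series.
\<close>
lemma Parseval_abs_summable:
  fixes a b :: "nat \<Rightarrow> complex"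
  assumes a: "summable (\<lambda>n. cmod (a n))" and b: "summable (\<lambda>n. cmod (b n))"
  shows "(\<lambda>n. of_real (2 * pi) * (a n * cnj (b n))) sums
      (\<integral>t. (\<Sum>n. a n * cis t ^ n) * cnj (\<Sum>n. b n * cis t ^ n) \<partial>circle_measure)"
proof -
  have one: "integrable circle_measure (\<lambda>_. 1 :: complex)"
    by (intro continuous_imp_integrable_real continuous_intros)
  have ib: "integrable circle_measure (\<lambda>t. cnj (\<Sum>n. b n * cis t ^ n))"
    using fourier_series_integral(2)[OF b one] by simp
  have "(\<integral>t. cis t ^ m * cnj (\<Sum>n. b n * cis t ^ n) \<partial>circle_measure) = of_real (2 * pi) * cnj (b m)" for m
  proof -
    have ic: "integrable circle_measure (\<lambda>t. cnj (cis t ^ m))"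
      by (intro integrable_cnj cis_power_integrable)
    have s: "(\<lambda>n. b n * (\<integral>t. cis t ^ n * cnj (cis t ^ m) \<partial>circle_measure)) sums
        (\<integral>t. (\<Sum>n. b n * cis t ^ n) * cnj (cis t ^ m) \<partial>circle_measure)"
      by (rule fourier_series_integral(1)[OF b ic])
    have eq: "(\<lambda>n. b n * (\<integral>t. cis t ^ n * cnj (cis t ^ m) \<partial>circle_measure))
        = (\<lambda>n. if n = m then b n * of_real (2 * pi) else 0)"
      by (rule ext) (subst integral_cis_power_cnj, simp)
    have "(\<integral>t. (\<Sum>n. b n * cis t ^ n) * cnj (cis t ^ m) \<partial>circle_measure) = b m * of_real (2 * pi)"
      by (rule sums_unique2[OF s[unfolded eq] sums_single])
    moreover have "(\<integral>t. cis t ^ m * cnj (\<Sum>n. b n * cis t ^ n) \<partial>circle_measure)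
        = cnj (\<integral>t. (\<Sum>n. b n * cis t ^ n) * cnj (cis t ^ m) \<partial>circle_measure)"
      by (subst Bochner_Integration.integral_cnj[symmetric]) (simp add: mult.commute)
    ultimately show ?thesis by simp
  qed
  thus ?thesis
    using fourier_series_integral(1)[OF a ib] by (simp add: mult_ac)
qed

lemma taylor_abs_summable:
  assumes "f holomorphic_on ball 0 1" "0 \<le> r" "r < 1"
  shows "summable (\<lambda>n. cmod (taylor f n * of_real r ^ n))"
proof -
  define \<rho> where "\<rho> = (1 + r) / 2"
  have \<rho>: "0 \<le> \<rho>" "r < \<rho>" "\<rho> < 1"
    using assms(2,3) by (auto simp: \<rho>_def)
  have "summable (\<lambda>n. taylor f n * of_real \<rho> ^ n)"
    by (rule sums_summable[OF taylor_sums[OF assms(1)]]) (use \<rho> in simp)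
  thus ?thesis
    by (rule powser_insidea) (use assms(2) \<rho> in simp)
qed

lemma taylor_circle:
  assumes "f holomorphic_on ball 0 1" "0 \<le> r" "r < 1"
  shows "f (of_real r * cis t) = (\<Sum>n. taylor f n * of_real r ^ n * cis t ^ n)"
  using taylor_sums[OF assms(1), of "of_real r * cis t"] assms(2,3)
  by (simp add: sums_iff norm_mult power_mult_distrib mult_ac)

lemma Parseval_circle:
  assumes "f holomorphic_on ball 0 1" "g holomorphic_on ball 0 1" "0 \<le> r" "r < 1"
  shows "(\<lambda>n. of_real (2 * pi) * (taylor f n * cnj (taylor g n) * of_real r ^ (2 * n))) sums
      (\<integral>t. f (of_real r * cis t) * cnj (g (of_real r * cis t)) \<partial>circle_measure)"
  using Parseval_abs_summable[OF taylor_abs_summable[OF assms(1,3,4)] taylor_abs_summable[OF assms(2,3,4)]]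
  unfolding taylor_circle[OF assms(1,3,4), symmetric] taylor_circle[OF assms(2,3,4), symmetric]
  by (simp add: mult_ac power_mult power2_eq_square power_mult_distrib)

definition radius_seq :: "nat \<Rightarrow> real" where
  "radius_seq k = 1 - inverse (real (Suc k))"

lemma radius_seq: "0 \<le> radius_seq k" "radius_seq k < 1"
  by (auto simp: radius_seq_def field_simps)

lemma radius_seq_tendsto: "radius_seq \<longlonglongrightarrow> 1"
  using tendsto_diff[OF tendsto_const LIMSEQ_inverse_real_of_nat, of 1]
  unfolding radius_seq_def by simp

lemma radius_seq_at_left: "filterlim radius_seq (at_left 1) sequentially"
  by (rule tendsto_imp_filterlim_at_left[OF radius_seq_tendsto]) (simp add: radius_seq)

lemma hinner_integral_limit:
  "(\<lambda>k. \<integral>t. hfun f (of_real (radius_seq k) * cis t) * cnj (hfun g (of_real (radius_seq k) * cis t)) \<partial>circle_measure)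
     \<longlonglongrightarrow> of_real (2 * pi) * hinner f g"
proof -
  define c where "c = (\<lambda>n. of_real (2 * pi) * (hcoeff f n * cnj (hcoeff g n)))"
  have "(\<lambda>k. \<Sum>n. c n * of_real (radius_seq k) ^ (2 * n)) \<longlonglongrightarrow> (\<Sum>n. c n)"
  proof (rule tannerys_theorem[THEN conjunct2, THEN conjunct2])
    show "(\<lambda>k. c n * of_real (radius_seq k) ^ (2 * n)) \<longlonglongrightarrow> c n" for n
      by (rule tendsto_eq_intros radius_seq_tendsto refl)+ simp
    show "summable (\<lambda>n. cmod (c n))"
      unfolding c_def by (simp add: norm_mult summable_mult summable_norm_mult hcoeff_summable)
    have "cmod (c n * of_real (radius_seq k) ^ (2 * n)) \<le> cmod (c n)" for n k
      using radius_seq[of k] by (simp add: norm_mult norm_power mult_left_le power_le_one)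
    thus "\<forall>\<^sub>F (n, k) in sequentially \<times>\<^sub>F sequentially.
        cmod (c n * of_real (radius_seq k) ^ (2 * n)) \<le> cmod (c n)"
      by (intro always_eventually) auto
  qed auto
  moreover have "(\<Sum>n. c n) = of_real (2 * pi) * hinner f g"
    unfolding c_def hinner_def by (intro suminf_mult hinner_summable)
  moreover have "(\<Sum>n. c n * of_real (radius_seq k) ^ (2 * n))
      = (\<integral>t. hfun f (of_real (radius_seq k) * cis t) * cnj (hfun g (of_real (radius_seq k) * cis t)) \<partial>circle_measure)" for k
    using Parseval_circle[OF hfun_holomorphic hfun_holomorphic radius_seq, of f g k]
    by (simp add: sums_iff c_def hcoeff_def mult_ac)
  ultimately show ?thesis by simp
qed

lemma circle_measurable:
  assumes "f holomorphic_on ball 0 1" "0 \<le> r" "r < 1"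
  shows "(\<lambda>t. f (of_real r * cis t)) \<in> borel_measurable circle_measure"
proof (rule continuous_imp_measurable_on_sets_lebesgue)
  have "continuous_on (ball 0 1) f"
    by (rule holomorphic_on_imp_continuous_on[OF assms(1)])
  thus "continuous_on {0..2*pi} (\<lambda>t. f (of_real r * cis t))"
    by (rule continuous_on_compose2) (use assms in \<open>auto intro!: continuous_intros simp: norm_mult\<close>)
qed auto

lemma circle_measurable_cnj:
  assumes "f holomorphic_on ball 0 1" "0 \<le> r" "r < 1"
  shows "(\<lambda>t. cnj (f (of_real r * cis t))) \<in> borel_measurable circle_measure"
  by (rule measurable_compose[OF circle_measurable[OF assms] borel_measurable_continuous_onI])
     (intro continuous_intros)

text \<open>
  Parseval's identity bounds \<open>\<Sum> |a\<^sub>n|\<^sup>2 r\<^sup>2\<^sup>n\<close> by the square of the bound of \<open>\<theta>\<close>, uniformly in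
  \<open>r < 1\<close>.
\<close>
lemma bounded_imp_hardy:
  assumes hol: "\<theta> holomorphic_on ball 0 1" and bdd: "bounded (\<theta> ` ball 0 1)"
  obtains T where "\<And>z. z \<in> ball 0 1 \<Longrightarrow> hfun T z = \<theta> z"
proof -
  obtain B where B: "\<And>z. z \<in> ball 0 1 \<Longrightarrow> cmod (\<theta> z) \<le> B"
    using bdd unfolding bounded_iff by (meson imageI)
  have "B \<ge> 0" using B[of 0] norm_ge_zero order_trans by (metis centre_in_ball zero_less_one)
  have est: "(\<Sum>n<N. (cmod (taylor \<theta> n))\<^sup>2 * r ^ (2 * n)) \<le> B\<^sup>2" if r: "0 \<le> r" "r < 1" for r N
  proof -
    let ?I = "\<integral>t. \<theta> (of_real r * cis t) * cnj (\<theta> (of_real r * cis t)) \<partial>circle_measure"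
    have "(\<lambda>n. cmod (of_real (2 * pi) * (taylor \<theta> n * cnj (taylor \<theta> n) * of_real r ^ (2 * n)))) =
      (\<lambda>n. 2 * pi * ((cmod (taylor \<theta> n))\<^sup>2 * r ^ (2 * n)))"
      using r by (simp add: norm_mult norm_power power2_eq_square)
    have s: "(\<lambda>n. 2 * pi * ((cmod (taylor \<theta> n))\<^sup>2 * r ^ (2 * n))) sums Re ?I"
      using sums_Re[OF Parseval_circle[OF hol hol r]]
      by (simp add: complex_norm_square[symmetric] flip: of_real_power of_real_mult)
    have "Re ?I \<le> cmod ?I" by (rule complex_Re_le_cmod)
    also have "\<dots> \<le> (\<integral>t. cmod (\<theta> (of_real r * cis t) * cnj (\<theta> (of_real r * cis t))) \<partial>circle_measure)"
      by (rule integral_norm_bound)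
    also have "\<dots> \<le> (\<integral>t. B\<^sup>2 \<partial>circle_measure)"
    proof (rule integral_mono)
      have bd: "cmod (\<theta> (of_real r * cis t) * cnj (\<theta> (of_real r * cis t))) \<le> B\<^sup>2" for t
        using r by (auto simp: norm_mult power2_eq_square intro!: mult_mono B \<open>B \<ge> 0\<close>)
      show "integrable circle_measure (\<lambda>t. B\<^sup>2)"
        by (intro continuous_imp_integrable_real continuous_intros)
      thus "integrable circle_measure (\<lambda>t. cmod (\<theta> (of_real r * cis t) * cnj (\<theta> (of_real r * cis t))))"
      proof (rule Bochner_Integration.integrable_bound)
        show "(\<lambda>t. cmod (\<theta> (of_real r * cis t) * cnj (\<theta> (of_real r * cis t)))) \<in> borel_measurable circle_measure"
          by (intro measurable_compose[OF _ borel_measurable_norm] borel_measurable_times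
              circle_measurable circle_measurable_cnj hol r)
      qed (use bd in auto)
      show "cmod (\<theta> (of_real r * cis t) * cnj (\<theta> (of_real r * cis t))) \<le> B\<^sup>2" for t by (rule bd)
    qed
    also have "\<dots> = 2 * pi * B\<^sup>2"
      using measure_circle_measure by simp
    finally have "Re ?I \<le> 2 * pi * B\<^sup>2" .
    moreover have "(\<Sum>n<N. 2 * pi * ((cmod (taylor \<theta> n))\<^sup>2 * r ^ (2 * n))) \<le> Re ?I"
      using s r by (intro sum_le_suminf[of _ "{..<N}", THEN order_trans]) (auto simp: sums_iff)
    ultimately have "2 * pi * (\<Sum>n<N. (cmod (taylor \<theta> n))\<^sup>2 * r ^ (2 * n)) \<le> 2 * pi * B\<^sup>2"
      by (simp add: sum_distrib_left)
    thus ?thesis by simp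
  qed
  have "(\<Sum>n<N. (cmod (taylor \<theta> n))\<^sup>2) \<le> B\<^sup>2" for N
  proof (rule LIMSEQ_le_const2)
    show "(\<lambda>k. \<Sum>n<N. (cmod (taylor \<theta> n))\<^sup>2 * radius_seq k ^ (2 * n)) \<longlonglongrightarrow> (\<Sum>n<N. (cmod (taylor \<theta> n))\<^sup>2)"
      by (rule tendsto_eq_intros radius_seq_tendsto refl)+ simp
  qed (use est[OF radius_seq] in blast)
  from this[of "Suc _"] have sm: "summable (\<lambda>n. (cmod (taylor \<theta> n))\<^sup>2)"
    unfolding lessThan_Suc_atMost by (rule bounded_imp_summable[rotated]) auto
  define f where "f = (\<lambda>z. if z \<in> ball 0 1 then \<theta> z else 0)"
  have hf: "f holomorphic_on ball 0 1"
    unfolding f_def by (rule holomorphic_transform[OF hol]) auto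
  have "\<forall>\<^sub>F z in nhds 0. f z = \<theta> z"
    using eventually_nhds_in_open[of "ball 0 1" "0::complex"] by (auto simp: f_def elim: eventually_mono)
  hence "fps_expansion f 0 = fps_expansion \<theta> 0"
    by (rule fps_expansion_cong)
  hence "taylor f n = taylor \<theta> n" for n
    by (simp add: taylor_def)
  hence "hfun (Abs_hardy f) = f"
    using hf sm by (intro Abs_hardy_inverse) (auto simp: f_def)
  thus ?thesis
    using that[of "Abs_hardy f"] by (simp add: f_def)
qed

text \<open>
  The inner product of \<open>z\<^sup>n \<theta>\<close> and \<open>\<theta>\<close> is the limit of the means of \<open>z\<^sup>n |\<theta>|\<^sup>2\<close> over circles of radius
  tending to 1. The integrands are bounded and tend to \<open>cis (n t)\<close> almost everywhere, because the
  radial limits of \<open>\<theta>\<close> have modulus 1.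
\<close>
proposition inner_function_imp_shift_orthonormal:
  assumes "inner_function \<theta>"
  obtains T where "\<And>z. z \<in> ball 0 1 \<Longrightarrow> hfun T z = \<theta> z" "shift_orthonormal T"
proof -
  have hol: "\<theta> holomorphic_on ball 0 1" and bdd: "bounded (\<theta> ` ball 0 1)"
    and ae: "AE t in circle_measure. \<exists>l. ((\<lambda>r. \<theta> (of_real r * cis t)) \<longlongrightarrow> l) (at_left 1) \<and> cmod l = 1"
    using assms by (auto simp: inner_function_def)
  obtain T where T: "\<And>z. z \<in> ball 0 1 \<Longrightarrow> hfun T z = \<theta> z"
    using bounded_imp_hardy[OF hol bdd] by blast
  obtain B where B: "\<And>z. z \<in> ball 0 1 \<Longrightarrow> cmod (\<theta> z) \<le> B"
    using bdd unfolding bounded_iff by (meson imageI)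
  have "B \<ge> 0" using B[of 0] norm_ge_zero order_trans by (metis centre_in_ball zero_less_one)
  have rc: "of_real (radius_seq k) * cis t \<in> ball 0 1" for k t
    using radius_seq[of k] by (simp add: norm_mult)
  have "hinner ((mult_z ^^ n) T) T = (if n = 0 then 1 else 0)" for n
  proof -
    define F where "F = (\<lambda>k t. (of_real (radius_seq k) * cis t) ^ n * hfun T (of_real (radius_seq k) * cis t)
        * cnj (hfun T (of_real (radius_seq k) * cis t)))"
    have "(\<lambda>k. \<integral>t. F k t \<partial>circle_measure) \<longlonglongrightarrow> (\<integral>t. cis t ^ n \<partial>circle_measure)"
    proof (rule integral_dominated_convergence[where w = "\<lambda>_. B * B"])
      show "(\<lambda>t. cis t ^ n) \<in> borel_measurable circle_measure" by (rule cis_power_measurable)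
      show "F k \<in> borel_measurable circle_measure" for k
        unfolding F_def power_mult_distrib
        by (intro borel_measurable_times borel_measurable_const cis_power_measurable
            circle_measurable circle_measurable_cnj hfun_holomorphic radius_seq)
      show "integrable circle_measure (\<lambda>_. B * B)"
        by (intro continuous_imp_integrable_real continuous_intros)
      have "cmod (F k t) \<le> 1 * (B * B)" for k t
        unfolding F_def norm_mult norm_power complex_mod_cnj norm_cis T[OF rc] mult.assoc
        using radius_seq[of k] \<open>B \<ge> 0\<close> by (intro mult_mono power_le_one B rc) auto
      thus "AE t in circle_measure. cmod (F k t) \<le> B * B" for k by simp
      show "AE t in circle_measure. (\<lambda>k. F k t) \<longlonglongrightarrow> cis t ^ n"
        using ae
      proof eventually_elim
        case (elim t)
        then obtain l where l: "((\<lambda>r. \<theta> (of_real r * cis t)) \<longlongrightarrow> l) (at_left 1)" "cmod l = 1" by blast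
        have lim: "(\<lambda>k. hfun T (of_real (radius_seq k) * cis t)) \<longlonglongrightarrow> l"
          using filterlim_compose[OF l(1) radius_seq_at_left] by (simp add: T[OF rc])
        have "(\<lambda>k. F k t) \<longlonglongrightarrow> (of_real 1 * cis t) ^ n * l * cnj l"
          unfolding F_def by (intro tendsto_intros radius_seq_tendsto lim)
        thus ?case
          using l(2) by (simp add: mult.assoc complex_norm_square[symmetric])
      qed
    qed
    moreover have "(\<lambda>k. \<integral>t. F k t \<partial>circle_measure) \<longlonglongrightarrow> of_real (2 * pi) * hinner ((mult_z ^^ n) T) T"
      using hinner_integral_limit[of "(mult_z ^^ n) T" T] by (simp add: F_def hfun_mult_z_power)
    ultimately have "of_real (2 * pi) * hinner ((mult_z ^^ n) T) T = (if n = 0 then of_real (2 * pi) else 0)"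
      using LIMSEQ_unique integral_cis_power by metis
    thus ?thesis by (auto split: if_splits)
  qed
  hence "shift_orthonormal T" by (simp add: shift_orthonormal_def)
  with T show ?thesis by (rule that)
qed

text \<open>
  Point evaluation at \<open>z\<close> is bounded on \<open>H\<^sup>2\<close>, and all powers of \<open>\<phi>\<close> have norm 1. Hence the powers of
  the number \<open>\<phi>(z)\<close> are bounded.
\<close>
lemma shift_orthonormal_bounded:
  assumes so: "shift_orthonormal \<phi>" and z: "z \<in> ball 0 1"
  shows "cmod (hfun \<phi> z) \<le> 1"
proof (rule ccontr)
  assume "\<not> ?thesis"
  hence gt: "1 < cmod (hfun \<phi> z)" by simp
  have "summable (\<lambda>n. (cmod (cnj z ^ n))\<^sup>2)"
  proof -
    have "(cmod (cnj z ^ n))\<^sup>2 = ((cmod z)\<^sup>2) ^ n" for n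
      by (simp add: norm_power mult.commute flip: power_mult)
    thus ?thesis
      using z by (simp add: summable_geometric abs_square_less_1)
  qed
  then obtain K where K: "\<And>n. hcoeff K n = cnj z ^ n"
    by (rule hardy_of_coeffs) blast
  have ev: "cmod (hfun f z) \<le> norm f * norm K" for f
  proof -
    have "hfun f z = hinner f K"
      unfolding hinner_def K using hfun_sums[OF z, of f] by (simp add: sums_iff)
    thus ?thesis using hinner_Cauchy_Schwarz[of f K] by simp
  qed
  have "cmod (hfun \<phi> z) ^ n \<le> norm K" for n
  proof -
    have "norm ((hmul \<phi> ^^ n) (hmonom 0)) = 1"
      by (induction n) (auto simp: norm_hmul[OF so] norm_hmonom)
    moreover have "hfun ((hmul \<phi> ^^ n) (hmonom 0)) z = hfun \<phi> z ^ n"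
      using z by (induction n) (auto simp: hfun_hmul[OF so] hfun_hmonom)
    ultimately show ?thesis
      using ev[of "(hmul \<phi> ^^ n) (hmonom 0)"] by (simp add: norm_power)
  qed
  with real_arch_pow[OF gt, of "norm K"] show False
    by (meson not_less)
qed

section \<open>Fatou's theorem\<close>
text \<open>
  Cauchy's formula for \<open>1 / (1 - r u)\<close> at \<open>u = r\<close>: on the unit circle \<open>1 - r u = u cnj (u - r)\<close>.
\<close>
lemma Poisson_kernel_integral:
  fixes r :: real
  assumes "0 \<le> r" "r < 1"
  shows "((\<lambda>x. 1 / (cmod (circlepath 0 1 x - of_real r))\<^sup>2) has_integral 1 / (1 - r\<^sup>2)) {0..1}"
proof -
  define f where "f = (\<lambda>u::complex. 1 / (1 - of_real r * u))"
  have nz: "1 - of_real r * u \<noteq> 0" if "cmod u \<le> 1" for u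
  proof
    assume "1 - of_real r * u = 0"
    hence "cmod (of_real r * u) = 1" by (metis eq_iff_diff_eq_0 norm_one)
    moreover have "cmod (of_real r * u) < 1"
      using assms that by (simp add: norm_mult) (metis mult_left_le le_less_trans)
    ultimately show False by simp
  qed
  have "continuous_on (cball 0 1) f" "f holomorphic_on ball 0 1"
    unfolding f_def by (intro continuous_intros holomorphic_intros; use nz in force)+
  from Cauchy_integral_circlepath[OF this, of "of_real r"]
  have "((\<lambda>u. f u / (u - of_real r)) has_contour_integral 2 * of_real pi * \<i> * f (of_real r)) (circlepath 0 1)"
    using assms by simp
  hence "((\<lambda>x. f (circlepath 0 1 x) / (circlepath 0 1 x - of_real r) *
      vector_derivative (circlepath 0 1) (at x within {0..1})) has_integral 2 * of_real pi * \<i> * f (of_real r)) {0..1}"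
    by (simp add: has_contour_integral_def)
  hence "((\<lambda>x. 2 * of_real pi * \<i> * of_real (1 / (cmod (circlepath 0 1 x - of_real r))\<^sup>2)) has_integral
      2 * of_real pi * \<i> * f (of_real r)) {0..1}"
  proof (rule has_integral_eq[rotated])
    fix x :: real assume x: "x \<in> {0..1}"
    define u where "u = circlepath 0 1 x"
    have u: "u = exp (2 * of_real pi * \<i> * x)" by (simp add: u_def circlepath)
    have nu: "cmod u = 1" by (simp add: u)
    have un: "u * cnj u = 1" by (simp add: complex_norm_square[symmetric] nu)
    have "1 - of_real r * u = u * cnj (u - of_real r)"
      using un by (simp add: algebra_simps)
    moreover have "u \<noteq> 0" using nu by auto
    ultimately have "f u / (u - of_real r) * u = 1 / ((u - of_real r) * cnj (u - of_real r))"
      by (simp add: f_def)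
    also have "\<dots> = of_real (1 / (cmod (u - of_real r))\<^sup>2)"
      by (simp only: complex_norm_square[symmetric] of_real_divide of_real_1)
    finally have "f u / (u - of_real r) * u = of_real (1 / (cmod (u - of_real r))\<^sup>2)" .
    moreover have "vector_derivative (circlepath 0 1) (at x within {0..1}) = 2 * of_real pi * \<i> * u"
      using x by (subst vector_derivative_circlepath01) (auto simp: u)
    ultimately show "f (circlepath 0 1 x) / (circlepath 0 1 x - of_real r) *
        vector_derivative (circlepath 0 1) (at x within {0..1}) =
        2 * of_real pi * \<i> * of_real (1 / (cmod (circlepath 0 1 x - of_real r))\<^sup>2)"
      unfolding u_def[symmetric] by (metis mult.assoc mult.commute)
  qed
  from has_integral_mult_right[OF this, of "1 / (2 * of_real pi * \<i>)"]
  have "((\<lambda>x. of_real (1 / (cmod (circlepath 0 1 x - of_real r))\<^sup>2)) has_integral f (of_real r)) {0..1}"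
    by (simp add: mult.assoc[symmetric])
  from has_integral_linear[OF this bounded_linear_Re]
  have "((\<lambda>x. 1 / (cmod (circlepath 0 1 x - of_real r))\<^sup>2) has_integral Re (f (of_real r))) {0..1}"
    by (simp add: o_def)
  moreover have "f (of_real r) = of_real (1 / (1 - r\<^sup>2))"
    by (simp add: f_def power2_eq_square)
  ultimately show ?thesis by simp
qed

text \<open>
  Cauchy's formula for \<open>H'(r)\<close> has a kernel of size \<open>1 / |u - r|\<^sup>2\<close>. Its integral
  against \<open>|u - 1|\<close> diverges logarithmically as \<open>r\<close> tends to 1, so \<open>H\<close> is first multiplied by a rational function
  \<open>b\<close> with \<open>b(r) = 1\<close> and \<open>b'(r) = 0\<close>, which does not change the derivative at \<open>r\<close>. Its only
  pole \<open>q = 2 - r\<close>, the mirror image of \<open>r\<close> in the point 1, is outside the disc, and its zero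
  at 1 makes the modified kernel, multiplied by \<open>|u - 1|\<close>, no larger than
  \<open>4 (1 - r) / |u - r|\<^sup>2\<close>, which has bounded integral. Away from the point 1 the kernel is
  \<open>O(1 - r)\<close>.
\<close>
lemma radial_derivative_bound:
  fixes H :: "complex \<Rightarrow> complex"
  assumes cont: "continuous_on (cball 0 1) H" and hol: "H holomorphic_on ball 0 1"
    and B: "\<And>z. cmod z \<le> 1 \<Longrightarrow> cmod (H z) \<le> B"
    and near: "\<And>\<xi>. cmod \<xi> = 1 \<Longrightarrow> cmod (\<xi> - 1) < \<delta> \<Longrightarrow> cmod (H \<xi>) \<le> \<epsilon> * cmod (\<xi> - 1)"
    and pos: "\<delta> > 0" "\<epsilon> \<ge> 0" and r: "0 < r" "r < 1" "1 - r \<le> \<delta> / 2"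
  shows "cmod (deriv H (of_real r)) \<le> 4 * \<epsilon> + 16 * B * (1 - r) / \<delta> ^ 3"
proof -
  define q where "q = complex_of_real (2 - r)"
  define R where "R = complex_of_real r"
  define b where "b = (\<lambda>u. - 4 * (1 - R) * (u - 1) / (u - q)\<^sup>2)"
  define f where "f = (\<lambda>u. H u * b u)"
  have uq: "u - q \<noteq> 0" if "cmod u \<le> 1" for u
  proof
    assume "u - q = 0"
    hence "cmod u = 2 - r" using r by (simp add: q_def del: of_real_diff)
    thus False using that r by simp
  qed
  have "B \<ge> 0" using B[of 0] norm_ge_zero order_trans by (metis norm_zero zero_le_one)
  have contf: "continuous_on (cball 0 1) f"
    unfolding f_def b_def by (intro continuous_intros cont) (use uq in auto)
  have holf: "f holomorphic_on ball 0 1"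
    unfolding f_def b_def by (intro holomorphic_intros hol) (use uq in auto)
  have Rb: "R \<in> ball 0 1" using r by (simp add: R_def)
  have Rq: "R - q = - 2 * (1 - R)" "R - q \<noteq> 0" "1 - R \<noteq> 0"
    using r by (auto simp: R_def q_def algebra_simps)
  have bR: "b R = 1"
  proof -
    have "b R = (- 2 * (1 - R))\<^sup>2 / (- 2 * (1 - R))\<^sup>2"
      unfolding b_def Rq(1) by (rule arg_cong2[where f = "(/)"]) (simp_all add: power2_eq_square algebra_simps)
    also have "\<dots> = 1"
      using Rq(3) by (intro divide_self) simp
    finally show ?thesis .
  qed
  have db: "(b has_field_derivative 0) (at R)"
  proof -
    have "(b has_field_derivative - 4 * (1 - R) * ((R - q)\<^sup>2 - (R - 1) * (2 * (R - q))) / ((R - q)\<^sup>2)\<^sup>2) (at R)"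
      unfolding b_def using Rq(2)
      by (auto intro!: derivative_eq_intros simp: power2_eq_square) (simp add: algebra_simps)
    moreover have "(R - q)\<^sup>2 - (R - 1) * (2 * (R - q)) = 0"
      unfolding Rq(1) by (simp add: power2_eq_square algebra_simps)
    ultimately show ?thesis by simp
  qed
  have dH: "(H has_field_derivative deriv H R) (at R)"
    using holomorphic_derivI[OF hol _ Rb] by simp
  have df: "(f has_field_derivative deriv H R) (at R)"
    using DERIV_mult[OF dH db] unfolding f_def by (simp add: bR)
  define g where "g = (\<lambda>u. f u / (u - R)\<^sup>2)"
  have gi: "g contour_integrable_on circlepath 0 1"
    unfolding g_def by (rule Cauchy_derivative_integral_circlepath(1)[OF contf holf Rb])
  have eq: "deriv H R = 1 / (2 * of_real pi * \<i>) * contour_integral (circlepath 0 1) g"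
    unfolding g_def
    by (rule DERIV_unique[OF df Cauchy_derivative_integral_circlepath(2)[OF contf holf Rb]])
  define C where "C = 16 * B * (1 - r) / \<delta> ^ 3"
  have gb: "cmod (g u) \<le> 4 * \<epsilon> * (1 - r) / (cmod (u - R))\<^sup>2 + C" if u: "cmod u = 1" for u
  proof -
    \<comment> \<open>The point \<open>u\<close> lies in the half-plane to the left of 1, and \<open>q\<close> is to the right of 1.\<close>
    have le: "cmod (u - 1) \<le> cmod (u - q)"
    proof -
      have "(cmod (u - q))\<^sup>2 - (cmod (u - 1))\<^sup>2 = (1 - r) * (3 - r - 2 * Re u)"
        unfolding q_def cmod_power2 by (simp add: power2_eq_square algebra_simps)
      also have "\<dots> \<ge> 0"
        using r complex_Re_le_cmod[of u] u by (intro mult_nonneg_nonneg) auto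
      finally show ?thesis by (simp add: abs_le_square_iff[symmetric])
    qed
    have uR: "cmod (u - R) > 0" using u r by (auto simp: R_def norm_of_real)
    have uq0: "cmod (u - q) > 0" using uq[of u] u by simp
    have cR: "cmod (1 - R) = 1 - r"
    proof -
      have "1 - R = of_real (1 - r)" by (simp add: R_def)
      thus ?thesis using r by (simp only: norm_of_real)
    qed
    have g1: "cmod (g u) = cmod (H u) * (4 * (1 - r) * cmod (u - 1) / (cmod (u - q))\<^sup>2) / (cmod (u - R))\<^sup>2"
      unfolding g_def f_def b_def norm_mult norm_divide norm_power cR by simp
    have C0: "C \<ge> 0" unfolding C_def using \<open>B \<ge> 0\<close> r pos by simp
    show ?thesis
    proof (cases "cmod (u - 1) < \<delta>")
      case True
      have "cmod (H u) * (4 * (1 - r) * cmod (u - 1) / (cmod (u - q))\<^sup>2)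
          \<le> (\<epsilon> * cmod (u - 1)) * (4 * (1 - r) * cmod (u - 1) / (cmod (u - q))\<^sup>2)"
        using near[OF u True] r by (intro mult_right_mono) auto
      also have "\<dots> = 4 * \<epsilon> * (1 - r) * ((cmod (u - 1))\<^sup>2 / (cmod (u - q))\<^sup>2)"
        by (simp add: power2_eq_square)
      also have "\<dots> \<le> 4 * \<epsilon> * (1 - r) * 1"
        using le uq0 pos r by (intro mult_left_mono) (auto simp: divide_le_eq intro!: power_mono)
      finally have "cmod (g u) \<le> 4 * \<epsilon> * (1 - r) / (cmod (u - R))\<^sup>2"
        unfolding g1 by (intro divide_right_mono) auto
      thus ?thesis using C0 by linarith
    next
      case False
      hence d: "\<delta> \<le> cmod (u - 1)" by simp
      have "cmod (u - 1) \<le> cmod (u - R) + cmod (R - 1)"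
        by (metis norm_triangle_ineq diff_add_cancel add_diff_eq)
      hence dR: "\<delta> / 2 \<le> cmod (u - R)"
        using d r(3) cR by (simp add: norm_minus_commute)
      have "cmod (u - 1) / (cmod (u - q))\<^sup>2 \<le> cmod (u - q) / (cmod (u - q))\<^sup>2"
        using le by (intro divide_right_mono) auto
      also have "\<dots> = 1 / cmod (u - q)" using uq0 by (simp add: power2_eq_square)
      also have "\<dots> \<le> 1 / \<delta>" using d le pos by (intro divide_left_mono mult_pos_pos uq0) auto
      finally have e1: "cmod (u - 1) / (cmod (u - q))\<^sup>2 \<le> 1 / \<delta>" .
      have "cmod (H u) * (4 * (1 - r) * (cmod (u - 1) / (cmod (u - q))\<^sup>2)) \<le> B * (4 * (1 - r) * (1 / \<delta>))"
        using B[of u] u e1 r \<open>B \<ge> 0\<close> by (intro mult_mono mult_left_mono) auto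
      hence "cmod (g u) \<le> B * (4 * (1 - r) * (1 / \<delta>)) / (cmod (u - R))\<^sup>2"
        unfolding g1 by (intro divide_right_mono) auto
      also have "\<dots> \<le> B * (4 * (1 - r) * (1 / \<delta>)) / (\<delta> / 2)\<^sup>2"
        using dR pos r \<open>B \<ge> 0\<close> uR by (intro divide_left_mono power_mono mult_pos_pos mult_nonneg_nonneg) auto
      also have "\<dots> = C"
        unfolding C_def using pos by (simp add: field_simps power2_eq_square power3_eq_cube)
      finally show ?thesis using pos r by (simp add: add_increasing)
    qed
  qed
  define K where "K = (\<lambda>x. 2 * pi * (4 * \<epsilon> * (1 - r) * (1 / (cmod (circlepath 0 1 x - R))\<^sup>2) + C))"
  have Ki: "(K has_integral 2 * pi * (4 * \<epsilon> * (1 - r) * (1 / (1 - r\<^sup>2)) + C)) {0..1}"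
  proof -
    have "((\<lambda>x::real. C) has_integral C) {0..1}"
      using has_integral_const_real[of C 0 1] by simp
    thus ?thesis
      unfolding K_def R_def
      by (intro has_integral_mult_right has_integral_add Poisson_kernel_integral) (use r in auto)
  qed
  have "(g has_contour_integral contour_integral (circlepath 0 1) g) (circlepath 0 1)"
    by (rule has_contour_integral_integral[OF gi])
  hence gI: "((\<lambda>x. g (circlepath 0 1 x) * vector_derivative (circlepath 0 1) (at x within {0..1}))
      has_integral contour_integral (circlepath 0 1) g) {0..1}"
    by (simp add: has_contour_integral_def)
  have "cmod (integral {0..1} (\<lambda>x. g (circlepath 0 1 x) * vector_derivative (circlepath 0 1) (at x within {0..1})))
      \<le> integral {0..1} K"
  proof (rule Henstock_Kurzweil_Integration.integral_norm_bound_integral)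
    fix x :: real assume x: "x \<in> {0..1}"
    have nc: "cmod (circlepath 0 1 x) = 1" by (simp add: circlepath)
    have "cmod (vector_derivative (circlepath 0 1) (at x within {0..1})) = 2 * pi"
      using x by (subst vector_derivative_circlepath01) (auto simp: norm_mult)
    hence "cmod (g (circlepath 0 1 x) * vector_derivative (circlepath 0 1) (at x within {0..1})) =
        2 * pi * cmod (g (circlepath 0 1 x))"
      unfolding norm_mult by simp
    also have "\<dots> \<le> 2 * pi * (4 * \<epsilon> * (1 - r) / (cmod (circlepath 0 1 x - R))\<^sup>2 + C)"
      by (intro mult_left_mono gb[OF nc]) simp
    finally show "cmod (g (circlepath 0 1 x) * vector_derivative (circlepath 0 1) (at x within {0..1})) \<le> K x"
      unfolding K_def by simp
  qed (use gI Ki in \<open>auto simp: integrable_on_def\<close>)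
  hence "cmod (contour_integral (circlepath 0 1) g) \<le> 2 * pi * (4 * \<epsilon> * (1 - r) * (1 / (1 - r\<^sup>2)) + C)"
    using integral_unique[OF gI] integral_unique[OF Ki] by simp
  hence "cmod (deriv H R) \<le> 4 * \<epsilon> * (1 - r) * (1 / (1 - r\<^sup>2)) + C"
    unfolding eq by (simp add: norm_mult norm_divide field_simps)
  also have "4 * \<epsilon> * (1 - r) * (1 / (1 - r\<^sup>2)) \<le> 4 * \<epsilon>"
  proof -
    have "1 - r\<^sup>2 = (1 - r) * (1 + r)" by (simp add: power2_eq_square algebra_simps)
    hence "4 * \<epsilon> * (1 - r) * (1 / (1 - r\<^sup>2)) = 4 * \<epsilon> / (1 + r)"
      using r by simp
    also have "\<dots> \<le> 4 * \<epsilon> / 1"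
      using r pos by (intro divide_left_mono) auto
    finally show ?thesis by simp
  qed
  finally show ?thesis unfolding C_def R_def by simp
qed

lemma radial_derivative_tendsto_0:
  fixes H :: "complex \<Rightarrow> complex"
  assumes cont: "continuous_on (cball 0 1) H" and hol: "H holomorphic_on ball 0 1"
    and near: "\<And>\<epsilon>. \<epsilon> > 0 \<Longrightarrow> \<exists>\<delta>>0. \<forall>\<xi>. cmod \<xi> = 1 \<longrightarrow> cmod (\<xi> - 1) < \<delta> \<longrightarrow> cmod (H \<xi>) \<le> \<epsilon> * cmod (\<xi> - 1)"
  shows "((\<lambda>r. deriv H (of_real r)) \<longlongrightarrow> 0) (at_left 1)"
proof -
  have "compact (H ` cball 0 1)"
    by (intro compact_continuous_image cont compact_cball)
  from compact_imp_bounded[OF this] obtain B where "\<forall>w\<in>H ` cball 0 1. cmod w \<le> B"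
    unfolding bounded_iff by blast
  hence B: "cmod (H z) \<le> B" if "cmod z \<le> 1" for z
    using that by simp
  show ?thesis
  proof (rule tendstoI)
    fix e :: real assume e: "e > 0"
    obtain \<delta> where d: "\<delta> > 0" "\<And>\<xi>. cmod \<xi> = 1 \<Longrightarrow> cmod (\<xi> - 1) < \<delta> \<Longrightarrow> cmod (H \<xi>) \<le> (e/8) * cmod (\<xi> - 1)"
      using near[of "e/8"] e by auto
    have "((\<lambda>r. 4 * (e/8) + 16 * B * (1 - r) / \<delta> ^ 3) \<longlongrightarrow> 4 * (e/8) + 16 * B * (1 - 1) / \<delta> ^ 3) (at_left 1)"
      using d by (intro tendsto_intros) auto
    hence 1: "\<forall>\<^sub>F r in at_left 1. 4 * (e/8) + 16 * B * (1 - r) / \<delta> ^ 3 < e"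
      by (rule order_tendstoD(2)) (use e in simp)
    have 2: "\<forall>\<^sub>F r in at_left 1. r \<in> {max 0 (1 - \<delta> / 2)<..<1::real}"
      using d by (intro eventually_at_left_real) auto
    from 1 2 show "\<forall>\<^sub>F r in at_left 1. dist (deriv H (of_real r)) 0 < e"
    proof eventually_elim
      case (elim r)
      have "cmod (deriv H (of_real r)) \<le> 4 * (e/8) + 16 * B * (1 - r) / \<delta> ^ 3"
        by (rule radial_derivative_bound[OF cont hol B d(2) d(1)]) (use elim e in auto)
      thus ?case using elim by simp
    qed
  qed
qed

text \<open>
  After a rotation to the point 1, subtract from \<open>F\<close> the linear function with the same value and
  tangential derivative there. Along the circle the difference \<open>H\<close> is then
  \<open>o(|\<xi> - 1|)\<close>, which is the hypothesis for its radial derivative to tend to 0.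
\<close>
lemma Fatou_at_point:
  fixes F :: "complex \<Rightarrow> complex"
  assumes cont: "continuous_on (cball 0 1) F" and hol: "F holomorphic_on ball 0 1"
    and D: "((\<lambda>s. F (cis s)) has_vector_derivative \<i> * cis t * L) (at t)"
  shows "((\<lambda>r. deriv F (of_real r * cis t)) \<longlongrightarrow> L) (at_left 1)"
proof -
  define H where "H = (\<lambda>z. F (z * cis t) - F (cis t) - L * cis t * (z - 1))"
  have contH: "continuous_on (cball 0 1) H"
    unfolding H_def by (intro continuous_intros continuous_on_compose2[OF cont]) (auto simp: norm_mult)
  have sub: "(\<lambda>z. z * cis t) ` ball 0 1 \<subseteq> ball 0 1" by (auto simp: norm_mult)
  have holH: "H holomorphic_on ball 0 1"
    unfolding H_def
    by (intro holomorphic_intros holomorphic_on_compose_gen[OF _ hol sub, unfolded o_def])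
  have dH: "deriv H z = deriv F (z * cis t) * cis t - L * cis t" if z: "z \<in> ball 0 1" for z
  proof (rule DERIV_imp_deriv)
    have "(F has_field_derivative deriv F (z * cis t)) (at (z * cis t))"
      by (rule holomorphic_derivI[OF hol]) (use z in \<open>auto simp: norm_mult\<close>)
    hence "((\<lambda>z. F (z * cis t)) has_field_derivative deriv F (z * cis t) * cis t) (at z)"
      by (rule DERIV_chain2) (auto intro!: derivative_eq_intros)
    thus "(H has_field_derivative deriv F (z * cis t) * cis t - L * cis t) (at z)"
      unfolding H_def by (auto intro!: derivative_eq_intros)
  qed
  have "((\<lambda>r. deriv H (of_real r)) \<longlongrightarrow> 0) (at_left 1)"
  proof (rule radial_derivative_tendsto_0[OF contH holH])
    fix \<epsilon> :: real assume e: "\<epsilon> > 0"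
    have vd: "((\<lambda>u. H (cis u)) has_vector_derivative 0) (at 0)"
    proof -
      have sh: "((\<lambda>u. F (cis (u + t))) has_vector_derivative \<i> * cis t * L) (at 0)"
      proof -
        have "((\<lambda>u. u + t) has_vector_derivative 1) (at 0)"
          by (auto intro!: derivative_eq_intros)
        from vector_diff_chain_at[OF this, of "\<lambda>s. F (cis s)"] D show ?thesis
          by (simp add: o_def)
      qed
      have c: "((\<lambda>u. cis u) has_vector_derivative \<i>) (at 0)"
      proof -
        have "((\<lambda>z. exp (\<i> * z)) has_field_derivative \<i>) (at (of_real 0))"
          by (auto intro!: derivative_eq_intros)
        from has_vector_derivative_real_field[OF this] show ?thesis
          by (simp add: cis_conv_exp)
      qed
      have "((\<lambda>u. F (cis (u + t)) - F (cis t) - L * cis t * (cis u - 1)) has_vector_derivative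
          \<i> * cis t * L - 0 - L * cis t * (\<i> - 0)) (at 0)"
        by (intro has_vector_derivative_diff sh has_vector_derivative_const c has_vector_derivative_mult_right)
      thus ?thesis
        unfolding H_def by (simp add: cis_mult mult_ac)
    qed
    have H0: "H (cis 0) = 0" by (simp add: H_def)
    from vd have "((\<lambda>u. H (cis u)) has_derivative (\<lambda>_. 0)) (at 0)"
      by (simp add: has_vector_derivative_def)
    then obtain \<eta> where eta: "\<eta> > 0" "\<And>u. \<bar>u\<bar> < \<eta> \<Longrightarrow> cmod (H (cis u)) \<le> \<epsilon> / 2 * \<bar>u\<bar>"
      unfolding has_derivative_at_alt using e H0 by (fastforce dest: spec[of _ "\<epsilon> / 2"])
    \<comment> \<open>Near 1 the angle of a point of the circle is at most twice its distance from 1.\<close>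
    have "(Ln has_derivative (\<lambda>h. h)) (at 1)"
      using has_field_derivative_Ln[of 1] by (simp add: has_field_derivative_def mult_1_left[abs_def])
    then obtain \<delta> where del: "\<delta> > 0" "\<And>y. cmod (y - 1) < \<delta> \<Longrightarrow> cmod (Ln y - Ln 1 - (y - 1)) \<le> 1 * cmod (y - 1)"
      unfolding has_derivative_at_alt by (metis zero_less_one)
    have "cmod (H \<xi>) \<le> \<epsilon> * cmod (\<xi> - 1)" if xi: "cmod \<xi> = 1" "cmod (\<xi> - 1) < min \<delta> (\<eta> / 2)" for \<xi>
    proof -
      define u where "u = Im (Ln \<xi>)"
      have "\<xi> \<noteq> 0" using xi by auto
      hence "\<xi> = exp (Ln \<xi>)" by simp
      moreover have "Re (Ln \<xi>) = 0" using xi \<open>\<xi> \<noteq> 0\<close> by simp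
      ultimately have xu: "\<xi> = cis u"
        unfolding u_def cis_conv_exp by (metis complex_eq add_0 of_real_0)
      have "\<bar>u\<bar> \<le> cmod (Ln \<xi>)" unfolding u_def by (rule abs_Im_le_cmod)
      also have "\<dots> \<le> cmod (Ln \<xi> - (\<xi> - 1)) + cmod (\<xi> - 1)"
        by (metis norm_triangle_ineq diff_add_cancel)
      also have "\<dots> \<le> 2 * cmod (\<xi> - 1)" using del(2)[of \<xi>] xi by simp
      finally have u: "\<bar>u\<bar> \<le> 2 * cmod (\<xi> - 1)" .
      hence "cmod (H \<xi>) \<le> \<epsilon> / 2 * \<bar>u\<bar>"
        unfolding xu using xi eta(2)[of u] by (simp add: xu)
      also have "\<dots> \<le> \<epsilon> / 2 * (2 * cmod (\<xi> - 1))"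
        using u e by (intro mult_left_mono) auto
      finally show ?thesis by simp
    qed
    thus "\<exists>\<delta>>0. \<forall>\<xi>. cmod \<xi> = 1 \<longrightarrow> cmod (\<xi> - 1) < \<delta> \<longrightarrow> cmod (H \<xi>) \<le> \<epsilon> * cmod (\<xi> - 1)"
      using del(1) eta(1) by (intro exI[of _ "min \<delta> (\<eta> / 2)"]) auto
  qed
  hence "((\<lambda>r. deriv H (of_real r) / cis t + L) \<longlongrightarrow> 0 / cis t + L) (at_left 1)"
    by (intro tendsto_intros) auto
  moreover have "\<forall>\<^sub>F r in at_left 1. deriv H (of_real r) / cis t + L = deriv F (of_real r * cis t)"
  proof -
    have "\<forall>\<^sub>F r in at_left 1. r \<in> {0<..<1::real}"
      by (rule eventually_at_left_real) simp
    thus ?thesis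
      by eventually_elim (simp add: dH field_simps)
  qed
  ultimately show ?thesis
    by (simp add: filterlim_cong)
qed

text \<open>
  The one-sided differentiation theorem is applied to \<open>f\<close> and to its reflection; the two exceptional
  sets together are negligible.
\<close>
lemma AE_derivative_of_indefinite_integral:
  fixes f G :: "real \<Rightarrow> complex"
  assumes f: "f integrable_on {A..B}"
    and G: "\<And>a b. A \<le> a \<Longrightarrow> a \<le> b \<Longrightarrow> b \<le> B \<Longrightarrow> integral {a..b} f = G b - G a"
  obtains N where "negligible N" "\<And>x. x \<in> {A<..<B} - N \<Longrightarrow> (G has_vector_derivative f x) (at x)"
proof -
  \<comment> \<open>The differentiation theorem requires integrability over all intervals.\<close>
  define h where "h = (\<lambda>x. if x \<in> {A..B} then f x else 0)"
  have "h integrable_on UNIV"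
    unfolding h_def by (rule Henstock_Kurzweil_Integration.integrable_restrict_UNIV[THEN iffD2, OF f])
  hence hi: "h integrable_on cbox a b" for a b
    by (rule integrable_on_subcbox) auto
  have hi': "(\<lambda>x. h (- x)) integrable_on cbox a b" for a b
    using hi[of "- b" "- a"] Henstock_Kurzweil_Integration.integrable_reflect_real[where f = h and a = "- b" and b = "- a"] by simp
  obtain N1 where N1: "negligible N1" "\<And>x e. x \<notin> N1 \<Longrightarrow> 0 < e \<Longrightarrow> \<exists>d>0. \<forall>u. 0 < u \<and> u < d \<longrightarrow>
      norm (integral (cbox x (x + u *\<^sub>R One)) h /\<^sub>R u ^ DIM(real) - h x) < e"
    using integrable_ccontinuous_explicit[OF hi] by blast
  obtain N2 where N2: "negligible N2" "\<And>x e. x \<notin> N2 \<Longrightarrow> 0 < e \<Longrightarrow> \<exists>d>0. \<forall>u. 0 < u \<and> u < d \<longrightarrow>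
      norm (integral (cbox x (x + u *\<^sub>R One)) (\<lambda>x. h (- x)) /\<^sub>R u ^ DIM(real) - h (- x)) < e"
    using integrable_ccontinuous_explicit[OF hi'] by blast
  have int_h: "integral {a..b} h = G b - G a" if "A \<le> a" "a \<le> b" "b \<le> B" for a b
  proof -
    have "integral {a..b} h = integral {a..b} f"
      by (rule integral_cong) (use that in \<open>auto simp: h_def\<close>)
    thus ?thesis using G[OF that] by simp
  qed
  have "negligible (uminus ` N2)"
    by (rule negligible_differentiable_image_negligible[OF _ N2(1)])
       (auto intro!: derivative_intros simp: differentiable_on_def)
  hence neg: "negligible (N1 \<union> uminus ` N2)" using N1(1) by simp
  have "(G has_vector_derivative f x) (at x)" if x: "x \<in> {A<..<B} - (N1 \<union> uminus ` N2)" for x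
    unfolding has_vector_derivative_def has_derivative_at_alt
  proof (intro conjI allI impI)
    show "bounded_linear (\<lambda>c. c *\<^sub>R f x)" by (rule bounded_linear_scaleR_left)
    fix e :: real assume e: "e > 0"
    have hx: "h x = f x" using x by (auto simp: h_def)
    obtain d1 where d1: "d1 > 0" "\<And>u. 0 < u \<Longrightarrow> u < d1 \<Longrightarrow> cmod (integral {x..x + u} h /\<^sub>R u - h x) < e"
      using N1(2)[of x e] x e by auto
    have "- x \<notin> N2" using x by (metis DiffD2 UnI2 imageI minus_minus)
    then obtain d2 where d2: "d2 > 0" "\<And>u. 0 < u \<Longrightarrow> u < d2 \<Longrightarrow>
        cmod (integral {- x..- x + u} (\<lambda>x. h (- x)) /\<^sub>R u - h x) < e"
      using N2(2)[of "- x" e] e by auto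
    define d where "d = Min {d1, d2, x - A, B - x}"
    have d: "d > 0" "d \<le> d1" "d \<le> d2" "d \<le> x - A" "d \<le> B - x"
      using d1 d2 x by (auto simp: d_def)
    have scal: "cmod (I - u *\<^sub>R c) \<le> e * u" if "u > 0" "cmod (I /\<^sub>R u - c) < e" for I c and u :: real
    proof -
      have "cmod (I - u *\<^sub>R c) = u * cmod (I /\<^sub>R u - c)"
      proof -
        have "I - u *\<^sub>R c = u *\<^sub>R (I /\<^sub>R u - c)"
          using that(1) by (simp add: scaleR_diff_right)
        thus ?thesis using that(1) by (simp only: norm_scaleR abs_of_pos)
      qed
      thus ?thesis using that by (simp add: mult.commute)
    qed
    have "cmod (G y - G x - (y - x) *\<^sub>R f x) \<le> e * norm (y - x)" if y: "norm (y - x) < d" for y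
    proof (cases y x rule: linorder_cases)
      case greater
      have "integral {x..x + (y - x)} h = G y - G x"
        using int_h[of x y] greater y d x by auto
      thus ?thesis
        using scal[OF _ d1(2)[of "y - x"]] greater y d hx by auto
    next
      case less
      have "integral {- x..- x + (x - y)} (\<lambda>x. h (- x)) = integral {y..x} h"
        using Henstock_Kurzweil_Integration.integral_reflect_real[where f = h and a = y and b = x] by simp
      hence eq: "integral {- x..- x + (x - y)} (\<lambda>x. h (- x)) = G x - G y"
        using int_h[of y x] less y d x by auto
      have "cmod (G x - G y - (x - y) *\<^sub>R f x) \<le> e * (x - y)"
        using scal[OF _ d2(2)[of "x - y"]] less y d hx eq by auto
      moreover have eq': "G y - G x - (y - x) *\<^sub>R f x = - (G x - G y - (x - y) *\<^sub>R f x)"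
        by (simp add: algebra_simps)
      ultimately show ?thesis
        unfolding eq' norm_minus_cancel using less by simp
    qed auto
    thus "\<exists>d>0. \<forall>y. norm (y - x) < d \<longrightarrow> cmod (G y - G x - (y - x) *\<^sub>R f x) \<le> e * norm (y - x)"
      using d(1) by blast
  qed
  with neg show ?thesis by (rule that)
qed

lemma integral_trig_polynomial_square:
  fixes a :: "nat \<Rightarrow> complex"
  assumes "finite S"
  shows "integrable circle_measure (\<lambda>t. (cmod (\<Sum>n\<in>S. a n * cis t ^ n))\<^sup>2)"
    and "(\<integral>t. (cmod (\<Sum>n\<in>S. a n * cis t ^ n))\<^sup>2 \<partial>circle_measure) = 2 * pi * (\<Sum>n\<in>S. (cmod (a n))\<^sup>2)"
proof -
  define b where "b = (\<lambda>n. if n \<in> S then a n else 0)"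
  have b0: "b n = 0" if "n \<notin> S" for n using that by (simp add: b_def)
  have sm: "summable (\<lambda>n. cmod (b n))"
    by (rule summable_finite[OF assms]) (simp add: b0)
  have s1: "(\<Sum>n. b n * cis t ^ n) = (\<Sum>n\<in>S. a n * cis t ^ n)" for t
    by (subst suminf_finite[OF assms]) (auto simp: b_def)
  have "(\<lambda>n. of_real (2 * pi) * (b n * cnj (b n))) sums (\<Sum>n\<in>S. of_real (2 * pi) * (b n * cnj (b n)))"
    by (rule sums_finite[OF assms]) (simp add: b0)
  from sums_unique2[OF Parseval_abs_summable[OF sm sm] this]
  have "(\<integral>t. complex_of_real ((cmod (\<Sum>n\<in>S. a n * cis t ^ n))\<^sup>2) \<partial>circle_measure)
      = (\<Sum>n\<in>S. of_real (2 * pi) * complex_of_real ((cmod (b n))\<^sup>2))"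
    unfolding s1 complex_norm_square .
  also have "\<dots> = complex_of_real (2 * pi * (\<Sum>n\<in>S. (cmod (a n))\<^sup>2))"
    by (simp add: b_def sum_distrib_left)
  finally show "(\<integral>t. (cmod (\<Sum>n\<in>S. a n * cis t ^ n))\<^sup>2 \<partial>circle_measure) = 2 * pi * (\<Sum>n\<in>S. (cmod (a n))\<^sup>2)"
    unfolding integral_complex_of_real by (simp only: of_real_eq_iff)
  show "integrable circle_measure (\<lambda>t. (cmod (\<Sum>n\<in>S. a n * cis t ^ n))\<^sup>2)"
    by (intro continuous_imp_integrable_real continuous_intros)
qed

text \<open>
  Cut the Fourier series at indices \<open>K k\<close> beyond which the squares of the coefficients sum to less than
  \<open>4\<^sup>-\<^sup>k\<close>. The \<open>k\<close>-th block \<open>p k\<close> then has \<open>L\<^sup>2\<close> norm of order \<open>2\<^sup>-\<^sup>k\<close>, hence also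
  \<open>L\<^sup>1\<close> norm of this order, so the sum of the blocks converges absolutely almost everywhere and can be integrated
  termwise against bounded functions.
\<close>
lemma boundary_function:
  fixes a :: "nat \<Rightarrow> complex"
  assumes a: "summable (\<lambda>n. (cmod (a n))\<^sup>2)"
  obtains u K where "integrable circle_measure u" "strict_mono (K :: nat \<Rightarrow> nat)"
    "\<And>g C. g \<in> borel_measurable circle_measure \<Longrightarrow> (\<And>t. cmod (g t) \<le> C) \<Longrightarrow>
       (\<lambda>k. \<integral>t. (\<Sum>n<K k. a n * cis t ^ n) * g t \<partial>circle_measure) \<longlonglongrightarrow> (\<integral>t. u t * g t \<partial>circle_measure) \<and>
       integrable circle_measure (\<lambda>t. u t * g t)"
proof -
  have "\<forall>k. \<exists>N. \<forall>m\<ge>N. \<forall>n. norm (\<Sum>i=m..<n. (cmod (a i))\<^sup>2) < (1/4) ^ k"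
    using a unfolding summable_Cauchy by simp
  then obtain N where N: "\<And>k m n. m \<ge> N k \<Longrightarrow> norm (\<Sum>i=m..<n. (cmod (a i))\<^sup>2) < (1/4) ^ k"
    unfolding choice_iff by blast
  \<comment> \<open>The summand \<open>k\<close> makes \<open>K\<close> strictly increasing.\<close>
  define K where "K = (\<lambda>k. k + (\<Sum>j\<le>k. N j))"
  have K: "strict_mono K"
    by (rule strict_monoI_Suc) (simp add: K_def)
  have KN: "K k \<ge> N k" for k
    unfolding K_def using member_le_sum[of k "{..k}" N] by (simp add: trans_le_add2)
  define s where "s = (\<lambda>n t. \<Sum>i<n. a i * cis t ^ i)"
  define p where "p = (\<lambda>k t. \<Sum>n=K k..<K (Suc k). a n * cis t ^ n)"
  have p_s: "s (K (Suc k)) t = s (K k) t + p k t" for k t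
  proof -
    have "K k \<le> K (Suc k)" using K by (simp add: strict_mono_less_eq)
    thus ?thesis
      unfolding s_def p_def lessThan_atLeast0 by (simp add: sum.atLeastLessThan_concat)
  qed
  have s_p: "s (K k) t = s (K 0) t + (\<Sum>j<k. p j t)" for k t
    by (induction k) (auto simp: p_s)
  have s_int: "integrable circle_measure (s n)" for n
    unfolding s_def by (intro continuous_imp_integrable_real continuous_intros)
  have p_int: "integrable circle_measure (p k)" for k
    unfolding p_def by (intro continuous_imp_integrable_real continuous_intros)
  have p_norm: "(\<integral>t. cmod (p k t) \<partial>circle_measure) \<le> 2 * pi * (1/2) ^ k" for k
  proof -
    have p2: "integrable circle_measure (\<lambda>t. (cmod (p k t))\<^sup>2)"
        "(\<integral>t. (cmod (p k t))\<^sup>2 \<partial>circle_measure) = 2 * pi * (\<Sum>n=K k..<K (Suc k). (cmod (a n))\<^sup>2)"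
      unfolding p_def by (intro integral_trig_polynomial_square; simp)+
    have c: "integrable circle_measure (\<lambda>t. (1/2) ^ k / 2 :: real)"
      by (intro continuous_imp_integrable_real continuous_intros)
    \<comment> \<open>The \<open>L\<^sup>1\<close> norm is controlled by \<open>2 x \<le> 2\<^sup>-\<^sup>k + 2\<^sup>k x\<^sup>2\<close>, which replaces the Cauchy-Schwarz inequality.\<close>
    have "(\<integral>t. cmod (p k t) \<partial>circle_measure) \<le> (\<integral>t. (1/2) ^ k / 2 + 2 ^ k / 2 * (cmod (p k t))\<^sup>2 \<partial>circle_measure)"
    proof (rule integral_mono)
      show "integrable circle_measure (\<lambda>t. cmod (p k t))" by (intro integrable_norm p_int)
      show "integrable circle_measure (\<lambda>t. (1/2) ^ k / 2 + 2 ^ k / 2 * (cmod (p k t))\<^sup>2)"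
        by (intro Bochner_Integration.integrable_add c integrable_mult_right p2)
      have sq: "2 * x \<le> (1/2) ^ k + 2 ^ k * x\<^sup>2" for x :: real
      proof -
        have "0 \<le> 2 ^ k * ((1/2) ^ k - x)\<^sup>2" by simp
        also have "2 ^ k * ((1/2) ^ k - x)\<^sup>2 = (1/2) ^ k - 2 * x + 2 ^ k * x\<^sup>2"
          by (simp add: power2_eq_square field_simps)
        finally show ?thesis by simp
      qed
      have "(1/2) ^ k / 2 + 2 ^ k / 2 * x\<^sup>2 = ((1/2) ^ k + 2 ^ k * x\<^sup>2) / 2" for x :: real
        by (simp add: add_divide_distrib)
      thus "cmod (p k t) \<le> (1/2) ^ k / 2 + 2 ^ k / 2 * (cmod (p k t))\<^sup>2" for t
        using sq[of "cmod (p k t)"] by simp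
    qed
    also have "\<dots> = 2 * pi * ((1/2) ^ k / 2) + 2 ^ k / 2 * (2 * pi * (\<Sum>n=K k..<K (Suc k). (cmod (a n))\<^sup>2))"
      using measure_circle_measure
      by (subst Bochner_Integration.integral_add) (use c p2 in \<open>auto intro!: integrable_mult_right\<close>)
    also have "\<dots> \<le> 2 * pi * ((1/2) ^ k / 2) + 2 ^ k / 2 * (2 * pi * (1/4) ^ k)"
      using N[OF KN, of k "K (Suc k)"] by (intro add_left_mono mult_left_mono) auto
    also have "\<dots> = 2 * pi * (1/2) ^ k"
    proof -
      have "(1/4 :: real) ^ k = (1/2) ^ k * (1/2) ^ k" by (simp flip: power_mult_distrib)
      thus ?thesis by (simp add: field_simps)
    qed
    finally show ?thesis .
  qed
  have geo: "summable (\<lambda>k. C * (2 * pi * (1/2) ^ k))" for C :: real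
    by (intro summable_mult summable_geometric) auto
  have p_sm: "summable (\<lambda>k. \<integral>t. cmod (p k t) \<partial>circle_measure)"
    by (rule summable_comparison_test'[OF geo[of 1], of 0]) (simp add: p_norm)
  have ae: "AE t in circle_measure. summable (\<lambda>k. cmod (p k t))"
  proof -
    have meas: "(\<lambda>t. ennreal (cmod (p k t))) \<in> borel_measurable circle_measure" for k
      using borel_measurable_integrable[OF integrable_norm[OF p_int[of k]]] by measurable
    have "(\<integral>\<^sup>+ t. (\<Sum>k. ennreal (cmod (p k t))) \<partial>circle_measure)
        = (\<Sum>k. \<integral>\<^sup>+ t. ennreal (cmod (p k t)) \<partial>circle_measure)"
      by (rule nn_integral_suminf[OF meas])
    also have "\<dots> = (\<Sum>k. ennreal (\<integral>t. cmod (p k t) \<partial>circle_measure))"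
      by (intro suminf_cong nn_integral_eq_integral integrable_norm p_int) auto
    also have "\<dots> = ennreal (\<Sum>k. \<integral>t. cmod (p k t) \<partial>circle_measure)"
      by (intro suminf_ennreal2 p_sm) auto
    finally have "(\<integral>\<^sup>+ t. (\<Sum>k. ennreal (cmod (p k t))) \<partial>circle_measure) \<noteq> \<infinity>" by simp
    hence "AE t in circle_measure. (\<Sum>k. ennreal (cmod (p k t))) \<noteq> \<infinity>"
      by (intro nn_integral_PInf_AE borel_measurable_suminf_order meas)
    thus ?thesis
      by eventually_elim (rule summable_suminf_not_top, auto)
  qed
  define v where "v = (\<lambda>t. \<Sum>k. p k t)"
  have v_int: "integrable circle_measure v"
    unfolding v_def by (rule integrable_suminf[OF p_int ae p_sm])
  define u where "u = (\<lambda>t. s (K 0) t + v t)"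
  show ?thesis
  proof (rule that[of u K])
    show "integrable circle_measure u"
      unfolding u_def by (intro Bochner_Integration.integrable_add s_int v_int)
    fix g :: "real \<Rightarrow> complex" and C
    assume g: "g \<in> borel_measurable circle_measure" and C: "\<And>t. cmod (g t) \<le> C"
    have mult_int: "integrable circle_measure (\<lambda>t. f t * g t)" if f: "integrable circle_measure f" for f
    proof (rule Bochner_Integration.integrable_bound[of _ "\<lambda>t. C * cmod (f t)"])
      show "integrable circle_measure (\<lambda>t. C * cmod (f t))"
        by (intro integrable_mult_right integrable_norm f)
      show "(\<lambda>t. f t * g t) \<in> borel_measurable circle_measure"
        by (intro borel_measurable_times g borel_measurable_integrable[OF f])
      have "cmod (f t * g t) \<le> norm (C * cmod (f t))" for t
      proof -
        have "cmod (f t * g t) \<le> cmod (f t) * C"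
          unfolding norm_mult by (intro mult_left_mono C) simp
        thus ?thesis by (metis abs_ge_self mult.commute order_trans real_norm_def)
      qed
      thus "AE t in circle_measure. cmod (f t * g t) \<le> norm (C * cmod (f t))" by simp
    qed
    have pg_int: "integrable circle_measure (\<lambda>t. p k t * g t)" for k
      by (rule mult_int[OF p_int])
    have C0: "C \<ge> 0" using order_trans[OF norm_ge_zero C] .
    have ae_g: "AE t in circle_measure. summable (\<lambda>k. norm (p k t * g t))"
      using ae by eventually_elim (simp add: norm_mult summable_mult2)
    have sm_g: "summable (\<lambda>k. \<integral>t. norm (p k t * g t) \<partial>circle_measure)"
    proof (rule summable_comparison_test'[OF summable_mult[OF p_sm, of C], of 0])
      fix k
      have "(\<integral>t. norm (p k t * g t) \<partial>circle_measure) \<le> (\<integral>t. C * cmod (p k t) \<partial>circle_measure)"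
        using C by (intro integral_mono integrable_norm pg_int integrable_mult_right p_int)
          (simp add: norm_mult mult.commute mult_right_mono)
      thus "norm (\<integral>t. norm (p k t * g t) \<partial>circle_measure) \<le> C * (\<integral>t. cmod (p k t) \<partial>circle_measure)"
        by simp
    qed
    have "(\<lambda>k. \<integral>t. p k t * g t \<partial>circle_measure) sums (\<integral>t. (\<Sum>k. p k t * g t) \<partial>circle_measure)"
      by (rule sums_integral[OF pg_int ae_g sm_g])
    also have "(\<integral>t. (\<Sum>k. p k t * g t) \<partial>circle_measure) = (\<integral>t. v t * g t \<partial>circle_measure)"
    proof (rule integral_cong_AE)
      show "(\<lambda>t. \<Sum>k. p k t * g t) \<in> borel_measurable circle_measure"
        by (rule borel_measurable_integrable[OF integrable_suminf[OF pg_int ae_g sm_g]])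
      show "(\<lambda>t. v t * g t) \<in> borel_measurable circle_measure"
        by (rule borel_measurable_integrable[OF mult_int[OF v_int]])
      show "AE t in circle_measure. (\<Sum>k. p k t * g t) = v t * g t"
        using ae
      proof eventually_elim
        case (elim t)
        show ?case
          unfolding v_def by (rule suminf_mult2[symmetric, OF summable_norm_cancel[OF elim]])
      qed
    qed
    finally have "(\<lambda>k. \<Sum>j<k. \<integral>t. p j t * g t \<partial>circle_measure) \<longlonglongrightarrow> (\<integral>t. v t * g t \<partial>circle_measure)"
      by (simp add: sums_def)
    hence "(\<lambda>k. (\<integral>t. s (K 0) t * g t \<partial>circle_measure) + (\<Sum>j<k. \<integral>t. p j t * g t \<partial>circle_measure))
        \<longlonglongrightarrow> (\<integral>t. s (K 0) t * g t \<partial>circle_measure) + (\<integral>t. v t * g t \<partial>circle_measure)"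
      by (intro tendsto_intros)
    moreover have "(\<integral>t. s (K 0) t * g t \<partial>circle_measure) + (\<Sum>j<k. \<integral>t. p j t * g t \<partial>circle_measure)
        = (\<integral>t. s (K k) t * g t \<partial>circle_measure)" for k
    proof -
      have "(\<integral>t. s (K k) t * g t \<partial>circle_measure)
          = (\<integral>t. s (K 0) t * g t + (\<Sum>j<k. p j t * g t) \<partial>circle_measure)"
        unfolding s_p[of k] by (simp add: distrib_right sum_distrib_right)
      also have "\<dots> = (\<integral>t. s (K 0) t * g t \<partial>circle_measure) + (\<integral>t. (\<Sum>j<k. p j t * g t) \<partial>circle_measure)"
        by (intro Bochner_Integration.integral_add mult_int[OF s_int] Bochner_Integration.integrable_sum pg_int)
      also have "(\<integral>t. (\<Sum>j<k. p j t * g t) \<partial>circle_measure) = (\<Sum>j<k. \<integral>t. p j t * g t \<partial>circle_measure)"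
        by (intro Bochner_Integration.integral_sum pg_int)
      finally show ?thesis by simp
    qed
    moreover have "(\<integral>t. s (K 0) t * g t \<partial>circle_measure) + (\<integral>t. v t * g t \<partial>circle_measure)
        = (\<integral>t. u t * g t \<partial>circle_measure)"
      unfolding u_def distrib_right
      by (intro Bochner_Integration.integral_add[symmetric] mult_int s_int v_int)
    ultimately have "(\<lambda>k. \<integral>t. s (K k) t * g t \<partial>circle_measure) \<longlonglongrightarrow> (\<integral>t. u t * g t \<partial>circle_measure)"
      by simp
    moreover have "integrable circle_measure (\<lambda>t. u t * g t)"
      unfolding u_def distrib_right by (intro Bochner_Integration.integrable_add mult_int s_int v_int)
    ultimately show "(\<lambda>k. \<integral>t. (\<Sum>n<K k. a n * cis t ^ n) * g t \<partial>circle_measure) \<longlonglongrightarrow> (\<integral>t. u t * g t \<partial>circle_measure) \<and>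
       integrable circle_measure (\<lambda>t. u t * g t)"
      unfolding s_def by blast
  qed (rule K)
qed

lemma integral_subinterval_circle:
  fixes f :: "real \<Rightarrow> complex"
  assumes f: "integrable circle_measure f" and ab: "0 \<le> a" "b \<le> 2 * pi"
  shows "integral {a..b} f = (\<integral>t. indicator {a..b} t *\<^sub>R f t \<partial>circle_measure)"
proof -
  have "{a..b} \<in> sets circle_measure"
    using ab by (intro sets_restrict_space_iff[THEN iffD2]) auto
  hence i: "integrable circle_measure (\<lambda>t. indicator {a..b} t *\<^sub>R f t)"
    by (rule integrable_mult_indicator[OF _ f])
  have "(\<integral>t. indicator {a..b} t *\<^sub>R f t \<partial>circle_measure) = integral {0..2*pi} (\<lambda>t. indicator {a..b} t *\<^sub>R f t)"
    by (rule lebesgue_integral_eq_integral[OF i]) auto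
  also have "\<dots> = integral {0..2*pi} (\<lambda>t. if t \<in> {a..b} then f t else 0)"
    by (rule integral_cong) (auto simp: indicator_def)
  also have "\<dots> = integral {a..b} f"
    using ab by (simp only: integral_restrict_Int) (simp add: Int_absorb1)
  finally show ?thesis by simp
qed

context
  fixes h :: hardy
begin

definition prim_coeff :: "nat \<Rightarrow> complex" where
  "prim_coeff n = (if n = 0 then 0 else hcoeff h (n - 1) / of_nat n)"

text \<open>
  The primitive of \<open>h\<close> that vanishes at the origin. Its coefficients are absolutely summable, so it is
  continuous on the closed disc.
\<close>
definition hprimitive :: "complex \<Rightarrow> complex" where
  "hprimitive z = (\<Sum>n. prim_coeff n * z ^ n)"

lemma prim_coeff_summable: "summable (\<lambda>n. cmod (prim_coeff n))"
proof -
  have "summable (\<lambda>n. (cmod (hcoeff h n))\<^sup>2 + inverse ((real (Suc n))\<^sup>2))"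
    by (intro summable_add hcoeff_summable) (use inverse_power_summable[of 2, where ?'a = real] summable_Suc_iff[of "\<lambda>n. inverse ((real n)\<^sup>2)"] in simp)
  hence "summable (\<lambda>n. cmod (prim_coeff (Suc n)))"
  proof (rule summable_comparison_test'[where N = 0])
    fix n
    have "cmod (prim_coeff (Suc n)) = cmod (hcoeff h n) * inverse (real (Suc n))"
      by (simp add: prim_coeff_def norm_divide divide_inverse norm_mult norm_inverse del: of_nat_Suc)
    also have "\<dots> \<le> (cmod (hcoeff h n))\<^sup>2 + (inverse (real (Suc n)))\<^sup>2"
    proof -
      have "x * y \<le> x\<^sup>2 + y\<^sup>2" if "x \<ge> 0" "y \<ge> 0" for x y :: real
        using sum_squares_bound[of x y] mult_nonneg_nonneg[OF that] by linarith
      thus ?thesis by simp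
    qed
    finally show "norm (cmod (prim_coeff (Suc n))) \<le> (cmod (hcoeff h n))\<^sup>2 + inverse ((real (Suc n))\<^sup>2)"
      by (simp add: power_inverse)
  qed
  thus ?thesis by (rule summable_Suc_iff[THEN iffD1])
qed

lemma primitive_uniform_limit:
  "uniform_limit (cball 0 1) (\<lambda>N z. \<Sum>n<N. prim_coeff n * z ^ n) hprimitive sequentially"
  unfolding hprimitive_def[abs_def]
proof (rule Weierstrass_m_test[OF _ prim_coeff_summable])
  show "cmod (prim_coeff n * z ^ n) \<le> cmod (prim_coeff n)" if "z \<in> cball 0 1" for n z
    using that by (simp add: norm_mult norm_power mult_left_le power_le_one)
qed

lemma primitive_continuous: "continuous_on (cball 0 1) hprimitive"
  by (rule uniform_limit_theorem[OF _ primitive_uniform_limit])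
     (auto intro!: always_eventually continuous_intros)

lemma primitive_derivative:
  assumes "z \<in> ball 0 1"
  shows "(hprimitive has_field_derivative hfun h z) (at z)"
proof -
  have "summable (\<lambda>n. prim_coeff n * 1 ^ n)"
    using summable_norm_cancel[OF prim_coeff_summable] by simp
  hence "(hprimitive has_field_derivative (\<Sum>n. diffs prim_coeff n * z ^ n)) (at z)"
    unfolding hprimitive_def[abs_def] by (rule termdiffs_strong) (use assms in simp)
  moreover have "diffs prim_coeff n = hcoeff h n" for n
    by (simp add: diffs_def prim_coeff_def del: of_nat_Suc)
  ultimately show ?thesis
    using hfun_sums[OF assms, of h] by (simp add: sums_iff)
qed

lemma primitive_holomorphic: "hprimitive holomorphic_on ball 0 1"
  unfolding holomorphic_on_open[OF open_ball] using primitive_derivative by blast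

lemma primitive_partial_sum_integral:
  assumes "a \<le> b"
  shows "integral {a..b} (\<lambda>t. (\<Sum>n<N. hcoeff h n * cis t ^ n) * (\<i> * cis t)) =
    (\<Sum>n<Suc N. prim_coeff n * cis b ^ n) - (\<Sum>n<Suc N. prim_coeff n * cis a ^ n)"
proof (rule integral_unique, rule fundamental_theorem_of_calculus[OF assms])
  fix t :: real
  define e where "e = (\<lambda>z. exp (\<i> * z))"
  have ec: "e (of_real x) = cis x" for x by (simp add: e_def cis_conv_exp)
  have de: "(e has_field_derivative \<i> * e z) (at z)" for z
    unfolding e_def by (auto intro!: derivative_eq_intros)
  have "((\<lambda>z. prim_coeff (Suc n) * e z ^ Suc n) has_field_derivative
      hcoeff h n * e z ^ n * (\<i> * e z)) (at z)" for n z
    using DERIV_cmult[OF DERIV_power[OF de[of z], of "Suc n"], of "prim_coeff (Suc n)"]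
    by (simp add: prim_coeff_def mult_ac del: of_nat_Suc power_Suc)
  hence "((\<lambda>z. \<Sum>n<N. prim_coeff (Suc n) * e z ^ Suc n) has_field_derivative
      (\<Sum>n<N. hcoeff h n * e z ^ n * (\<i> * e z))) (at z)" for z
    by (intro DERIV_sum)
  from has_vector_derivative_real_field[OF this, of t]
  have "((\<lambda>t. \<Sum>n<N. prim_coeff (Suc n) * cis t ^ Suc n) has_vector_derivative
      (\<Sum>n<N. hcoeff h n * cis t ^ n * (\<i> * cis t))) (at t within {a..b})"
    unfolding ec .
  moreover have "(\<Sum>n<Suc N. prim_coeff n * x ^ n) = (\<Sum>n<N. prim_coeff (Suc n) * x ^ Suc n)" for x
    by (subst sum.lessThan_Suc_shift) (simp add: prim_coeff_def)
  ultimately show "((\<lambda>t. \<Sum>n<Suc N. prim_coeff n * cis t ^ n) has_vector_derivative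
      (\<Sum>n<N. hcoeff h n * cis t ^ n) * (\<i> * cis t)) (at t within {a..b})"
    by (simp add: sum_distrib_right)
qed

text \<open>
  With \<open>u\<close> the boundary function of \<open>h\<close>, the map \<open>s \<mapsto> F(cis s)\<close> for the primitive \<open>F\<close> of \<open>h\<close> is
  the indefinite integral of \<open>\<i> cis s u(s)\<close>; so it has this derivative almost everywhere, and wherever it
  does, \<open>h\<close> has radial limit \<open>u\<close>.
\<close>
theorem Fatou_radial_limits:
  obtains u where "integrable circle_measure u"
    "AE t in circle_measure. ((\<lambda>r. hfun h (of_real r * cis t)) \<longlongrightarrow> u t) (at_left 1)"
proof -
  obtain u and K :: "nat \<Rightarrow> nat" where u: "integrable circle_measure u" and K: "strict_mono K"
    and lim: "\<And>g C. g \<in> borel_measurable circle_measure \<Longrightarrow> (\<And>t. cmod (g t) \<le> C) \<Longrightarrow>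
       (\<lambda>k. \<integral>t. (\<Sum>n<K k. hcoeff h n * cis t ^ n) * g t \<partial>circle_measure) \<longlonglongrightarrow> (\<integral>t. u t * g t \<partial>circle_measure) \<and>
       integrable circle_measure (\<lambda>t. u t * g t)"
    using boundary_function[OF hcoeff_summable[of h]] by blast
  define e where "e = (\<lambda>t. \<i> * cis t)"
  have e_meas: "e \<in> borel_measurable circle_measure"
    unfolding e_def using cis_power_measurable[of 1] by (intro borel_measurable_times) auto
  have ue_int: "integrable circle_measure (\<lambda>t. u t * e t)"
    using lim[OF e_meas, of 1] by (simp add: e_def norm_mult)
  have prim: "integral {a..b} (\<lambda>t. u t * e t) = hprimitive (cis b) - hprimitive (cis a)"
    if ab: "0 \<le> a" "a \<le> b" "b \<le> 2 * pi" for a b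
  proof (rule LIMSEQ_unique)
    define g where "g = (\<lambda>t. indicator {a..b} t *\<^sub>R e t)"
    have "{a..b} \<in> sets circle_measure"
      using ab by (intro sets_restrict_space_iff[THEN iffD2]) auto
    hence gm: "g \<in> borel_measurable circle_measure"
      unfolding g_def by (intro borel_measurable_scaleR borel_measurable_indicator e_meas)
    have gb: "cmod (g t) \<le> 1" for t
      by (auto simp: g_def e_def norm_mult indicator_def)
    have "(\<lambda>k. \<integral>t. (\<Sum>n<K k. hcoeff h n * cis t ^ n) * g t \<partial>circle_measure) \<longlonglongrightarrow> (\<integral>t. u t * g t \<partial>circle_measure)"
      using lim[OF gm gb] by blast
    moreover have "(\<integral>t. u t * g t \<partial>circle_measure) = integral {a..b} (\<lambda>t. u t * e t)"
      using integral_subinterval_circle[OF ue_int, of a b] ab by (simp add: g_def)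
    ultimately show "(\<lambda>k. \<integral>t. (\<Sum>n<K k. hcoeff h n * cis t ^ n) * g t \<partial>circle_measure)
        \<longlonglongrightarrow> integral {a..b} (\<lambda>t. u t * e t)"
      by simp
    have eq: "(\<integral>t. (\<Sum>n<N. hcoeff h n * cis t ^ n) * g t \<partial>circle_measure) =
      (\<Sum>n<Suc N. prim_coeff n * cis b ^ n) - (\<Sum>n<Suc N. prim_coeff n * cis a ^ n)" for N
    proof -
      have "integrable circle_measure (\<lambda>t. (\<Sum>n<N. hcoeff h n * cis t ^ n) * e t)"
        unfolding e_def by (intro continuous_imp_integrable_real continuous_intros)
      from integral_subinterval_circle[OF this, of a b] ab
      have "integral {a..b} (\<lambda>t. (\<Sum>n<N. hcoeff h n * cis t ^ n) * e t) =
          (\<integral>t. (\<Sum>n<N. hcoeff h n * cis t ^ n) * g t \<partial>circle_measure)"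
        by (simp add: g_def)
      thus ?thesis
        using primitive_partial_sum_integral[OF ab(2), of N] by (simp add: e_def)
    qed
    have pl: "(\<lambda>N. \<Sum>n<N. prim_coeff n * z ^ n) \<longlonglongrightarrow> hprimitive z" if "cmod z \<le> 1" for z
      using tendsto_uniform_limitI[OF primitive_uniform_limit, of z] that by simp
    have sub: "strict_mono (\<lambda>k. Suc (K k))" using K by (simp add: strict_mono_def)
    have pl': "(\<lambda>k. \<Sum>n<Suc (K k). prim_coeff n * z ^ n) \<longlonglongrightarrow> hprimitive z" if "cmod z \<le> 1" for z
      using LIMSEQ_subseq_LIMSEQ[OF pl[OF that] sub] by (simp only: o_def)
    show "(\<lambda>k. \<integral>t. (\<Sum>n<K k. hcoeff h n * cis t ^ n) * g t \<partial>circle_measure)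
        \<longlonglongrightarrow> hprimitive (cis b) - hprimitive (cis a)"
      unfolding eq by (intro tendsto_diff pl') auto
  qed
  have "(\<lambda>t. u t * e t) integrable_on {0..2*pi}"
    using ue_int by (intro integrable_on_lebesgue_on) auto
  then obtain N where N: "negligible N"
      "\<And>t. t \<in> {0<..<2*pi} - N \<Longrightarrow> ((\<lambda>t. hprimitive (cis t)) has_vector_derivative u t * e t) (at t)"
    using AE_derivative_of_indefinite_integral[OF _ prim] by blast
  have limt: "((\<lambda>r. hfun h (of_real r * cis t)) \<longlongrightarrow> u t) (at_left 1)" if t: "t \<in> {0<..<2*pi} - N" for t
  proof -
    have "((\<lambda>t. hprimitive (cis t)) has_vector_derivative \<i> * cis t * u t) (at t)"
      using N(2)[OF t] by (simp add: e_def mult_ac)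
    hence "((\<lambda>r. deriv hprimitive (of_real r * cis t)) \<longlongrightarrow> u t) (at_left 1)"
      by (rule Fatou_at_point[OF primitive_continuous primitive_holomorphic])
    moreover have "\<forall>\<^sub>F r in at_left 1. deriv hprimitive (of_real r * cis t) = hfun h (of_real r * cis t)"
    proof -
      have "\<forall>\<^sub>F r in at_left 1. r \<in> {0<..<1::real}"
        by (rule eventually_at_left_real) simp
      thus ?thesis
        by eventually_elim (rule DERIV_imp_deriv[OF primitive_derivative], simp add: norm_mult)
    qed
    ultimately show ?thesis by (simp add: filterlim_cong)
  qed
  define Z where "Z = (N \<union> {0, 2 * pi}) \<inter> {0..2*pi}"
  have "negligible Z"
    unfolding Z_def using N(1) by (intro negligible_Int) auto
  hence "Z \<in> null_sets circle_measure"
    by (subst null_sets_restrict_space) (auto simp: negligible_iff_null_sets Z_def)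
  hence "AE t in circle_measure. ((\<lambda>r. hfun h (of_real r * cis t)) \<longlongrightarrow> u t) (at_left 1)"
  proof (rule AE_I')
    show "{t \<in> space circle_measure. \<not> ((\<lambda>r. hfun h (of_real r * cis t)) \<longlongrightarrow> u t) (at_left 1)} \<subseteq> Z"
      using limt by (auto simp: Z_def space_restrict_space order_le_less)
  qed
  with u show ?thesis by (rule that)
qed

end

text \<open>
  The radial limit \<open>u\<close> satisfies \<open>|u| \<le> 1\<close>, and by dominated convergence the mean of \<open>|u|\<^sup>2\<close> is the squared
  norm of \<open>\<phi>\<close>, which is 1. So the nonnegative function \<open>1 - |u|\<^sup>2\<close> has integral 0.
\<close>
proposition shift_orthonormal_imp_inner_function:
  assumes so: "shift_orthonormal \<phi>"
  shows "inner_function (hfun \<phi>)"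
proof -
  have bd: "cmod (hfun \<phi> z) \<le> 1" if "z \<in> ball 0 1" for z
    by (rule shift_orthonormal_bounded[OF so that])
  obtain u where u: "integrable circle_measure u"
    and lim: "AE t in circle_measure. ((\<lambda>r. hfun \<phi> (of_real r * cis t)) \<longlongrightarrow> u t) (at_left 1)"
    by (rule Fatou_radial_limits)
  have rc: "of_real (radius_seq k) * cis t \<in> ball 0 1" for k t
    using radius_seq[of k] by (simp add: norm_mult)
  have limk: "AE t in circle_measure. (\<lambda>k. hfun \<phi> (of_real (radius_seq k) * cis t)) \<longlonglongrightarrow> u t"
    using lim by eventually_elim (rule filterlim_compose[OF _ radius_seq_at_left])
  have ub: "AE t in circle_measure. cmod (u t) \<le> 1"
    using limk
  proof eventually_elim
    case (elim t)
    show ?case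
      by (rule LIMSEQ_le_const2[OF tendsto_norm[OF elim]]) (use bd[OF rc] in auto)
  qed
  have um: "u \<in> borel_measurable circle_measure" by (rule borel_measurable_integrable[OF u])
  have ucm: "(\<lambda>t. cnj (u t)) \<in> borel_measurable circle_measure"
    by (rule borel_measurable_integrable[OF integrable_cnj[OF u]])
  have one: "integrable circle_measure (\<lambda>_. 1 :: real)"
    by (intro continuous_imp_integrable_real continuous_intros)
  define S where "S = (\<lambda>k t. hfun \<phi> (of_real (radius_seq k) * cis t) * cnj (hfun \<phi> (of_real (radius_seq k) * cis t)))"
  have "(\<lambda>k. \<integral>t. S k t \<partial>circle_measure) \<longlonglongrightarrow> (\<integral>t. u t * cnj (u t) \<partial>circle_measure)"
  proof (rule integral_dominated_convergence[where w = "\<lambda>_. 1"])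
    show "(\<lambda>t. u t * cnj (u t)) \<in> borel_measurable circle_measure"
      by (intro borel_measurable_times um ucm)
    show "S k \<in> borel_measurable circle_measure" for k
      unfolding S_def by (intro borel_measurable_times circle_measurable circle_measurable_cnj hfun_holomorphic radius_seq)
    have "cmod (S k t) \<le> 1" for k t
      using bd[OF rc[of k t]] by (simp add: S_def norm_mult mult_le_one)
    thus "AE t in circle_measure. norm (S k t) \<le> 1" for k by simp
    show "AE t in circle_measure. (\<lambda>k. S k t) \<longlonglongrightarrow> u t * cnj (u t)"
      using limk by eventually_elim (auto simp: S_def intro!: tendsto_intros)
  qed (rule one)
  moreover have "(\<lambda>k. \<integral>t. S k t \<partial>circle_measure) \<longlonglongrightarrow> of_real (2 * pi) * hinner \<phi> \<phi>"
    unfolding S_def by (rule hinner_integral_limit)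
  moreover have "hinner \<phi> \<phi> = 1"
    using shift_orthonormalD[OF so, of 0 0] by simp
  ultimately have "(\<integral>t. u t * cnj (u t) \<partial>circle_measure) = of_real (2 * pi)"
    using LIMSEQ_unique by fastforce
  hence "(\<integral>t. (cmod (u t))\<^sup>2 \<partial>circle_measure) = 2 * pi"
    unfolding complex_norm_square[symmetric] integral_complex_of_real by (simp only: of_real_eq_iff)
  moreover have i2: "integrable circle_measure (\<lambda>t. (cmod (u t))\<^sup>2)"
  proof (rule Bochner_Integration.integrable_bound[OF one])
    show "(\<lambda>t. (cmod (u t))\<^sup>2) \<in> borel_measurable circle_measure"
      using um by measurable
    show "AE t in circle_measure. norm ((cmod (u t))\<^sup>2) \<le> norm (1::real)"
      using ub by eventually_elim (simp add: power_le_one)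
  qed
  ultimately have "(\<integral>t. 1 - (cmod (u t))\<^sup>2 \<partial>circle_measure) = 0"
    using measure_circle_measure by (subst Bochner_Integration.integral_diff[OF one i2]) simp
  moreover have "AE t in circle_measure. 0 \<le> 1 - (cmod (u t))\<^sup>2"
    using ub by eventually_elim (simp add: power_le_one)
  ultimately have "AE t in circle_measure. 1 - (cmod (u t))\<^sup>2 = 0"
    using integral_nonneg_eq_0_iff_AE[of circle_measure "\<lambda>t. 1 - (cmod (u t))\<^sup>2"]
      Bochner_Integration.integrable_diff[OF one i2] by simp
  hence u1: "AE t in circle_measure. cmod (u t) = 1"
  proof eventually_elim
    case (elim t)
    hence "(cmod (u t))\<^sup>2 = 1\<^sup>2" by simp
    thus ?case by (rule power2_eq_imp_eq) auto
  qed
  have "AE t in circle_measure. \<exists>l. ((\<lambda>r. hfun \<phi> (of_real r * cis t)) \<longlongrightarrow> l) (at_left 1) \<and> cmod l = 1"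
    using lim u1 by eventually_elim blast
  moreover have "bounded (hfun \<phi> ` ball 0 1)"
    unfolding bounded_iff using bd by blast
  ultimately show ?thesis
    by (simp add: inner_function_def hfun_holomorphic)
qed

section \<open>The compressed shift and its invariant subspaces\<close>
lemma mult_z_power_commute: "(mult_z ^^ m) ((mult_z ^^ n) f) = (mult_z ^^ n) ((mult_z ^^ m) f)"
  by (rule hardy_eqI) (simp add: hfun_mult_z_power)

lemma shift_orthonormal_mult_z_power:
  "shift_orthonormal \<theta> \<Longrightarrow> shift_orthonormal ((mult_z ^^ m) \<theta>)"
  unfolding shift_orthonormal_def mult_z_power_commute[of _ m] hinner_mult_z_power .

lemma hmul_mult_z_power:
  assumes "shift_orthonormal \<theta>"
  shows "hmul ((mult_z ^^ m) \<theta>) k = (mult_z ^^ m) (hmul \<theta> k)"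
  by (rule hardy_eqI)
     (simp add: hfun_hmul[OF assms] hfun_hmul[OF shift_orthonormal_mult_z_power[OF assms]] hfun_mult_z_power)

lemma hinner_hmul_right_eq_0:
  assumes so: "shift_orthonormal \<theta>" and g: "\<And>n. hinner g ((mult_z ^^ n) \<theta>) = 0"
  shows "hinner g (hmul \<theta> k) = 0"
proof -
  have "hinner ((mult_z ^^ n) \<theta>) g = 0" for n
    using g[of n] hinner_commute[of "(mult_z ^^ n) \<theta>" g] by simp
  hence "(\<lambda>N. hinner (\<Sum>n<N. hscale (hcoeff k n) ((mult_z ^^ n) \<theta>)) g) = (\<lambda>_. 0)"
    by (simp add: hinner_sum_left hinner_simps)
  hence "hinner (hmul \<theta> k) g = 0"
    using LIMSEQ_unique[OF tendsto_hinner_left[OF hmul_tendsto[OF so, of k], of g]] by simp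
  thus ?thesis using hinner_commute[of g "hmul \<theta> k"] by simp
qed

lemma mult_range_cong:
  "(\<And>z. z \<in> ball 0 1 \<Longrightarrow> \<phi> z = \<psi> z) \<Longrightarrow> mult_range \<phi> = mult_range \<psi>"
  by (simp add: mult_range_def)

lemma mult_range_inner_function:
  assumes T: "\<And>z. z \<in> ball 0 1 \<Longrightarrow> hfun T z = \<theta> z" and so: "shift_orthonormal T"
  shows "mult_range \<theta> = range (hmul T)"
    and "mult_range (\<lambda>z. z\<^sup>2 * \<theta> z) = range (hmul ((mult_z ^^ 2) T))"
proof -
  show "mult_range \<theta> = range (hmul T)"
    unfolding mult_range_hfun[OF so, symmetric] by (rule mult_range_cong) (simp add: T)
  show "mult_range (\<lambda>z. z\<^sup>2 * \<theta> z) = range (hmul ((mult_z ^^ 2) T))"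
    unfolding mult_range_hfun[OF shift_orthonormal_mult_z_power[OF so], symmetric]
    by (rule mult_range_cong) (simp add: T hfun_mult_z_power)
qed

lemma H2_subspace_closure:
  assumes "H2_subspace V"
  shows "H2_subspace (closure V)"
  unfolding H2.subspace_def
proof (intro conjI ballI allI)
  show "0 \<in> closure V"
    using H2.subspace_0[OF assms] closure_subset by blast
next
  fix x y assume "x \<in> closure V" "y \<in> closure V"
  then obtain X Y where X: "\<And>n. X n \<in> V" "X \<longlonglongrightarrow> x" and Y: "\<And>n. Y n \<in> V" "Y \<longlonglongrightarrow> y"
    unfolding closure_sequential by blast
  have "(\<lambda>n. X n + Y n) \<longlonglongrightarrow> x + y" by (intro tendsto_add X Y)
  thus "x + y \<in> closure V"
    unfolding closure_sequential
    by (intro exI[of _ "\<lambda>n. X n + Y n"] conjI allI H2.subspace_add[OF assms] X Y)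
next
  fix c x assume "x \<in> closure V"
  then obtain X where X: "\<And>n. X n \<in> V" "X \<longlonglongrightarrow> x"
    unfolding closure_sequential by blast
  have "(\<lambda>n. hscale c (X n)) \<longlonglongrightarrow> hscale c x"
  proof (rule LIM_zero_cancel, rule tendsto_norm_zero_cancel)
    have "norm (hscale c (X n) - hscale c x) = cmod c * norm (X n - x)" for n
      by (simp add: norm_hscale flip: H2.scale_right_diff_distrib)
    moreover have "(\<lambda>n. cmod c * norm (X n - x)) \<longlonglongrightarrow> cmod c * 0"
      by (intro tendsto_intros tendsto_norm_zero LIM_zero X)
    ultimately show "(\<lambda>n. norm (hscale c (X n) - hscale c x)) \<longlonglongrightarrow> 0" by simp
  qed
  thus "hscale c x \<in> closure V"
    unfolding closure_sequential
    by (intro exI[of _ "\<lambda>n. hscale c (X n)"] conjI allI H2.subspace_scale[OF assms] X)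
qed

lemma H2_subspace_closed_span: "H2_subspace (closed_span A)"
  unfolding closed_span_def by (intro H2_subspace_closure H2.subspace_span)

lemma closed_closed_span: "closed (closed_span A)"
  by (simp add: closed_span_def)

lemma closed_span_superset: "A \<subseteq> closed_span A"
  unfolding closed_span_def using H2.span_superset closure_subset by blast

lemma closed_span_minimal:
  assumes "A \<subseteq> V" "H2_subspace V" "closed V"
  shows "closed_span A \<subseteq> V"
  unfolding closed_span_def by (intro closure_minimal H2.span_minimal assms)

lemma hardy_shift_exists:
  obtains g where "h = hscale (hcoeff h 0) (hmonom 0) + hscale (hcoeff h 1) (hmonom 1) + (mult_z ^^ 2) g"
proof -
  have "summable (\<lambda>n. (cmod (hcoeff h (n + 2)))\<^sup>2)"
    using hcoeff_summable[of h] summable_iff_shift[of "\<lambda>n. (cmod (hcoeff h n))\<^sup>2" 2] by simp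
  then obtain g where g: "\<And>n. hcoeff g n = hcoeff h (n + 2)"
    by (rule hardy_of_coeffs) blast
  have "h = hscale (hcoeff h 0) (hmonom 0) + hscale (hcoeff h 1) (hmonom 1) + (mult_z ^^ 2) g"
  proof (rule hardy_eq_hcoeffI)
    fix n :: nat
    consider "n = 0" | "n = 1" | m where "n = m + 2"
      by (metis One_nat_def Suc_1 add_2_eq_Suc' not0_implies_Suc)
    thus "hcoeff h n = hcoeff (hscale (hcoeff h 0) (hmonom 0) + hscale (hcoeff h 1) (hmonom 1) + (mult_z ^^ 2) g) n"
      unfolding hcoeff_add hcoeff_hscale hcoeff_hmonom hcoeff_mult_z_power g
      by cases auto
  qed
  thus ?thesis by (rule that)
qed

context
  fixes \<alpha> \<beta> :: complex
  assumes nz: "\<alpha> \<noteq> 0" "\<beta> \<noteq> 0" and unit: "(cmod \<alpha>)\<^sup>2 + (cmod \<beta>)\<^sup>2 = 1"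
begin

text \<open>
  \<open>S\<close> maps \<open>f\<^sub>0\<close> to \<open>\<alpha> cnj \<beta> f\<^sub>0 + \<beta> z\<^sup>2\<close>; so \<open>\<alpha> cnj \<beta>\<close> is the eigenvalue of \<open>S\<close> on the
  one-dimensional quotient of \<open>H\<^sup>2\<^sub>\<alpha>\<^sub>,\<^sub>\<beta>\<close> by \<open>z\<^sup>2 H\<^sup>2\<close>.
\<close>
abbreviation (input) eigval :: complex where "eigval \<equiv> \<alpha> * cnj \<beta>"

lemma eigval_in_ball: "eigval \<in> ball 0 1"
proof -
  have "2 * (cmod \<alpha> * cmod \<beta>) \<le> 1"
    using sum_squares_bound[of "cmod \<alpha>" "cmod \<beta>"] unit by simp
  thus ?thesis by (simp add: norm_mult)
qed

lemma hcoeff_f0: "hcoeff (f0 \<alpha> \<beta>) n = (if n = 0 then \<alpha> else if n = 1 then \<beta> else 0)"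
  by (simp add: f0_def hcoeff_add hcoeff_hscale hcoeff_hmonom)

lemma hfun_f0: "z \<in> ball 0 1 \<Longrightarrow> hfun (f0 \<alpha> \<beta>) z = \<alpha> + \<beta> * z"
  by (simp add: f0_def hfun_add hfun_hscale hfun_hmonom)

lemma hinner_f0: "hinner h (f0 \<alpha> \<beta>) = hcoeff h 0 * cnj \<alpha> + hcoeff h 1 * cnj \<beta>"
  by (simp add: f0_def hinner_simps hinner_hmonom mult.commute)

lemma hinner_f0_shift: "hinner ((mult_z ^^ 2) g) (f0 \<alpha> \<beta>) = 0" "hinner (f0 \<alpha> \<beta>) ((mult_z ^^ 2) g) = 0"
proof -
  show 1: "hinner ((mult_z ^^ 2) g) (f0 \<alpha> \<beta>) = 0"
    by (simp add: hinner_f0 hcoeff_mult_z_power del: funpow.simps)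
  show "hinner (f0 \<alpha> \<beta>) ((mult_z ^^ 2) g) = 0"
    using 1 hinner_commute[of "f0 \<alpha> \<beta>" "(mult_z ^^ 2) g"] by simp
qed

text \<open>
  The condition \<open>\<beta> h\<^sub>0 = \<alpha> h\<^sub>1\<close> on the first two coefficients is closed and linear and holds for the
  generators; it says that \<open>(h\<^sub>0, h\<^sub>1)\<close> is a multiple of \<open>(\<alpha>, \<beta>)\<close>.
\<close>
lemma Hab_iff: "h \<in> Hab \<alpha> \<beta> \<longleftrightarrow> (\<exists>c g. h = hscale c (f0 \<alpha> \<beta>) + (mult_z ^^ 2) g)"
proof
  define V where "V = {h. \<beta> * hcoeff h 0 = \<alpha> * hcoeff h 1}"
  assume "h \<in> Hab \<alpha> \<beta>"
  moreover have "Hab \<alpha> \<beta> \<subseteq> V"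
    unfolding Hab_def
  proof (rule closed_span_minimal)
    show "insert (f0 \<alpha> \<beta>) (hmonom ` {2..}) \<subseteq> V"
      by (auto simp: V_def hcoeff_f0 hcoeff_hmonom)
    show "H2_subspace V"
      unfolding V_def H2.subspace_def
      by (auto simp: hcoeff_zero hcoeff_add hcoeff_hscale algebra_simps)
    show "closed V"
    proof (rule closed_sequential_limits[THEN iffD2], intro allI impI, elim conjE)
      fix X l assume X: "\<forall>n. X n \<in> V" "X \<longlonglongrightarrow> l"
      have "(\<lambda>n. \<beta> * hcoeff (X n) 0) \<longlonglongrightarrow> \<beta> * hcoeff l 0"
        by (intro tendsto_intros tendsto_hcoeff X)
      moreover have "(\<lambda>n. \<alpha> * hcoeff (X n) 1) \<longlonglongrightarrow> \<alpha> * hcoeff l 1"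
        by (intro tendsto_intros tendsto_hcoeff X)
      ultimately have "\<beta> * hcoeff l 0 = \<alpha> * hcoeff l 1"
        using X(1) LIMSEQ_unique unfolding V_def by force
      thus "l \<in> V" by (simp add: V_def)
    qed
  qed
  ultimately have V: "\<beta> * hcoeff h 0 = \<alpha> * hcoeff h 1" by (auto simp: V_def)
  obtain g where g: "h = hscale (hcoeff h 0) (hmonom 0) + hscale (hcoeff h 1) (hmonom 1) + (mult_z ^^ 2) g"
    by (rule hardy_shift_exists)
  have "h = hscale (hcoeff h 0 / \<alpha>) (f0 \<alpha> \<beta>) + (mult_z ^^ 2) g"
  proof (subst g, rule hardy_eqI)
    fix z :: complex assume "z \<in> ball 0 1"
    moreover have "hcoeff h 1 = hcoeff h 0 / \<alpha> * \<beta>"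
      using V nz by (simp add: field_simps)
    ultimately show "hfun (hscale (hcoeff h 0) (hmonom 0) + hscale (hcoeff h 1) (hmonom 1) + (mult_z ^^ 2) g) z
        = hfun (hscale (hcoeff h 0 / \<alpha>) (f0 \<alpha> \<beta>) + (mult_z ^^ 2) g) z"
      using nz by (simp add: hfun_add hfun_hscale hfun_hmonom hfun_f0 distrib_left)
  qed
  thus "\<exists>c g. h = hscale c (f0 \<alpha> \<beta>) + (mult_z ^^ 2) g" by blast
next
  assume "\<exists>c g. h = hscale c (f0 \<alpha> \<beta>) + (mult_z ^^ 2) g"
  then obtain c g where h: "h = hscale c (f0 \<alpha> \<beta>) + (mult_z ^^ 2) g" by blast
  have sub: "H2_subspace (Hab \<alpha> \<beta>)" and cl: "closed (Hab \<alpha> \<beta>)"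
    unfolding Hab_def by (rule H2_subspace_closed_span closed_closed_span)+
  have gen: "f0 \<alpha> \<beta> \<in> Hab \<alpha> \<beta>" "\<And>n. hmonom (n + 2) \<in> Hab \<alpha> \<beta>"
    unfolding Hab_def using closed_span_superset by fastforce+
  have "(mult_z ^^ 2) g \<in> Hab \<alpha> \<beta>"
  proof (rule closed_sequentially[OF cl])
    show "(\<lambda>N. (mult_z ^^ 2) (\<Sum>n<N. hscale (hcoeff g n) (hmonom n))) \<longlonglongrightarrow> (mult_z ^^ 2) g"
      by (simp add: numeral_2_eq_2) (intro tendsto_mult_z trunc_tendsto)
    have "(mult_z ^^ 2) (\<Sum>n<N. hscale (hcoeff g n) (hmonom n)) = (\<Sum>n<N. hscale (hcoeff g n) (hmonom (n + 2)))" for N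
      by (rule hardy_eqI)
         (simp add: hfun_mult_z_power hfun_sum hfun_hscale hfun_hmonom sum_distrib_left power_add
            power2_eq_square mult_ac)
    thus "(mult_z ^^ 2) (\<Sum>n<N. hscale (hcoeff g n) (hmonom n)) \<in> Hab \<alpha> \<beta>" for N
      by (simp only:) (intro H2.subspace_sum H2.subspace_scale sub gen)
  qed
  thus "h \<in> Hab \<alpha> \<beta>"
    unfolding h by (intro H2.subspace_add H2.subspace_scale sub gen)
qed

lemma H2_subspace_Hab: "H2_subspace (Hab \<alpha> \<beta>)"
  unfolding Hab_def by (rule H2_subspace_closed_span)

text \<open>
  The product \<open>z (c f\<^sub>0 + z\<^sup>2 g)\<close> differs from an element of the space only by its term \<open>c \<alpha> z\<close>,
  whose projection is \<open>c \<alpha> cnj \<beta> f\<^sub>0\<close>.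
\<close>
lemma Sab_formula:
  "Sab \<alpha> \<beta> (hscale c (f0 \<alpha> \<beta>) + (mult_z ^^ 2) g) =
     hscale (c * eigval) (f0 \<alpha> \<beta>) + (mult_z ^^ 2) (hscale (c * \<beta>) (hmonom 0) + mult_z g)"
    (is "Sab \<alpha> \<beta> ?h = ?p")
proof -
  have p: "?p \<in> Hab \<alpha> \<beta>" unfolding Hab_iff by blast
  have "mult_z ?h - ?p = hscale (c * \<alpha>) (hmonom 1) - hscale (c * eigval) (f0 \<alpha> \<beta>)"
    by (rule hardy_eqI)
       (simp add: hfun_diff hfun_add hfun_mult_z hfun_mult_z_power hfun_hscale hfun_hmonom hfun_f0
          algebra_simps power2_eq_square)
  moreover have "hscale (c * \<alpha>) (hmonom 1) - hscale (c * eigval) (f0 \<alpha> \<beta>) \<in> orth_compl (Hab \<alpha> \<beta>)"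
    (is "?d \<in> _")
  proof -
    have d0: "hinner ?d (f0 \<alpha> \<beta>) = 0"
    proof -
      have "\<alpha> * cnj \<alpha> + \<beta> * cnj \<beta> = 1"
        unfolding complex_norm_square[symmetric] of_real_add[symmetric] unit by simp
      moreover have "hinner ?d (f0 \<alpha> \<beta>) = c * \<alpha> * cnj \<beta> * (1 - (\<alpha> * cnj \<alpha> + \<beta> * cnj \<beta>))"
        unfolding hinner_f0 hcoeff_diff hcoeff_hscale
        by (simp add: hcoeff_hmonom hcoeff_f0 algebra_simps)
      ultimately show ?thesis by simp
    qed
    have d2: "hinner ?d ((mult_z ^^ 2) k) = 0" for k
    proof -
      have "hinner (hmonom 1) ((mult_z ^^ 2) k) = cnj (hcoeff ((mult_z ^^ 2) k) 1)"
        by (metis hinner_commute hinner_hmonom)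
      also have "\<dots> = 0" unfolding hcoeff_mult_z_power by simp
      finally show ?thesis by (simp add: hinner_simps hinner_f0_shift del: funpow.simps)
    qed
    have "hinner ?d x = 0" if "x \<in> Hab \<alpha> \<beta>" for x
    proof -
      obtain a k where "x = hscale a (f0 \<alpha> \<beta>) + (mult_z ^^ 2) k"
        using \<open>x \<in> Hab \<alpha> \<beta>\<close> Hab_iff by blast
      thus ?thesis by (simp only: hinner_add_right hinner_hscale_right d0 d2) simp
    qed
    thus ?thesis by (simp add: orth_compl_def)
  qed
  ultimately have o: "mult_z ?h - ?p \<in> orth_compl (Hab \<alpha> \<beta>)" by (simp only:)
  show ?thesis
    unfolding Sab_def orth_proj_def
  proof (rule the_equality)
    show "?p \<in> Hab \<alpha> \<beta> \<and> mult_z ?h - ?p \<in> orth_compl (Hab \<alpha> \<beta>)" using p o by blast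
    fix q assume q: "q \<in> Hab \<alpha> \<beta> \<and> mult_z ?h - q \<in> orth_compl (Hab \<alpha> \<beta>)"
    have "q - ?p \<in> Hab \<alpha> \<beta>"
      using q p by (intro H2.subspace_diff H2_subspace_Hab) auto
    hence "hinner (mult_z ?h - ?p) (q - ?p) = 0" "hinner (mult_z ?h - q) (q - ?p) = 0"
      using q o unfolding orth_compl_def by blast+
    hence "hinner ((mult_z ?h - ?p) - (mult_z ?h - q)) (q - ?p) = 0"
      by (simp only: hinner_diff_left) simp
    moreover have "(a - b) - (a - c) = c - b" for a b c :: hardy by simp
    ultimately have "hinner (q - ?p) (q - ?p) = 0" by (simp only:)
    thus "q = ?p" unfolding hinner_self_eq_0 by simp
  qed
qed

lemma Sab_shift: "Sab \<alpha> \<beta> ((mult_z ^^ 2) g) = (mult_z ^^ 2) (mult_z g)"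
  using Sab_formula[of 0 g] by (simp del: funpow.simps)

lemma Sab_shift_power: "(Sab \<alpha> \<beta> ^^ n) ((mult_z ^^ 2) g) = (mult_z ^^ n) ((mult_z ^^ 2) g)"
proof (induction n)
  case (Suc n)
  have "(mult_z ^^ n) ((mult_z ^^ 2) g) = (mult_z ^^ 2) ((mult_z ^^ n) g)"
    by (rule mult_z_power_commute)
  hence "Sab \<alpha> \<beta> ((mult_z ^^ n) ((mult_z ^^ 2) g)) = (mult_z ^^ 2) (mult_z ((mult_z ^^ n) g))"
    by (simp only: Sab_shift)
  also have "\<dots> = mult_z ((mult_z ^^ n) ((mult_z ^^ 2) g))"
    by (rule hardy_eqI) (simp add: hfun_mult_z hfun_mult_z_power mult_ac)
  finally show ?case by (simp only: funpow.simps comp_apply Suc)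
qed simp

lemma Sab_diff_hscale:
  assumes "x \<in> Hab \<alpha> \<beta>" "y \<in> Hab \<alpha> \<beta>"
  shows "Sab \<alpha> \<beta> (x - hscale a y) = Sab \<alpha> \<beta> x - hscale a (Sab \<alpha> \<beta> y)"
proof -
  obtain c g where x: "x = hscale c (f0 \<alpha> \<beta>) + (mult_z ^^ 2) g" using assms(1) Hab_iff by blast
  obtain d k where y: "y = hscale d (f0 \<alpha> \<beta>) + (mult_z ^^ 2) k" using assms(2) Hab_iff by blast
  have "x - hscale a y = hscale (c - a * d) (f0 \<alpha> \<beta>) + (mult_z ^^ 2) (g - hscale a k)"
    by (rule hardy_eqI)
       (simp add: x y hfun_diff hfun_add hfun_hscale hfun_mult_z_power algebra_simps)
  hence "Sab \<alpha> \<beta> (x - hscale a y) = hscale ((c - a * d) * eigval) (f0 \<alpha> \<beta>) +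
      (mult_z ^^ 2) (hscale ((c - a * d) * \<beta>) (hmonom 0) + mult_z (g - hscale a k))"
    by (simp only: Sab_formula)
  also have "\<dots> = Sab \<alpha> \<beta> x - hscale a (Sab \<alpha> \<beta> y)"
    unfolding x y Sab_formula
    by (rule hardy_eqI)
       (simp add: hfun_diff hfun_add hfun_hscale hfun_mult_z hfun_mult_z_power hfun_hmonom hfun_f0 algebra_simps)
  finally show ?thesis .
qed

lemma Sab_in_Hab: "x \<in> Hab \<alpha> \<beta> \<Longrightarrow> Sab \<alpha> \<beta> x \<in> Hab \<alpha> \<beta>"
  by (metis Hab_iff Sab_formula)

lemma Sab_f0_plus_shift:
  "Sab \<alpha> \<beta> (f0 \<alpha> \<beta> + (mult_z ^^ 2) g) - hscale eigval (f0 \<alpha> \<beta> + (mult_z ^^ 2) g) =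
     (mult_z ^^ 2) (hscale \<beta> (hmonom 0) + mult_z g - hscale eigval g)"
proof -
  have "Sab \<alpha> \<beta> (f0 \<alpha> \<beta> + (mult_z ^^ 2) g) = hscale eigval (f0 \<alpha> \<beta>) + (mult_z ^^ 2) (hscale \<beta> (hmonom 0) + mult_z g)"
    using Sab_formula[of 1 g] by simp
  thus ?thesis
    by (simp only:)
       (rule hardy_eqI, simp add: hfun_diff hfun_add hfun_hscale hfun_mult_z hfun_mult_z_power algebra_simps)
qed

lemma cyc_span_subset:
  assumes "H2_subspace M" "closed M" "Sab \<alpha> \<beta> ` M \<subseteq> M" "h \<in> M"
  shows "cyc_span (Sab \<alpha> \<beta>) h \<subseteq> M"
  unfolding cyc_span_def
proof (rule closed_span_minimal[OF _ assms(1,2)])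
  have "(Sab \<alpha> \<beta> ^^ n) h \<in> M" for n
    by (induction n) (use assms in auto)
  thus "range (\<lambda>n. (Sab \<alpha> \<beta> ^^ n) h) \<subseteq> M" by blast
qed

lemma power_in_cyc_span: "(S ^^ n) h \<in> cyc_span S h"
  unfolding cyc_span_def by (rule subsetD[OF closed_span_superset]) (rule rangeI)

lemma H2_subspace_cyc_span: "H2_subspace (cyc_span S h)" and closed_cyc_span: "closed (cyc_span S h)"
  unfolding cyc_span_def by (rule H2_subspace_closed_span closed_closed_span)+

text \<open>
  On \<open>z\<^sup>2 H\<^sup>2\<close> the operator is the shift, and the shifts of \<open>z\<^sup>2 \<theta>\<close> span a dense subspace of \<open>z\<^sup>2 \<theta> H\<^sup>2\<close>.
\<close>
lemma first_form_invariant_cyclic: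
  assumes so: "shift_orthonormal T" and M: "M = range (hmul ((mult_z ^^ 2) T))"
    and sub: "H2_subspace M" "closed M"
  shows "Sab \<alpha> \<beta> ` M \<subseteq> M" and "is_cyclic (Sab \<alpha> \<beta>) M"
proof -
  let ?T = "(mult_z ^^ 2) T"
  have so2: "shift_orthonormal ?T" by (rule shift_orthonormal_mult_z_power[OF so])
  show inv: "Sab \<alpha> \<beta> ` M \<subseteq> M"
  proof
    fix x assume "x \<in> Sab \<alpha> \<beta> ` M"
    then obtain k where "x = Sab \<alpha> \<beta> (hmul ?T k)" using M by blast
    hence "x = hmul ?T (mult_z k)"
      by (simp only: hmul_mult_z_power[OF so] Sab_shift mult_z_hmul[OF so])
    thus "x \<in> M" using M by blast
  qed
  have TM: "?T \<in> M"
    using hmul_hmonom[OF so2, of 0] M by (metis funpow_0 rangeI)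
  have "M = cyc_span (Sab \<alpha> \<beta>) ?T"
  proof
    show "cyc_span (Sab \<alpha> \<beta>) ?T \<subseteq> M" by (rule cyc_span_subset[OF sub inv TM])
    have "(mult_z ^^ n) ?T \<in> cyc_span (Sab \<alpha> \<beta>) ?T" for n
      using power_in_cyc_span[where S = "Sab \<alpha> \<beta>" and h = ?T and n = n] by (simp only: Sab_shift_power)
    thus "M \<subseteq> cyc_span (Sab \<alpha> \<beta>) ?T"
      unfolding M using hmul_in_closed_subspace[OF so2 H2_subspace_cyc_span closed_cyc_span] by blast
  qed
  thus "is_cyclic (Sab \<alpha> \<beta>) M"
    unfolding is_cyclic_def using sub inv TM by blast
qed

text \<open>
  The equation for \<open>g\<close> amounts to \<open>S f - w f = c z\<^sup>2 \<theta>\<close> with \<open>c = \<beta> / \<theta>(w) \<noteq> 0\<close>. Applying \<open>S\<close>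
  repeatedly to this relation produces all shifts of \<open>z\<^sup>2 \<theta>\<close> from the orbit of \<open>f\<close>.
\<close>
lemma second_form_invariant_cyclic:
  assumes inner: "inner_function \<theta>" and sf: "second_form \<alpha> \<beta> \<theta> g f M"
    and sub: "H2_subspace M" "closed M"
  shows "Sab \<alpha> \<beta> ` M \<subseteq> M" and "M = cyc_span (Sab \<alpha> \<beta>) f" and "f \<in> M"
proof -
  obtain T where T: "\<And>z. z \<in> ball 0 1 \<Longrightarrow> hfun T z = \<theta> z" and so: "shift_orthonormal T"
    by (rule inner_function_imp_shift_orthonormal[OF inner]) blast
  let ?T = "(mult_z ^^ 2) T"
  have so2: "shift_orthonormal ?T" by (rule shift_orthonormal_mult_z_power[OF so])
  have tw: "\<theta> eigval \<noteq> 0"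
    and eq: "\<And>z. z \<in> ball 0 1 \<Longrightarrow> (z - eigval) * hfun g z = \<beta> / \<theta> eigval * (\<theta> z - \<theta> eigval)"
    and f: "f = f0 \<alpha> \<beta> + (mult_z ^^ 2) g"
    and M: "M = {a + b | a b. a \<in> range (\<lambda>c. hscale c f) \<and> b \<in> range (hmul ?T)}"
    using sf mult_range_inner_function(2)[OF T so]
    unfolding second_form_def Let_def is_orth_sum_def by (auto simp: numeral_2_eq_2)
  define c where "c = \<beta> / \<theta> eigval"
  have c0: "c \<noteq> 0" using tw nz by (simp add: c_def)
  have Sf: "Sab \<alpha> \<beta> f - hscale eigval f = hscale c ?T"
  proof -
    have "hscale \<beta> (hmonom 0) + mult_z g - hscale eigval g = hscale c T"
    proof (rule hardy_eqI)
      fix z :: complex assume z: "z \<in> ball 0 1"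
      have "hfun (hscale \<beta> (hmonom 0) + mult_z g - hscale eigval g) z = \<beta> + (z - eigval) * hfun g z"
        using z by (simp add: hfun_diff hfun_add hfun_hscale hfun_mult_z hfun_hmonom algebra_simps)
      also have "\<dots> = c * \<theta> z"
      proof -
        have "\<beta> = c * \<theta> eigval" using tw by (simp add: c_def)
        thus ?thesis unfolding eq[OF z] c_def[symmetric] by (simp add: right_diff_distrib)
      qed
      finally show "hfun (hscale \<beta> (hmonom 0) + mult_z g - hscale eigval g) z = hfun (hscale c T) z"
        using z by (simp add: hfun_hscale T)
    qed
    thus ?thesis
      unfolding f Sab_f0_plus_shift by (simp only: mult_z_power_hscale)
  qed
  have fH: "f \<in> Hab \<alpha> \<beta>"
    unfolding f Hab_iff by (rule exI[of _ 1]) auto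
  have TM: "hmul ?T k \<in> M" for k
    unfolding M by (force intro: exI[of _ 0] image_eqI[where x = 0])
  show fM: "f \<in> M"
  proof -
    have "f = hscale 1 f + hmul ?T 0"
      by (rule hardy_eqI) (simp add: hfun_add hfun_hscale hfun_hmul[OF so2] hfun_zero)
    thus ?thesis unfolding M by blast
  qed
  have T2M: "?T \<in> M" using TM[of "hmonom 0"] hmul_hmonom[OF so2, of 0] by simp
  have SfM: "Sab \<alpha> \<beta> f \<in> M"
  proof -
    have "Sab \<alpha> \<beta> f = hscale eigval f + hscale c ?T" using Sf by (metis add.commute diff_add_cancel)
    thus ?thesis using fM T2M by (simp only:) (intro H2.subspace_add H2.subspace_scale sub)
  qed
  show inv: "Sab \<alpha> \<beta> ` M \<subseteq> M"
  proof
    fix x assume "x \<in> Sab \<alpha> \<beta> ` M"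
    then obtain a k where x: "x = Sab \<alpha> \<beta> (hscale a f + hmul ?T k)" unfolding M by blast
    have kH: "hmul ?T k \<in> Hab \<alpha> \<beta>"
      unfolding Hab_iff hmul_mult_z_power[OF so] by (rule exI[of _ 0]) auto
    have e: "hscale a f + hmul ?T k = hmul ?T k - hscale (- a) f" by (simp add: add.commute)
    have "x = Sab \<alpha> \<beta> (hmul ?T k) - hscale (- a) (Sab \<alpha> \<beta> f)"
      unfolding x e by (rule Sab_diff_hscale[OF kH fH])
    also have "Sab \<alpha> \<beta> (hmul ?T k) = hmul ?T (mult_z k)"
      by (simp only: hmul_mult_z_power[OF so] Sab_shift mult_z_hmul[OF so])
    finally show "x \<in> M"
      using TM SfM by (simp only:) (intro H2.subspace_diff H2.subspace_scale sub)
  qed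
  show "M = cyc_span (Sab \<alpha> \<beta>) f"
  proof
    show "cyc_span (Sab \<alpha> \<beta>) f \<subseteq> M" by (rule cyc_span_subset[OF sub inv fM])
    let ?N = "cyc_span (Sab \<alpha> \<beta>) f"
    have pH: "(Sab \<alpha> \<beta> ^^ n) f \<in> Hab \<alpha> \<beta>" for n
      by (induction n) (auto simp: fH Sab_in_Hab)
    \<comment> \<open>Linearity of \<open>S\<close> propagates the relation for \<open>S f - w f\<close> along the orbit of \<open>f\<close>.\<close>
    have step: "(Sab \<alpha> \<beta> ^^ Suc n) f - hscale eigval ((Sab \<alpha> \<beta> ^^ n) f) = hscale c ((mult_z ^^ n) ?T)" for n
    proof (induction n)
      case 0
      show ?case using Sf by simp
    next
      case (Suc n)
      have "(Sab \<alpha> \<beta> ^^ Suc (Suc n)) f - hscale eigval ((Sab \<alpha> \<beta> ^^ Suc n) f)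
          = Sab \<alpha> \<beta> ((Sab \<alpha> \<beta> ^^ Suc n) f - hscale eigval ((Sab \<alpha> \<beta> ^^ n) f))"
        using Sab_diff_hscale[OF pH pH, of "Suc n" eigval n] by simp
      also have "\<dots> = Sab \<alpha> \<beta> ((mult_z ^^ 2) (hscale c ((mult_z ^^ n) T)))"
        unfolding Suc mult_z_power_hscale mult_z_power_commute[of n 2] ..
      also have "\<dots> = hscale c ((mult_z ^^ Suc n) ?T)"
        unfolding Sab_shift
        by (rule hardy_eqI) (simp add: hfun_mult_z hfun_mult_z_power hfun_hscale)
      finally show ?case .
    qed
    have "(mult_z ^^ n) ?T \<in> ?N" for n
    proof -
      have "hscale c ((mult_z ^^ n) ?T) \<in> ?N"
        unfolding step[symmetric]
        by (intro H2.subspace_diff H2.subspace_scale H2_subspace_cyc_span power_in_cyc_span)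
      from H2.subspace_scale[OF H2_subspace_cyc_span this, of "1 / c"] show ?thesis
        using c0 by simp
    qed
    hence "hmul ?T k \<in> ?N" for k
      by (rule hmul_in_closed_subspace[OF so2 H2_subspace_cyc_span closed_cyc_span])
    moreover have "hscale a f \<in> ?N" for a
      using power_in_cyc_span[where n = 0 and S = "Sab \<alpha> \<beta>" and h = f]
      by (intro H2.subspace_scale H2_subspace_cyc_span) simp
    ultimately show "M \<subseteq> ?N"
      unfolding M using H2.subspace_add[OF H2_subspace_cyc_span] by blast
  qed
qed

text \<open>
  The space \<open>N = {g. z\<^sup>2 g \<in> M}\<close> is shift-invariant, and Beurling's theorem applies to it. If \<open>M\<close>
  contains \<open>f\<^sub>0 + z\<^sup>2 g\<^sub>1\<close>, then \<open>N\<close> is nonzero because \<open>\<beta> + (z - w) g\<^sub>1\<close>, which takes the value \<open>\<beta>\<close> at \<open>w\<close>, belongs to it.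
\<close>
lemma invariant_imp_form:
  assumes sub: "H2_subspace M" "closed M" and MH: "M \<subseteq> Hab \<alpha> \<beta>" and M0: "M \<noteq> {0}"
    and inv: "Sab \<alpha> \<beta> ` M \<subseteq> M"
  obtains \<theta> where "shift_orthonormal \<theta>"
    "M = range (hmul ((mult_z ^^ 2) \<theta>)) \<or> (\<exists>g f. second_form \<alpha> \<beta> (hfun \<theta>) g f M)"
proof -
  define N where "N = {g. (mult_z ^^ 2) g \<in> M}"
  have subN: "H2_subspace N"
  proof -
    have "(mult_z ^^ 2) 0 = 0"
      by (rule hardy_eqI) (simp add: hfun_mult_z_power hfun_zero)
    thus ?thesis
      using sub(1) unfolding N_def H2.subspace_def
      by (simp add: mult_z_power_add mult_z_power_hscale del: funpow.simps)
  qed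
  have clN: "closed N"
  proof (rule closed_sequential_limits[THEN iffD2], intro allI impI, elim conjE)
    fix X l assume X: "\<forall>n. X n \<in> N" "X \<longlonglongrightarrow> l"
    have "(\<lambda>n. (mult_z ^^ 2) (X n)) \<longlonglongrightarrow> (mult_z ^^ 2) l"
      by (simp add: numeral_2_eq_2) (intro tendsto_mult_z X)
    thus "l \<in> N"
      using X(1) closed_sequentially[OF sub(2), of "\<lambda>n. (mult_z ^^ 2) (X n)"] by (simp add: N_def)
  qed
  have zN: "mult_z ` N \<subseteq> N"
  proof
    fix x assume "x \<in> mult_z ` N"
    then obtain g where g: "x = mult_z g" "(mult_z ^^ 2) g \<in> M" by (auto simp: N_def)
    hence "Sab \<alpha> \<beta> ((mult_z ^^ 2) g) \<in> M" using inv by blast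
    thus "x \<in> N" unfolding N_def g(1) Sab_shift by simp
  qed
  show ?thesis
  proof (cases "M \<subseteq> range (mult_z ^^ 2)")
    case True
    have MN: "M = (mult_z ^^ 2) ` N"
      using True by (auto simp: N_def)
    have "N \<noteq> {0}"
    proof
      assume "N = {0}"
      hence "M = {(mult_z ^^ 2) 0}" using MN by simp
      also have "(mult_z ^^ 2) 0 = 0"
        by (rule hardy_eqI) (simp add: hfun_mult_z_power hfun_zero)
      finally show False using M0 by simp
    qed
    then obtain \<theta> where th: "shift_orthonormal \<theta>" "N = range (hmul \<theta>)"
      using Beurling_shift_orthonormal[OF subN clN zN] by blast
    have "M = range (hmul ((mult_z ^^ 2) \<theta>))"
      unfolding MN th(2) hmul_mult_z_power[OF th(1), abs_def] by blast
    with th(1) show ?thesis using that by blast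
  next
    case False
    then obtain h where h: "h \<in> M" "h \<notin> range (mult_z ^^ 2)" by blast
    then obtain a k where hk: "h = hscale a (f0 \<alpha> \<beta>) + (mult_z ^^ 2) k"
      using MH Hab_iff by blast
    have a0: "a \<noteq> 0" using h(2) hk by auto
    define g1 where "g1 = hscale (1 / a) k"
    have f1: "f0 \<alpha> \<beta> + (mult_z ^^ 2) g1 \<in> M"
    proof -
      have "hscale (1 / a) h = f0 \<alpha> \<beta> + (mult_z ^^ 2) g1"
        by (rule hardy_eqI)
           (use a0 in \<open>simp add: hk g1_def hfun_add hfun_hscale hfun_mult_z_power distrib_left\<close>)
      thus ?thesis using H2.subspace_scale[OF sub(1) h(1), of "1 / a"] by simp
    qed
    have key: "hscale \<beta> (hmonom 0) + mult_z g - hscale eigval g \<in> N"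
      if g: "f0 \<alpha> \<beta> + (mult_z ^^ 2) g \<in> M" for g
    proof -
      have "Sab \<alpha> \<beta> (f0 \<alpha> \<beta> + (mult_z ^^ 2) g) \<in> M" using inv g by blast
      hence "Sab \<alpha> \<beta> (f0 \<alpha> \<beta> + (mult_z ^^ 2) g) - hscale eigval (f0 \<alpha> \<beta> + (mult_z ^^ 2) g) \<in> M"
        using g by (intro H2.subspace_diff H2.subspace_scale sub)
      thus ?thesis unfolding Sab_f0_plus_shift N_def by simp
    qed
    have at_w: "hfun (hscale \<beta> (hmonom 0) + mult_z g - hscale eigval g) eigval = \<beta>" for g
      using eigval_in_ball by (simp add: hfun_diff hfun_add hfun_hscale hfun_mult_z hfun_hmonom)
    have "N \<noteq> {0}"
    proof
      assume "N = {0}"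
      hence "hscale \<beta> (hmonom 0) + mult_z g1 - hscale eigval g1 = 0" using key[OF f1] by simp
      hence "\<beta> = hfun 0 eigval" using at_w[of g1] by simp
      thus False using nz by (simp add: hfun_zero)
    qed
    then obtain \<theta> where so: "shift_orthonormal \<theta>" and Nth: "N = range (hmul \<theta>)"
      using Beurling_shift_orthonormal[OF subN clN zN] by blast
    obtain q where q: "\<And>n. hcoeff q n = hinner g1 ((mult_z ^^ n) \<theta>)"
      by (rule hardy_of_coeffs[OF Bessel[OF shift_orthonormalD[OF so], of g1]]) blast
    define g where "g = g1 - hmul \<theta> q"
    have g_orth: "hinner g ((mult_z ^^ n) \<theta>) = 0" for n
      by (simp add: g_def hinner_simps hinner_hmul_shift[OF so] q)
    have g_orth': "hinner g (hmul \<theta> k) = 0" for k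
      by (rule hinner_hmul_right_eq_0[OF so g_orth])
    define f where "f = f0 \<alpha> \<beta> + (mult_z ^^ 2) g"
    have fM: "f \<in> M"
    proof -
      have "f = (f0 \<alpha> \<beta> + (mult_z ^^ 2) g1) - (mult_z ^^ 2) (hmul \<theta> q)"
        by (rule hardy_eqI)
           (simp add: f_def g_def hfun_add hfun_diff hfun_mult_z_power right_diff_distrib)
      moreover have "(mult_z ^^ 2) (hmul \<theta> q) \<in> M" using Nth N_def by blast
      ultimately show ?thesis
        using f1 by (simp only:) (intro H2.subspace_diff sub)
    qed
    define d where "d = hscale \<beta> (hmonom 0) + mult_z g - hscale eigval g"
    have "d \<in> N" unfolding d_def by (rule key) (use fM f_def in simp)
    then obtain \<kappa> where \<kappa>: "d = hmul \<theta> \<kappa>" using Nth by blast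
    \<comment> \<open>The \<open>n\<close>-th coefficient of \<open>\<kappa>\<close> is the inner product of \<open>d\<close> with \<open>z\<^sup>n \<theta>\<close>, which kills all three summands of \<open>d\<close>.\<close>
    have k0: "hcoeff \<kappa> n = 0" if "n > 0" for n
    proof -
      obtain m where m: "n = Suc m" using \<open>n > 0\<close> by (cases n) auto
      have "hinner (hmonom 0) ((mult_z ^^ n) \<theta>) = cnj (hcoeff ((mult_z ^^ n) \<theta>) 0)"
        by (metis hinner_commute hinner_hmonom)
      also have "\<dots> = 0" using that by (simp add: hcoeff_mult_z_power)
      finally have 1: "hinner (hmonom 0) ((mult_z ^^ n) \<theta>) = 0" .
      have 2: "hinner (mult_z g) ((mult_z ^^ n) \<theta>) = 0"
        by (simp add: m hinner_mult_z g_orth)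
      have "hcoeff \<kappa> n = hinner d ((mult_z ^^ n) \<theta>)"
        unfolding \<kappa> by (rule hinner_hmul_shift[OF so, symmetric])
      also have "\<dots> = 0"
        unfolding d_def hinner_simps 1 2 g_orth by simp
      finally show ?thesis .
    qed
    have \<kappa>_const: "\<kappa> = hscale (hcoeff \<kappa> 0) (hmonom 0)"
      by (rule hardy_eq_hcoeffI) (use k0 in \<open>auto simp: hcoeff_hscale hcoeff_hmonom\<close>)
    have dz: "hfun d z = hfun \<theta> z * hcoeff \<kappa> 0" if "z \<in> ball 0 1" for z
    proof -
      have "hfun \<kappa> z = hcoeff \<kappa> 0"
        using that arg_cong[OF \<kappa>_const, of "\<lambda>f. hfun f z"] by (simp add: hfun_hscale hfun_hmonom)
      thus ?thesis by (simp add: \<kappa> hfun_hmul[OF so])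
    qed
    have bw: "\<beta> = hfun \<theta> eigval * hcoeff \<kappa> 0"
      using dz[OF eigval_in_ball] at_w[of g] by (simp add: d_def)
    hence tw: "hfun \<theta> eigval \<noteq> 0" using nz by auto
    have kap: "hcoeff \<kappa> 0 = \<beta> / hfun \<theta> eigval"
      unfolding nonzero_eq_divide_eq[OF tw] using bw by (simp only: mult.commute)
    have range2: "mult_range (\<lambda>z. z\<^sup>2 * hfun \<theta> z) = range (hmul ((mult_z ^^ 2) \<theta>))"
      by (rule mult_range_inner_function(2)[OF _ so]) simp
    have "second_form \<alpha> \<beta> (hfun \<theta>) g f M"
      unfolding second_form_def Let_def
    proof (intro conjI ballI)
      show "hfun \<theta> eigval \<noteq> 0" by (rule tw)
      show "g \<in> orth_compl (mult_range (hfun \<theta>))"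
        unfolding mult_range_hfun[OF so] orth_compl_def using g_orth' by blast
      show "f = f0 \<alpha> \<beta> + mult_z (mult_z g)"
        by (simp add: f_def numeral_2_eq_2)
    next
      fix z :: complex assume z: "z \<in> ball 0 1"
      have "\<beta> + (z - eigval) * hfun g z = hfun d z"
        using z by (simp add: d_def hfun_diff hfun_add hfun_hscale hfun_mult_z hfun_hmonom algebra_simps)
      hence "(z - eigval) * hfun g z = hfun d z - \<beta>" by (simp add: algebra_simps)
      also have "\<dots> = hfun \<theta> z * (\<beta> / hfun \<theta> eigval) - \<beta>"
        using dz[OF z] kap by simp
      also have "\<dots> = \<beta> / hfun \<theta> eigval * (hfun \<theta> z - hfun \<theta> eigval)"
        using tw by (simp add: field_simps)
      finally show "(z - eigval) * hfun g z = \<beta> / hfun \<theta> eigval * (hfun \<theta> z - hfun \<theta> eigval)" .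
    next
      show "is_orth_sum M (range (\<lambda>c. hscale c f)) (mult_range (\<lambda>z. z\<^sup>2 * hfun \<theta> z))"
        unfolding is_orth_sum_def range2 hmul_mult_z_power[OF so, abs_def]
      proof (intro conjI ballI)
        fix a b assume "a \<in> range (\<lambda>c. hscale c f)" "b \<in> range (\<lambda>k. (mult_z ^^ 2) (hmul \<theta> k))"
        then obtain c k where "a = hscale c f" "b = (mult_z ^^ 2) (hmul \<theta> k)" by blast
        thus "hinner a b = 0"
          by (simp add: f_def hinner_simps hinner_f0_shift hinner_mult_z_power g_orth' del: funpow.simps)
      next
        show "M = {a + b |a b. a \<in> range (\<lambda>c. hscale c f) \<and> b \<in> range (\<lambda>k. (mult_z ^^ 2) (hmul \<theta> k))}"
          (is "M = ?R")
        proof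
          show "?R \<subseteq> M"
          proof
            fix x assume "x \<in> ?R"
            then obtain c k where x: "x = hscale c f + (mult_z ^^ 2) (hmul \<theta> k)" by blast
            have "(mult_z ^^ 2) (hmul \<theta> k) \<in> M" using Nth N_def by blast
            thus "x \<in> M" unfolding x by (intro H2.subspace_add H2.subspace_scale sub fM)
          qed
          show "M \<subseteq> ?R"
          proof
            fix x assume x: "x \<in> M"
            then obtain c k where xk: "x = hscale c (f0 \<alpha> \<beta>) + (mult_z ^^ 2) k"
              using MH Hab_iff by blast
            have "x - hscale c f = (mult_z ^^ 2) (k - hscale c g)"
              by (rule hardy_eqI)
                 (simp add: xk f_def hfun_diff hfun_add hfun_hscale hfun_mult_z_power algebra_simps)
            moreover have "x - hscale c f \<in> M"
              by (intro H2.subspace_diff H2.subspace_scale sub x fM)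
            ultimately have "k - hscale c g \<in> N" by (simp add: N_def)
            then obtain l where "k - hscale c g = hmul \<theta> l" using Nth by blast
            hence "x = hscale c f + (mult_z ^^ 2) (hmul \<theta> l)"
              using \<open>x - hscale c f = _\<close> by (metis add.commute diff_add_cancel)
            thus "x \<in> ?R" by blast
          qed
        qed
      qed
    qed
    with so show ?thesis using that by blast
  qed
qed

end

theorem theorem3p5:
  fixes \<alpha> \<beta> :: complex and M :: "hardy set"
  assumes "\<alpha> \<noteq> 0" and "\<beta> \<noteq> 0" and "(cmod \<alpha>)\<^sup>2 + (cmod \<beta>)\<^sup>2 = 1"
    and "H2_subspace M" and "closed M" and "M \<subseteq> Hab \<alpha> \<beta>" and "M \<noteq> {0}"
  shows "(Sab \<alpha> \<beta> ` M \<subseteq> M \<longleftrightarrow>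
           (\<exists>\<theta>. inner_function \<theta> \<and>
              (M = mult_range (\<lambda>z. z\<^sup>2 * \<theta> z) \<or> (\<exists>g f. second_form \<alpha> \<beta> \<theta> g f M))))
       \<and> (Sab \<alpha> \<beta> ` M \<subseteq> M \<longrightarrow> is_cyclic (Sab \<alpha> \<beta>) M)
       \<and> (\<forall>\<theta> g f. inner_function \<theta> \<and> second_form \<alpha> \<beta> \<theta> g f M \<longrightarrow> M = cyc_span (Sab \<alpha> \<beta>) f)"
    (is "(?inv \<longleftrightarrow> ?form) \<and> (?inv \<longrightarrow> ?cyc) \<and> ?gen")
proof -
  have forward: ?form if inv: ?inv
  proof -
    obtain \<theta> where so: "shift_orthonormal \<theta>"
      and form: "M = range (hmul ((mult_z ^^ 2) \<theta>)) \<or> (\<exists>g f. second_form \<alpha> \<beta> (hfun \<theta>) g f M)"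
      using invariant_imp_form[OF assms(1-7) inv] by blast
    have "mult_range (\<lambda>z. z\<^sup>2 * hfun \<theta> z) = range (hmul ((mult_z ^^ 2) \<theta>))"
      by (rule mult_range_inner_function(2)[OF _ so]) simp
    with form shift_orthonormal_imp_inner_function[OF so] show ?thesis by auto
  qed
  have backward: "?inv \<and> ?cyc" if form: ?form
  proof -
    obtain \<theta> where inner: "inner_function \<theta>"
      and form: "M = mult_range (\<lambda>z. z\<^sup>2 * \<theta> z) \<or> (\<exists>g f. second_form \<alpha> \<beta> \<theta> g f M)"
      using form by blast
    from form show ?thesis
    proof
      assume M: "M = mult_range (\<lambda>z. z\<^sup>2 * \<theta> z)"
      obtain T where T: "\<And>z. z \<in> ball 0 1 \<Longrightarrow> hfun T z = \<theta> z" and so: "shift_orthonormal T"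
        by (rule inner_function_imp_shift_orthonormal[OF inner]) blast
      have "M = range (hmul ((mult_z ^^ 2) T))"
        unfolding M by (rule mult_range_inner_function(2)[OF T so])
      from first_form_invariant_cyclic[OF assms(1-3) so this assms(4,5)] show ?thesis by blast
    next
      assume "\<exists>g f. second_form \<alpha> \<beta> \<theta> g f M"
      then obtain g f where sf: "second_form \<alpha> \<beta> \<theta> g f M" by blast
      note * = second_form_invariant_cyclic[OF assms(1-3) inner sf assms(4,5)]
      show ?thesis
        unfolding is_cyclic_def using * assms(4,5) by blast
    qed
  qed
  have ?gen
    using second_form_invariant_cyclic(2)[OF assms(1-3) _ _ assms(4,5)] by blast
  with forward backward show ?thesis by blast
qed

end
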